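(* Let $n\ge2$, let $\varphi$ satisfy (i)–(vi) of the context, let $\Omega\subset\mathbb{R}^n$ be a domain, and for $h=1,\dots,n$ let $\mathscr{A}^h(x)$ be an $m\times m$ matrix with complex-valued entries in $L^1_{\rm loc}(\Omega)$. Let $Au=\sum_{h=1}^n\partial_h(\mathscr{A}^h(x)\partial_hu)$, and set $\mathscr{A}^{hk}=\mathscr{A}^h$ if $h=k$ and $\mathscr{A}^{hk}=0$ if $h\ne k$. Assume $\Lambda_\infty^2=\sup_{t>0}\Lambda^2(t)<1$. Then the following statements are equivalent: (a) the operator $A$ is strict $L^\Phi$-dissipative; (b) there exists $\kappa>0$ such that $A-\kappa\Delta$ is $L^\Phi$-dissipative, where $(A-\kappa\Delta)u=\sum_h\partial_h((\mathscr{A}^h-\kappa I)\partial_hu)$; (c) the coefficients $\{\mathscr{A}^{hk}\}$ satisfy the integral $\Phi$-ellipticity condition; (d) the coefficients $\{\mathscr{A}^{hk}\}$ satisfy the weak $\Phi$-ellipticity condition. Moreover, if the coefficients $\{\mathscr{A}^{hk}\}$ satisfy the strong $\Phi$-ellipticity condition, then (a)–(d) hold.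
   Context: Conditions on $\varphi:(0,+\infty)\to(0,+\infty)$: (i) $\varphi\in C^1((0,+\infty))$; (ii) $(s\varphi(s))'>0$ for all $s>0$; (iii) the range of $s\mapsto s\varphi(s)$ is $(0,+\infty)$; (iv) there are $s_0>0$, $C_1,C_2>0$ and a real $r>-1$ with $C_1s^r\le(s\varphi(s))'\le C_2s^r$ for $s\in(0,s_0)$, and if $r=0$ moreover the finite limit $\lim_{s\to0^+}\varphi(s)>0$ exists and $\lim_{s\to0^+}s\varphi'(s)=0$; (v) there is $s_1>s_0$ such that either $\varphi'(s)\ge0$ for all $s\ge s_1$ or $\varphi'(s)\le0$ for all $s\ge s_1$; (vi) $s\mapsto|s\varphi'(s)/\varphi(s)|$ is non-decreasing on $(0,+\infty)$. The function $\Lambda$ on $(0,+\infty)$ is defined by $\Lambda(s\sqrt{\varphi(s)})=-\dfrac{s\varphi'(s)}{s\varphi'(s)+2\varphi(s)}$, $s>0$. Under (i)–(vi), $\Lambda$ is monotone with constant sign and $\Lambda^2$ is non-decreasing; $\Lambda_\infty:=\lim_{t\to+\infty}\Lambda(t)$, so $\Lambda_\infty^2=\sup_{t>0}\Lambda^2(t)$. $\langle\cdot,\cdot\rangle$ is the standard Hermitian inner product on $\mathbb{C}^m$, $|\cdot|$ its norm, $^*$ denotes the conjugate transpose; $C^1_0(\Omega)$ is the space of complex-valued $C^1$ functions with compact support in $\Omega$; $\varphi(|u|)u$ and $\sqrt{\varphi(|u|)}\,u$ are understood as $0$ where $u=0$. Repeated indices $h,k$ are summed from $1$ to $n$. For a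 system $\partial_h(\mathscr{A}^{hk}(x)\partial_k)$ with $m\times m$ complex $L^1_{\rm loc}(\Omega)$ matrices $\mathscr{A}^{hk}$: - It is $L^\Phi$-dissipative if $\mathrm{Re}\int_\Omega\langle\mathscr{A}^{hk}\partial_ku,\partial_h(\varphi(|u|)u)\rangle dx\ge0$ for all $u\in[C^1_0(\Omega)]^m$ such that $\varphi(|u|)u\in[C^1_0(\Omega)]^m$; it is strict $L^\Phi$-dissipative if for some $\kappa>0$ the same integral is $\ge\kappa\int_\Omega|\nabla(\sqrt{\varphi(|u|)}\,u)|^2dx$ for all such $u$. - Strong $\Phi$-ellipticity: there is $\kappa>0$ such that $\mathrm{Re}\langle\mathscr{A}^{hk}(x)\xi_k,\xi_h\rangle+\Lambda(t)\,\mathrm{Re}\langle(\mathscr{A}^{hk}(x)-(\mathscr{A}^{kh})^*(x))\omega,\xi_h\rangle\,\mathrm{Re}\langle\omega,\xi_k\rangle-\Lambda^2(t)\,\mathrm{Re}\langle\mathscr{A}^{hk}(x)\omega,\omega\rangle\,\mathrm{Re}\langle\omega,\xi_k\rangle\,\mathrm{Re}\langle\omega,\xi_h\rangle\ge\kappa|\xi|^2$ for all $\xi=(\xi_1,\dots,\xi_n)$ with $\xi_h\in\mathbb{C}^m$, all $\omega\in\mathbb{C}^m$ with $|\omega|=1$, all $t>0$ and almost every $x\in\Omega$. - Integral $\Phi$-ellipticity: there is $\kappa>0$ such that for all $v\in[C^1_0(\Omega)]^m$, $\mathrm{Re}\int_\Omega\big(\langle\mathscr{A}^{hk}\partial_kv,\partial_hv\rangle+\Lambda(|v|)|v|^{-2}\langle(\mathscr{A}^{hk}-(\mathscr{A}^{kh})^*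 )v,\partial_hv\rangle\mathrm{Re}\langle v,\partial_kv\rangle-\Lambda^2(|v|)|v|^{-4}\langle\mathscr{A}^{hk}v,v\rangle\mathrm{Re}\langle v,\partial_kv\rangle\mathrm{Re}\langle v,\partial_hv\rangle\big)dx\ge\kappa\int_\Omega|\nabla v|^2dx$, the integrand on the left being extended by zero where $v=0$. - Weak (Legendre–Hadamard) $\Phi$-ellipticity: there is $\kappa>0$ such that, with $\mathscr{A}_q(x)=\mathscr{A}^{hk}(x)q_hq_k$, $\mathrm{Re}\langle\mathscr{A}_q(x)\lambda,\lambda\rangle-\Lambda^2(t)\mathrm{Re}\langle\mathscr{A}_q(x)\omega,\omega\rangle(\mathrm{Re}\langle\lambda,\omega\rangle)^2+\Lambda(t)\mathrm{Re}(\langle\mathscr{A}_q(x)\omega,\lambda\rangle-\langle\mathscr{A}_q(x)\lambda,\omega\rangle)\mathrm{Re}\langle\lambda,\omega\rangle\ge\kappa|q|^2|\lambda|^2$ for all $q\in\mathbb{R}^n$, $\lambda,\omega\in\mathbb{C}^m$ with $|\omega|=1$, $t>0$ and almost every $x\in\Omega$. *)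

theory Defs
  imports "HOL-Analysis.Analysis"
begin

definition phi_admissible :: "(real \<Rightarrow> real) \<Rightarrow> bool" where
  "phi_admissible \<phi> \<longleftrightarrow>
     (\<forall>s>0. \<phi> s > 0) \<and>
     (\<forall>s>0. \<phi> differentiable (at s)) \<and> continuous_on {0<..} (deriv \<phi>) \<and>
     (\<forall>s>0. deriv (\<lambda>s. s * \<phi> s) s > 0) \<and>
     (\<lambda>s. s * \<phi> s) ` {0<..} = {0<..} \<and>
     (\<exists>s0 C1 C2 r. s0 > 0 \<and> C1 > 0 \<and> C2 > 0 \<and> r > -1 \<and>
        (\<forall>s\<in>{0<..<s0}. C1 * s powr r \<le> deriv (\<lambda>s. s * \<phi> s) s \<and>
                         deriv (\<lambda>s. s * \<phi> s) s \<le> C2 * s powr r) \<and>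
        (r = 0 \<longrightarrow> (\<exists>l>0. (\<phi> \<longlongrightarrow> l) (at_right 0)) \<and>
                    ((\<lambda>s. s * deriv \<phi> s) \<longlongrightarrow> 0) (at_right 0)) \<and>
        (\<exists>s1>s0. (\<forall>s\<ge>s1. deriv \<phi> s \<ge> 0) \<or> (\<forall>s\<ge>s1. deriv \<phi> s \<le> 0))) \<and>
     mono_on {0<..} (\<lambda>s. \<bar>s * deriv \<phi> s / \<phi> s\<bar>)"

text \<open>For admissible \<open>\<phi>\<close> the map \<open>s \<mapsto> s * sqrt (\<phi> s)\<close> is a bijection of the positive half-line:
  its square is the product of \<open>s\<close> and \<open>s * \<phi> s\<close>, both of them increasing onto it.
  Only values of \<open>Lambda \<phi>\<close> at positive arguments are meaningful.\<close>

definition Lambda :: "(real \<Rightarrow> real) \<Rightarrow> real \<Rightarrow> real" where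
  "Lambda \<phi> t =
     (let s = the_inv_into {0<..} (\<lambda>s. s * sqrt (\<phi> s)) t
      in - (s * deriv \<phi> s) / (s * deriv \<phi> s + 2 * \<phi> s))"

definition Lambda_infinity :: "(real \<Rightarrow> real) \<Rightarrow> real" where
  "Lambda_infinity \<phi> = Lim at_top (Lambda \<phi>)"

definition hinner :: "complex^'m \<Rightarrow> complex^'m \<Rightarrow> complex" where
  "hinner u v = (\<Sum>i\<in>UNIV. u $ i * cnj (v $ i))"

definition conj_transpose :: "complex^'m^'m \<Rightarrow> complex^'m^'m" where
  "conj_transpose M = (\<chi> i j. cnj (M $ j $ i))"

text \<open>Functions on \<open>\<Omega>\<close> with compact support are represented by their extension by zero.\<close>

definition C1_0 :: "(real^'n) set \<Rightarrow> (real^'n \<Rightarrow> complex^'m) set" where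
  "C1_0 \<Omega> = {u.
     (\<exists>u'. (\<forall>x\<in>\<Omega>. (u has_derivative blinfun_apply (u' x)) (at x)) \<and> continuous_on \<Omega> u') \<and>
     compact (closure {x. u x \<noteq> 0}) \<and> closure {x. u x \<noteq> 0} \<subseteq> \<Omega>}"

definition L1_loc_matrix :: "(real^'n) set \<Rightarrow> (real^'n \<Rightarrow> complex^'m^'m) \<Rightarrow> bool" where
  "L1_loc_matrix \<Omega> M \<longleftrightarrow>
     (\<forall>i j K. compact K \<and> K \<subseteq> \<Omega> \<longrightarrow> (\<lambda>x. M x $ i $ j) absolutely_integrable_on K)"

definition partial_deriv :: "'n \<Rightarrow> (real^'n \<Rightarrow> complex^'m) \<Rightarrow> real^'n \<Rightarrow> complex^'m" where
  "partial_deriv h u x = frechet_derivative u (at x) (axis h 1)"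

definition grad_sq :: "(real^'n \<Rightarrow> complex^'m) \<Rightarrow> real^'n \<Rightarrow> real" where
  "grad_sq u x = (\<Sum>h\<in>UNIV. (norm (partial_deriv h u x))\<^sup>2)"

text \<open>Where \<open>u x = 0\<close> the vectors \<open>phi_mult \<phi> u x\<close> and \<open>sqrt_phi_mult \<phi> u x\<close> vanish,
  whatever the value of \<open>\<phi>\<close> at \<open>0\<close>.\<close>

definition phi_mult :: "(real \<Rightarrow> real) \<Rightarrow> (real^'n \<Rightarrow> complex^'m) \<Rightarrow> real^'n \<Rightarrow> complex^'m" where
  "phi_mult \<phi> u x = \<phi> (norm (u x)) *\<^sub>R u x"

definition sqrt_phi_mult :: "(real \<Rightarrow> real) \<Rightarrow> (real^'n \<Rightarrow> complex^'m) \<Rightarrow> real^'n \<Rightarrow> complex^'m" where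
  "sqrt_phi_mult \<phi> u x = sqrt (\<phi> (norm (u x))) *\<^sub>R u x"

definition phi_test_functions ::
    "(real \<Rightarrow> real) \<Rightarrow> (real^'n) set \<Rightarrow> (real^'n \<Rightarrow> complex^'m) set" where
  "phi_test_functions \<phi> \<Omega> = {u. u \<in> C1_0 \<Omega> \<and> phi_mult \<phi> u \<in> C1_0 \<Omega>}"

definition phi_form ::
    "(real \<Rightarrow> real) \<Rightarrow> (real^'n) set \<Rightarrow> ('n \<Rightarrow> 'n \<Rightarrow> real^'n \<Rightarrow> complex^'m^'m) \<Rightarrow>
     (real^'n \<Rightarrow> complex^'m) \<Rightarrow> complex" where
  "phi_form \<phi> \<Omega> A u =
     (LINT x:\<Omega>|lebesgue. (\<Sum>h\<in>UNIV. \<Sum>k\<in>UNIV.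
        hinner (A h k x *v partial_deriv k u x) (partial_deriv h (phi_mult \<phi> u) x)))"

definition LPhi_dissipative ::
    "(real \<Rightarrow> real) \<Rightarrow> (real^'n) set \<Rightarrow> ('n \<Rightarrow> 'n \<Rightarrow> real^'n \<Rightarrow> complex^'m^'m) \<Rightarrow> bool" where
  "LPhi_dissipative \<phi> \<Omega> A \<longleftrightarrow>
     (\<forall>u \<in> phi_test_functions \<phi> \<Omega>. Re (phi_form \<phi> \<Omega> A u) \<ge> 0)"

text \<open>For admissible \<open>\<phi>\<close> and \<open>u\<close> a test function, \<open>sqrt_phi_mult \<phi> u\<close> is classically differentiable
  also at zeros of \<open>u\<close>: there \<open>|sqrt (\<phi>(|u|)) u|\<^sup>2 = |u| |\<phi>(|u|) u|\<close>, and the growth condition at \<open>0\<close>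
  makes one factor \<open>o\<close> of the other if \<open>r \<noteq> 0\<close>, while \<open>\<phi>\<close> has a limit at \<open>0\<close> if \<open>r = 0\<close>.
  So no weak derivative is needed.\<close>

definition strict_LPhi_dissipative ::
    "(real \<Rightarrow> real) \<Rightarrow> (real^'n) set \<Rightarrow> ('n \<Rightarrow> 'n \<Rightarrow> real^'n \<Rightarrow> complex^'m^'m) \<Rightarrow> bool" where
  "strict_LPhi_dissipative \<phi> \<Omega> A \<longleftrightarrow>
     (\<exists>\<kappa>>0. \<forall>u \<in> phi_test_functions \<phi> \<Omega>.
        Re (phi_form \<phi> \<Omega> A u) \<ge> \<kappa> * (LINT x:\<Omega>|lebesgue. grad_sq (sqrt_phi_mult \<phi> u) x))"

definition strong_Phi_elliptic ::
    "(real \<Rightarrow> real) \<Rightarrow> (real^'n) set \<Rightarrow> ('n \<Rightarrow> 'n \<Rightarrow> real^'n \<Rightarrow> complex^'m^'m) \<Rightarrow> bool" where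
  "strong_Phi_elliptic \<phi> \<Omega> A \<longleftrightarrow>
     (\<exists>\<kappa>>0. AE x\<in>\<Omega> in lebesgue.
        \<forall>(\<xi>::complex^'m^'n) \<omega> t. norm \<omega> = 1 \<longrightarrow> t > 0 \<longrightarrow>
          (\<Sum>h\<in>UNIV. \<Sum>k\<in>UNIV.
             Re (hinner (A h k x *v (\<xi> $ k)) (\<xi> $ h))
             + Lambda \<phi> t * Re (hinner ((A h k x - conj_transpose (A k h x)) *v \<omega>) (\<xi> $ h))
                 * Re (hinner \<omega> (\<xi> $ k))
             - (Lambda \<phi> t)\<^sup>2 * Re (hinner (A h k x *v \<omega>) \<omega>)
                 * Re (hinner \<omega> (\<xi> $ k)) * Re (hinner \<omega> (\<xi> $ h)))
          \<ge> \<kappa> * (norm \<xi>)\<^sup>2)"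

definition integral_Phi_integrand ::
    "(real \<Rightarrow> real) \<Rightarrow> ('n \<Rightarrow> 'n \<Rightarrow> real^'n \<Rightarrow> complex^'m^'m) \<Rightarrow>
     (real^'n \<Rightarrow> complex^'m) \<Rightarrow> real^'n \<Rightarrow> complex" where
  "integral_Phi_integrand \<phi> A v x =
     (if v x = 0 then 0 else
        (\<Sum>h\<in>UNIV. \<Sum>k\<in>UNIV.
           hinner (A h k x *v partial_deriv k v x) (partial_deriv h v x)
           + of_real (Lambda \<phi> (norm (v x)) / (norm (v x))\<^sup>2)
               * hinner ((A h k x - conj_transpose (A k h x)) *v v x) (partial_deriv h v x)
               * of_real (Re (hinner (v x) (partial_deriv k v x)))
           - of_real ((Lambda \<phi> (norm (v x)))\<^sup>2 / (norm (v x))^4)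
               * hinner (A h k x *v v x) (v x)
               * of_real (Re (hinner (v x) (partial_deriv k v x)))
               * of_real (Re (hinner (v x) (partial_deriv h v x)))))"

definition integral_Phi_elliptic ::
    "(real \<Rightarrow> real) \<Rightarrow> (real^'n) set \<Rightarrow> ('n \<Rightarrow> 'n \<Rightarrow> real^'n \<Rightarrow> complex^'m^'m) \<Rightarrow> bool" where
  "integral_Phi_elliptic \<phi> \<Omega> A \<longleftrightarrow>
     (\<exists>\<kappa>>0. \<forall>v \<in> C1_0 \<Omega>.
        Re (LINT x:\<Omega>|lebesgue. integral_Phi_integrand \<phi> A v x)
        \<ge> \<kappa> * (LINT x:\<Omega>|lebesgue. grad_sq v x))"

definition symbol_matrix ::
    "('n \<Rightarrow> 'n \<Rightarrow> real^'n \<Rightarrow> complex^'m^'m) \<Rightarrow> real^'n \<Rightarrow> real^'n \<Rightarrow> complex^'m^'m" where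
  "symbol_matrix A q x = (\<Sum>h\<in>UNIV. \<Sum>k\<in>UNIV. (q $ h * q $ k) *\<^sub>R A h k x)"

definition weak_Phi_elliptic ::
    "(real \<Rightarrow> real) \<Rightarrow> (real^'n) set \<Rightarrow> ('n \<Rightarrow> 'n \<Rightarrow> real^'n \<Rightarrow> complex^'m^'m) \<Rightarrow> bool" where
  "weak_Phi_elliptic \<phi> \<Omega> A \<longleftrightarrow>
     (\<exists>\<kappa>>0. AE x\<in>\<Omega> in lebesgue.
        \<forall>q \<eta> \<omega> t. norm \<omega> = 1 \<longrightarrow> t > 0 \<longrightarrow>
          Re (hinner (symbol_matrix A q x *v \<eta>) \<eta>)
          - (Lambda \<phi> t)\<^sup>2 * Re (hinner (symbol_matrix A q x *v \<omega>) \<omega>) * (Re (hinner \<eta> \<omega>))\<^sup>2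
          + Lambda \<phi> t * Re (hinner (symbol_matrix A q x *v \<omega>) \<eta>
                             - hinner (symbol_matrix A q x *v \<eta>) \<omega>) * Re (hinner \<eta> \<omega>)
          \<ge> \<kappa> * (norm q)\<^sup>2 * (norm \<eta>)\<^sup>2)"

definition diag_system ::
    "('n \<Rightarrow> real^'n \<Rightarrow> complex^'m^'m) \<Rightarrow> 'n \<Rightarrow> 'n \<Rightarrow> real^'n \<Rightarrow> complex^'m^'m" where
  "diag_system A h k x = (if h = k then A h x else 0)"

end

theory Submission
  imports Defs
begin

text \<open>
  For a diagonal system all four conditions are equivalent to a pointwise one: for some \<open>\<kappa> > 0\<close>, almost
  every \<open>x\<close> and each \<open>h\<close>,
  \<open>Re \<langle>A\<^sup>h (\<eta> + \<Lambda>\<rho>\<omega>), \<eta> - \<Lambda>\<rho>\<omega>\<rangle> \<ge> \<kappa>|\<eta>|\<^sup>2\<close>, where \<open>\<rho> = Re \<langle>\<omega>, \<eta>\<rangle>\<close>. It is weak ellipticity because the symbol is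
  \<open>\<Sum>\<^sub>h q\<^sub>h\<^sup>2 A\<^sup>h\<close>, and strong ellipticity implies it by taking a single nonzero \<open>\<xi>\<^sub>h\<close>.
  With \<open>v = \<surd>\<phi>(|u|) u\<close> the integrands of \<open>L\<^sup>\<Phi>\<close>-dissipativity and of integral ellipticity have the same real part,
  so the pointwise condition integrates to the others. On \<open>{u = 0}\<close> all gradients involved vanish almost everywhere.

  Conversely, test with \<open>v = v\<^sub>0 + r\<^sup>-\<^sup>1 \<psi> cos (r\<^sup>2 x\<^sub>h) \<eta>\<close> and with its sine companion, where \<open>v\<^sub>0 = t\<omega>\<close> near a box containing
  the support of \<open>\<psi>\<close>. Adding both inequalities, dividing by \<open>r\<^sup>2\<close> and letting \<open>r \<rightarrow> \<infinity>\<close>, \<open>\<psi> \<rightarrow> 1\<close> gives the pointwise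
  inequality integrated over the box; Lebesgue differentiation and a countable dense set of parameters finish.
  Only in passing from \<open>A - \<kappa>\<Delta>\<close> back to \<open>A\<close> is \<open>\<Lambda>\<^sub>\<infinity>\<^sup>2 < 1\<close> used: the form of the identity is at least
  \<open>(1 - \<Lambda>\<^sub>\<infinity>\<^sup>2)|\<eta>|\<^sup>2\<close>.
\<close>

section \<open>The quadratic form\<close>

text \<open>The obstacle is that \<open>sqrt_phi_mult \<phi>\<close> does not match the two test
  classes. For a test function \<open>u\<close>, \<open>sqrt_phi_mult \<phi> u\<close> is not shown
  to be C^1; and a general C^1 function \<open>v\<close> need not come from a \<open>u\<close> for
  which both \<open>u\<close> and \<open>phi_mult \<phi> u\<close> are C^1, since \<phi> may blow up
  or vanish at 0. So sufficiency rests on identities almost everywhere, while necessity builds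
  \<open>v\<close> explicitly in both classes, and one argument then serves dissipativity and
  integral ellipticity. The base function \<open>v0\<close> is nonzero on the box because \<Lambda>
  has to be frozen at a prescribed \<open>t\<close> and direction \<omega>; it returns to 0 along a
  profile adapted to \<phi>. Cosine and sine are paired because their squared derivatives add up to
  1: the integrands then converge pointwise, and dominated convergence suffices for merely locally
  integrable coefficients.\<close>

lemma Re_hinner: "Re (hinner u v) = u \<bullet> v"
  by (simp add: hinner_def inner_vec_def inner_complex_def)

text \<open>The two Hermitian products are conjugate to each other, and real parts do not see
  conjugation.\<close>

lemma inner_conj_transpose: "(conj_transpose M *v u) \<bullet> v = (M *v v) \<bullet> u"
proof -
  have Re_cnj: "Re z = Re (cnj z)" for z by simp
  have "(conj_transpose M *v u) \<bullet> v = Re (\<Sum>i\<in>UNIV. \<Sum>j\<in>UNIV. cnj (M $ j $ i) * u $ j * cnj (v $ i))"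
    by (simp add: Re_hinner[symmetric] hinner_def conj_transpose_def matrix_vector_mult_def sum_distrib_right
        del: Re_sum)
  also have "\<dots> = Re (cnj (\<Sum>i\<in>UNIV. \<Sum>j\<in>UNIV. cnj (M $ j $ i) * u $ j * cnj (v $ i)))"
    using Re_cnj by blast
  also have "cnj (\<Sum>i\<in>UNIV. \<Sum>j\<in>UNIV. cnj (M $ j $ i) * u $ j * cnj (v $ i)) =
      (\<Sum>i\<in>UNIV. \<Sum>j\<in>UNIV. M $ j $ i * cnj (u $ j) * v $ i)"
    by simp
  also have "\<dots> = (\<Sum>j\<in>UNIV. \<Sum>i\<in>UNIV. M $ j $ i * cnj (u $ j) * v $ i)"
    by (rule sum.swap)
  also have "\<dots> = hinner (M *v v) u"
    by (simp add: hinner_def matrix_vector_mult_def sum_distrib_left sum_distrib_right mult_ac)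
  finally show ?thesis by (simp add: Re_hinner)
qed

lemma matrix_scaleR_vector: "(M :: complex^'n^'m) *v (c *\<^sub>R x) = c *\<^sub>R (M *v x)"
  by (simp add: vec_eq_iff matrix_vector_mult_def scaleR_sum_right)

lemma scaleR_matrix_vector: "(c *\<^sub>R (M :: complex^'n^'m)) *v x = c *\<^sub>R (M *v x)"
  by (simp add: vec_eq_iff matrix_vector_mult_def scaleR_sum_right)

lemma sum_matrix_vector: "(\<Sum>h\<in>S. M h :: complex^'n^'m) *v x = (\<Sum>h\<in>S. M h *v x)"
  by (induction S rule: infinite_finite_induct) (auto simp: matrix_vector_mult_add_rdistrib)

text \<open>A crude matrix norm, chosen because local integrability of the entries makes it
  integrable at once; the dominations below go through it.\<close>

definition entry_sum :: "complex^'n^'m \<Rightarrow> real" where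
  "entry_sum M = (\<Sum>i\<in>UNIV. \<Sum>j\<in>UNIV. norm (M $ i $ j))"

lemma entry_sum_nonneg: "0 \<le> entry_sum M"
  by (simp add: entry_sum_def sum_nonneg)

lemma norm_matrix_vector_le: "norm (M *v x) \<le> entry_sum M * norm x"
proof -
  have "norm (M *v x) \<le> (\<Sum>i\<in>UNIV. norm ((M *v x) $ i))"
    unfolding norm_vec_def by (rule L2_set_le_sum) simp
  also have "\<dots> \<le> (\<Sum>i\<in>UNIV. \<Sum>j\<in>UNIV. norm (M $ i $ j) * norm x)"
  proof (rule sum_mono)
    fix i
    have "norm ((M *v x) $ i) \<le> (\<Sum>j\<in>UNIV. norm (M $ i $ j * x $ j))"
      by (simp add: matrix_vector_mult_def norm_sum)
    also have "\<dots> \<le> (\<Sum>j\<in>UNIV. norm (M $ i $ j) * norm x)"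
      by (rule sum_mono) (simp add: norm_mult mult_left_mono Finite_Cartesian_Product.norm_nth_le)
    finally show "norm ((M *v x) $ i) \<le> (\<Sum>j\<in>UNIV. norm (M $ i $ j) * norm x)" .
  qed
  finally show ?thesis by (simp add: entry_sum_def sum_distrib_right)
qed

text \<open>With \<open>v = sqrt_phi_mult \<phi> u\<close>, \<open>\<omega> = v / |v|\<close>,
  \<eta> a partial derivative of \<open>v\<close>, \<open>l\<close> the value of \<Lambda> at
  \<open>|v|\<close> and \<open>q = sqrt (\<phi> |u|)\<close>, the two factors are \<open>q\<close>
  times the derivative of \<open>u\<close> and \<open>1/q\<close> times that of
  \<open>phi_mult \<phi> u\<close>. The product form is thus the dissipativity integrand, and its
  expansion the ellipticity one.\<close>

definition ell_form :: "complex^'m^'m \<Rightarrow> complex^'m \<Rightarrow> real \<Rightarrow> complex^'m \<Rightarrow> real" where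
  "ell_form M \<omega> l \<eta> =
     (M *v (\<eta> + (l * (\<omega> \<bullet> \<eta>)) *\<^sub>R \<omega>)) \<bullet> (\<eta> - (l * (\<omega> \<bullet> \<eta>)) *\<^sub>R \<omega>)"

lemma ell_form_expand:
  "ell_form M \<omega> l \<eta> = (M *v \<eta>) \<bullet> \<eta> + l * ((M *v \<omega>) \<bullet> \<eta> - (M *v \<eta>) \<bullet> \<omega>) * (\<omega> \<bullet> \<eta>)
     - l\<^sup>2 * ((M *v \<omega>) \<bullet> \<omega>) * (\<omega> \<bullet> \<eta>)\<^sup>2"
  by (simp add: ell_form_def matrix_vector_right_distrib matrix_scaleR_vector inner_simps
      algebra_simps power2_eq_square)

lemma ell_form_scale: "ell_form M \<omega> l (c *\<^sub>R \<eta>) = c\<^sup>2 * ell_form M \<omega> l \<eta>"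
  by (simp add: ell_form_expand matrix_scaleR_vector algebra_simps power2_eq_square)

lemma ell_form_zero [simp]: "ell_form M \<omega> l 0 = 0" "ell_form 0 \<omega> l \<eta> = 0"
  by (simp_all add: ell_form_def)

lemma ell_form_diff_id:
  "ell_form (M - \<kappa> *\<^sub>R mat 1) \<omega> l \<eta> = ell_form M \<omega> l \<eta> - \<kappa> * ell_form (mat 1) \<omega> l \<eta>"
  by (simp add: ell_form_def matrix_vector_mult_diff_rdistrib scaleR_matrix_vector inner_diff_left)

lemma ell_form_id:
  assumes "norm \<omega> = 1"
  shows "ell_form (mat 1) \<omega> l \<eta> = (norm \<eta>)\<^sup>2 - l\<^sup>2 * (\<omega> \<bullet> \<eta>)\<^sup>2"
proof -
  have "\<omega> \<bullet> \<omega> = 1" using assms by (simp add: dot_square_norm)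
  then show ?thesis
    by (simp add: ell_form_expand power2_norm_eq_inner inner_commute)
qed

text \<open>Cauchy-Schwarz confines the subtracted term between 0 and \<open>L |\<eta>|^2\<close>.
  The upper bound serves the passage from \<open>A\<close> to \<open>A - \<kappa>\<Delta>\<close>,
  the lower one the way back.\<close>

lemma ell_form_id_bounds:
  assumes "norm \<omega> = 1" "l\<^sup>2 \<le> L"
  shows "ell_form (mat 1) \<omega> l \<eta> \<le> (norm \<eta>)\<^sup>2" "(1 - L) * (norm \<eta>)\<^sup>2 \<le> ell_form (mat 1) \<omega> l \<eta>"
proof -
  have "(\<omega> \<bullet> \<eta>)\<^sup>2 \<le> (norm \<eta>)\<^sup>2"
    using Cauchy_Schwarz_ineq2[of \<omega> \<eta>] assms(1) by (simp add: abs_le_square_iff[symmetric])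
  then have "l\<^sup>2 * (\<omega> \<bullet> \<eta>)\<^sup>2 \<le> L * (norm \<eta>)\<^sup>2"
    using assms(2) by (intro mult_mono) (auto intro: order_trans[OF zero_le_power2])
  then show "(1 - L) * (norm \<eta>)\<^sup>2 \<le> ell_form (mat 1) \<omega> l \<eta>"
    by (simp add: ell_form_id[OF assms(1)] algebra_simps)
  show "ell_form (mat 1) \<omega> l \<eta> \<le> (norm \<eta>)\<^sup>2"
    by (simp add: ell_form_id[OF assms(1)])
qed

text \<open>Both factors of the form have length at most \<open>2 |\<eta>|\<close>, whence the 4.
  The condition on \<open>l\<close> holds for all values of \<Lambda>.\<close>

lemma ell_form_bound:
  assumes "norm \<omega> = 1" "\<bar>l\<bar> \<le> 1"
  shows "\<bar>ell_form M \<omega> l \<eta>\<bar> \<le> 4 * entry_sum M * (norm \<eta>)\<^sup>2"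
proof -
  have le: "norm ((l * (\<omega> \<bullet> \<eta>)) *\<^sub>R \<omega>) \<le> norm \<eta>"
  proof -
    have "\<bar>l\<bar> * \<bar>\<omega> \<bullet> \<eta>\<bar> \<le> 1 * norm \<eta>"
      using Cauchy_Schwarz_ineq2[of \<omega> \<eta>] assms by (intro mult_mono) auto
    then show ?thesis using assms(1) by (simp add: abs_mult)
  qed
  have a: "norm (\<eta> + (l * (\<omega> \<bullet> \<eta>)) *\<^sub>R \<omega>) \<le> 2 * norm \<eta>"
    using norm_triangle_ineq[of \<eta> "(l * (\<omega> \<bullet> \<eta>)) *\<^sub>R \<omega>"] le by linarith
  have b: "norm (\<eta> - (l * (\<omega> \<bullet> \<eta>)) *\<^sub>R \<omega>) \<le> 2 * norm \<eta>"
    using norm_triangle_ineq4[of \<eta> "(l * (\<omega> \<bullet> \<eta>)) *\<^sub>R \<omega>"] le by linarith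
  have "\<bar>ell_form M \<omega> l \<eta>\<bar> \<le> (entry_sum M * (2 * norm \<eta>)) * (2 * norm \<eta>)"
    unfolding ell_form_def
    by (intro order_trans[OF Cauchy_Schwarz_ineq2] mult_mono b
        order_trans[OF norm_matrix_vector_le mult_left_mono[OF a entry_sum_nonneg]])
      (auto simp: entry_sum_nonneg)
  then show ?thesis by (simp add: power2_eq_square)
qed

lemma sum_diag_system:
  fixes F :: "'n::finite \<Rightarrow> 'n \<Rightarrow> 'b::comm_monoid_add"
  assumes "\<And>h k. h \<noteq> k \<Longrightarrow> F h k = 0"
  shows "(\<Sum>h\<in>UNIV. \<Sum>k\<in>UNIV. F h k) = (\<Sum>h\<in>UNIV. F h h)"
proof -
  have "(\<Sum>k\<in>UNIV. F h k) = F h h" for h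
    using assms by (subst sum.remove[of _ h]) (auto intro!: sum.neutral)
  then show ?thesis by simp
qed

lemma conj_transpose_0 [simp]: "conj_transpose 0 = 0"
  by (simp add: conj_transpose_def vec_eq_iff)

lemma integral_Phi_integrand_diag:
  assumes "v x \<noteq> 0"
  shows "integral_Phi_integrand \<phi> (diag_system A) v x =
    (\<Sum>h\<in>UNIV. hinner (A h x *v partial_deriv h v x) (partial_deriv h v x)
           + of_real (Lambda \<phi> (norm (v x)) / (norm (v x))\<^sup>2)
               * hinner ((A h x - conj_transpose (A h x)) *v v x) (partial_deriv h v x)
               * of_real (Re (hinner (v x) (partial_deriv h v x)))
           - of_real ((Lambda \<phi> (norm (v x)))\<^sup>2 / (norm (v x))^4)
               * hinner (A h x *v v x) (v x)
               * of_real (Re (hinner (v x) (partial_deriv h v x)))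
               * of_real (Re (hinner (v x) (partial_deriv h v x))))"
  unfolding integral_Phi_integrand_def using assms
  apply (simp only: if_False)
  apply (subst sum_diag_system)
  subgoal by (simp add: diag_system_def hinner_def)
  subgoal by (simp only: diag_system_def if_True simp_thms)
  done

text \<open>The powers of \<open>|v|\<close> normalise \<open>v\<close> to the unit vector
  \<open>v / |v|\<close>, so \<open>|v|\<close> itself survives only inside \<Lambda>. Under the
  real part the adjoint moves to the other argument, which produces the antisymmetric middle
  term.\<close>

lemma Re_integral_Phi_integrand_diag:
  assumes "v x \<noteq> 0"
  shows "Re (integral_Phi_integrand \<phi> (diag_system A) v x) =
    (\<Sum>h\<in>UNIV. ell_form (A h x) (v x /\<^sub>R norm (v x)) (Lambda \<phi> (norm (v x))) (partial_deriv h v x))"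
proof -
  define n where "n = norm (v x)"
  define l where "l = Lambda \<phi> n"
  have n: "n > 0" using assms by (simp add: n_def)
  show ?thesis
    unfolding integral_Phi_integrand_diag[of v x, OF assms] Re_sum n_def[symmetric] l_def[symmetric]
  proof (rule sum.cong)
    fix h
    let ?d = "partial_deriv h v x"
    have R1: "Re (of_real a * z * of_real b) = a * Re z * b" for a b z by simp
    have R2: "Re (of_real a * z * of_real b * of_real c) = a * Re z * b * c" for a b c z by simp
    define w where "w = v x /\<^sub>R n"
    have vw: "v x = n *\<^sub>R w" using n by (simp add: w_def)
    have iw: "(n *\<^sub>R w) /\<^sub>R n = w" using n by simp
    \<comment> \<open>Counts powers of \<open>n\<close>: every occurrence of \<open>v x\<close>
      contributes one factor, and together they cancel \<open>n^2\<close> and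
      \<open>n^4\<close>.\<close>
    have scal: "a + l / n\<^sup>2 * (n * p - n * q) * (n * r) - l\<^sup>2 / n^4 * (n * (n * s)) * (n * r)\<^sup>2 =
        a + l * (p - q) * r - l\<^sup>2 * s * r\<^sup>2" for a p q r s
      using n by (simp add: field_simps power2_eq_square power4_eq_xxxx)
    have "Re (hinner (A h x *v ?d) ?d
           + of_real (l / n\<^sup>2) * hinner ((A h x - conj_transpose (A h x)) *v v x) ?d
               * of_real (Re (hinner (v x) ?d))
           - of_real (l\<^sup>2 / n^4) * hinner (A h x *v v x) (v x)
               * of_real (Re (hinner (v x) ?d)) * of_real (Re (hinner (v x) ?d))) =
       (A h x *v ?d) \<bullet> ?d + (l / n\<^sup>2) * ((A h x *v v x) \<bullet> ?d - (A h x *v ?d) \<bullet> v x) * (v x \<bullet> ?d)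
           - l\<^sup>2 / n^4 * ((A h x *v v x) \<bullet> v x) * (v x \<bullet> ?d)\<^sup>2"
      unfolding plus_complex.sel minus_complex.sel R1 R2 Re_hinner matrix_vector_mult_diff_rdistrib
        inner_diff_left inner_conj_transpose by (simp only: power2_eq_square mult.assoc)
    also have "\<dots> = ell_form (A h x) (v x /\<^sub>R n) l ?d"
      unfolding vw iw matrix_scaleR_vector inner_scaleR_left inner_scaleR_right
        ell_form_expand scal by simp
    finally show "Re (hinner (A h x *v ?d) ?d
           + of_real (l / n\<^sup>2) * hinner ((A h x - conj_transpose (A h x)) *v v x) ?d
               * of_real (Re (hinner (v x) ?d))
           - of_real (l\<^sup>2 / n^4) * hinner (A h x *v v x) (v x)
               * of_real (Re (hinner (v x) ?d)) * of_real (Re (hinner (v x) ?d))) = 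
         ell_form (A h x) (v x /\<^sub>R n) l ?d" .
  qed (rule refl)
qed

text \<open>The constant is a parameter rather than an existential, so that implications carry a
  definite \<kappa> and the value 0 can describe plain dissipativity of
  \<open>A - \<kappa>\<Delta>\<close>.\<close>

definition pointwise_elliptic ::
    "(real \<Rightarrow> real) \<Rightarrow> (real^'n) set \<Rightarrow> ('n \<Rightarrow> real^'n \<Rightarrow> complex^'m^'m) \<Rightarrow> real \<Rightarrow> bool" where
  "pointwise_elliptic \<phi> \<Omega> A \<kappa> \<longleftrightarrow>
     (AE x\<in>\<Omega> in lebesgue. \<forall>h \<eta> \<omega> t. norm \<omega> = 1 \<longrightarrow> t > 0 \<longrightarrow>
        ell_form (A h x) \<omega> (Lambda \<phi> t) \<eta> \<ge> \<kappa> * (norm \<eta>)\<^sup>2)"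

lemma weak_expr_eq_ell_form:
  "Re (hinner (M *v \<eta>) \<eta>) - l\<^sup>2 * Re (hinner (M *v \<omega>) \<omega>) * (Re (hinner \<eta> \<omega>))\<^sup>2
     + l * Re (hinner (M *v \<omega>) \<eta> - hinner (M *v \<eta>) \<omega>) * Re (hinner \<eta> \<omega>) = ell_form M \<omega> l \<eta>"
  by (simp add: Re_hinner ell_form_expand inner_commute)

lemma symbol_matrix_diag: "symbol_matrix (diag_system A) q x = (\<Sum>h\<in>UNIV. (q $ h)\<^sup>2 *\<^sub>R A h x)"
  unfolding symbol_matrix_def
  by (subst sum_diag_system) (auto simp: diag_system_def power2_eq_square)

lemma ell_form_sum:
  "ell_form (\<Sum>h\<in>S. c h *\<^sub>R M h) \<omega> l \<eta> = (\<Sum>h\<in>S. c h * ell_form (M h) \<omega> l \<eta>)"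
  by (simp add: ell_form_def sum_matrix_vector scaleR_matrix_vector inner_sum_left)

text \<open>\<open>ell_form\<close> is linear in the matrix, and the weights
  \<open>(q $ h)^2\<close> are nonnegative with sum \<open>|q|^2\<close>, so the inequalities for
  the single \<open>A h\<close> add up; unit axis vectors isolate them again. The constant is the
  same in both directions.\<close>

lemma weak_Phi_elliptic_diag_iff:
  fixes A :: "'n::finite \<Rightarrow> real^'n \<Rightarrow> complex^'m^'m"
  shows "weak_Phi_elliptic \<phi> \<Omega> (diag_system A) \<longleftrightarrow> (\<exists>\<kappa>>0. pointwise_elliptic \<phi> \<Omega> A \<kappa>)"
proof -
  have "(\<forall>q \<eta> (\<omega>::complex^'m) t. norm \<omega> = 1 \<longrightarrow> t > 0 \<longrightarrow>
      ell_form (symbol_matrix (diag_system A) q x) \<omega> (Lambda \<phi> t) \<eta> \<ge> \<kappa> * (norm q)\<^sup>2 * (norm \<eta>)\<^sup>2) \<longleftrightarrow>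
    (\<forall>h \<eta> (\<omega>::complex^'m) t. norm \<omega> = 1 \<longrightarrow> t > 0 \<longrightarrow> ell_form (A h x) \<omega> (Lambda \<phi> t) \<eta> \<ge> \<kappa> * (norm \<eta>)\<^sup>2)"
    (is "?L \<longleftrightarrow> ?R") for x \<kappa>
  proof
    assume L: ?L
    show ?R
    proof (intro allI impI)
      fix h \<eta> and \<omega> :: "complex^'m" and t :: real assume a: "norm \<omega> = 1" "t > 0"
      have "ell_form (symbol_matrix (diag_system A) (axis h 1) x) \<omega> (Lambda \<phi> t) \<eta> =
          ell_form (A h x) \<omega> (Lambda \<phi> t) \<eta>"
        by (simp add: symbol_matrix_diag axis_def if_distrib[of "\<lambda>x. x^2"] if_distrib[of "\<lambda>c. c *\<^sub>R _"] cong: if_cong)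
      with L a show "ell_form (A h x) \<omega> (Lambda \<phi> t) \<eta> \<ge> \<kappa> * (norm \<eta>)\<^sup>2"
        by (metis mult.right_neutral norm_axis_1 power_one)
    qed
  next
    assume R: ?R
    show ?L
    proof (intro allI impI)
      fix q :: "real^'n" and \<eta> \<omega> :: "complex^'m" and t :: real assume a: "norm \<omega> = 1" "t > 0"
      have "\<kappa> * (norm q)\<^sup>2 * (norm \<eta>)\<^sup>2 = (\<Sum>h\<in>UNIV. (q $ h)\<^sup>2 * (\<kappa> * (norm \<eta>)\<^sup>2))"
        by (simp add: norm_vec_def L2_set_def sum_nonneg sum_distrib_left sum_distrib_right mult_ac)
      also have "\<dots> \<le> (\<Sum>h\<in>UNIV. (q $ h)\<^sup>2 * ell_form (A h x) \<omega> (Lambda \<phi> t) \<eta>)"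
        using R a by (intro sum_mono mult_left_mono) auto
      finally show "\<kappa> * (norm q)\<^sup>2 * (norm \<eta>)\<^sup>2 \<le>
          ell_form (symbol_matrix (diag_system A) q x) \<omega> (Lambda \<phi> t) \<eta>"
        by (simp add: symbol_matrix_diag ell_form_sum)
    qed
  qed
  then show ?thesis
    unfolding weak_Phi_elliptic_def pointwise_elliptic_def weak_expr_eq_ell_form by presburger
qed

lemma strong_Phi_elliptic_imp_pointwise:
  fixes A :: "'n::finite \<Rightarrow> real^'n \<Rightarrow> complex^'m^'m"
  assumes "strong_Phi_elliptic \<phi> \<Omega> (diag_system A)"
  shows "\<exists>\<kappa>>0. pointwise_elliptic \<phi> \<Omega> A \<kappa>"
proof -
  have eq: "(\<Sum>h\<in>UNIV. \<Sum>k\<in>UNIV.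
             Re (hinner (diag_system A h k x *v (axis g \<eta> $ k)) (axis g \<eta> $ h))
             + l * Re (hinner ((diag_system A h k x - conj_transpose (diag_system A k h x)) *v \<omega>) (axis g \<eta> $ h))
                 * Re (hinner \<omega> (axis g \<eta> $ k))
             - l\<^sup>2 * Re (hinner (diag_system A h k x *v \<omega>) \<omega>)
                 * Re (hinner \<omega> (axis g \<eta> $ k)) * Re (hinner \<omega> (axis g \<eta> $ h))) = ell_form (A g x) \<omega> l \<eta>"
    for g x \<eta> and \<omega> :: "complex^'m" and l
  proof -
    have "ell_form (A g x) \<omega> l \<eta> = (\<Sum>h\<in>UNIV. ell_form (A h x) \<omega> l (axis g \<eta> $ h))"
      by (simp add: axis_def if_distrib[of "ell_form _ _ _"] cong: if_cong)
    also have "\<dots> = (\<Sum>h\<in>UNIV. \<Sum>k\<in>UNIV.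
             Re (hinner (diag_system A h k x *v (axis g \<eta> $ k)) (axis g \<eta> $ h))
             + l * Re (hinner ((diag_system A h k x - conj_transpose (diag_system A k h x)) *v \<omega>) (axis g \<eta> $ h))
                 * Re (hinner \<omega> (axis g \<eta> $ k))
             - l\<^sup>2 * Re (hinner (diag_system A h k x *v \<omega>) \<omega>)
                 * Re (hinner \<omega> (axis g \<eta> $ k)) * Re (hinner \<omega> (axis g \<eta> $ h)))"
      apply (subst sum_diag_system)
      subgoal by (auto simp: diag_system_def hinner_def)
      subgoal by (auto simp: diag_system_def Re_hinner matrix_vector_mult_diff_rdistrib inner_diff_left
             inner_conj_transpose ell_form_expand power2_eq_square intro!: sum.cong)
      done
    finally show ?thesis ..
  qed
  have nrm: "norm (axis g \<eta>) = norm \<eta>" for g :: 'n and \<eta> :: "complex^'m"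
    by (simp add: norm_eq_sqrt_inner inner_axis_axis)
  from assms obtain \<kappa> where "\<kappa> > 0" and k: "AE x\<in>\<Omega> in lebesgue.
        \<forall>(\<xi>::complex^'m^'n) \<omega> t. norm \<omega> = 1 \<longrightarrow> t > 0 \<longrightarrow>
          (\<Sum>h\<in>UNIV. \<Sum>k\<in>UNIV.
             Re (hinner (diag_system A h k x *v (\<xi> $ k)) (\<xi> $ h))
             + Lambda \<phi> t * Re (hinner ((diag_system A h k x - conj_transpose (diag_system A k h x)) *v \<omega>) (\<xi> $ h))
                 * Re (hinner \<omega> (\<xi> $ k))
             - (Lambda \<phi> t)\<^sup>2 * Re (hinner (diag_system A h k x *v \<omega>) \<omega>)
                 * Re (hinner \<omega> (\<xi> $ k)) * Re (hinner \<omega> (\<xi> $ h)))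
          \<ge> \<kappa> * (norm \<xi>)\<^sup>2" (is "AE x\<in>\<Omega> in lebesgue. ?P x")
    unfolding strong_Phi_elliptic_def by auto
  have "pointwise_elliptic \<phi> \<Omega> A \<kappa>"
    unfolding pointwise_elliptic_def
    using k
  proof (eventually_elim, intro impI allI)
    fix x h and \<eta> \<omega> :: "complex^'m" and t :: real
    assume *: "x \<in> \<Omega> \<longrightarrow> ?P x" "x \<in> \<Omega>" "norm \<omega> = 1" "t > 0"
    show "\<kappa> * (norm \<eta>)\<^sup>2 \<le> ell_form (A h x) \<omega> (Lambda \<phi> t) \<eta>"
      using *(1)[rule_format, OF *(2-4), of "axis h \<eta>"] by (simp only: eq nrm)
  qed
  with \<open>\<kappa> > 0\<close> show ?thesis by blast
qed

section \<open>Zero sets and continuously differentiable functions\<close>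

text \<open>Small translates of \<open>S\<close> along \<open>i\<close> are pairwise disjoint, have equal measure and stay in a ball.\<close>
lemma negligible_if_isolated_in_direction:
  fixes S :: "'a::euclidean_space set"
  assumes "compact S" and "d > 0"
    and iso: "\<And>x s. x \<in> S \<Longrightarrow> 0 < s \<Longrightarrow> s < d \<Longrightarrow> x + s *\<^sub>R i \<notin> S"
  shows "negligible S"
proof -
  have meas: "S \<in> lmeasurable" by (rule lmeasurable_compact[OF assms(1)])
  define m where "m = measure lebesgue S"
  define T where "T = (\<lambda>N j. (+) ((d * real j / real N) *\<^sub>R i) ` S)"
  obtain B where B: "\<And>x. x \<in> S \<Longrightarrow> norm x \<le> B"
    using compact_imp_bounded[OF assms(1)] unfolding bounded_iff by auto
  define C where "C = cball (0::'a) (B + d * norm i)"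
  have Tm: "T N j \<in> lmeasurable" for N j
    unfolding T_def by (rule measurable_translation[OF meas])
  have le: "real N * m \<le> measure lebesgue C" if "N > 0" for N
  proof -
    have disj: "disjoint_family_on (T N) {..<N}"
    proof -
      have "T N j \<inter> T N k = {}" if "j < k" "k < N" for j k
      proof (rule ccontr)
        assume "T N j \<inter> T N k \<noteq> {}"
        then obtain x y where xy: "x \<in> S" "y \<in> S"
            "(d * real j / real N) *\<^sub>R i + x = (d * real k / real N) *\<^sub>R i + y"
          by (auto simp: T_def)
        then have "x = y + (d * real k / real N - d * real j / real N) *\<^sub>R i"
          by (simp add: algebra_simps)
        moreover have "d * real k / real N - d * real j / real N > 0"
          using that \<open>d > 0\<close> by (simp add: field_simps)
        moreover have "d * real k / real N - d * real j / real N < d"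
        proof -
          have "d * real k / real N < d" using that \<open>d > 0\<close> by (simp add: field_simps)
          moreover have "d * real j / real N \<ge> 0" using \<open>d > 0\<close> by simp
          ultimately show ?thesis by linarith
        qed
        ultimately show False using iso xy by metis
      qed
      then show ?thesis unfolding disjoint_family_on_def
        by (metis inf_commute lessThan_iff linorder_neqE_nat)
    qed
    have "real N * m = (\<Sum>j<N. measure lebesgue (T N j))"
      by (simp add: T_def measure_translation m_def)
    also have "\<dots> = measure lebesgue (\<Union>j<N. T N j)"
    proof (rule measure_finite_Union[symmetric])
      show "T N ` {..<N} \<subseteq> sets lebesgue" using fmeasurableD[OF Tm[of N]] by blast
      show "emeasure lebesgue (T N j) \<noteq> \<infinity>" for j
        using fmeasurableD2[OF Tm[of N j]] unfolding infinity_ennreal_def .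
    qed (rule finite_lessThan disj)+
    also have "\<dots> \<le> measure lebesgue C"
    proof (rule measure_mono_fmeasurable)
      show "(\<Union>j<N. T N j) \<subseteq> C"
      proof (clarsimp simp: T_def C_def)
        fix j x assume j: "j < N" and x: "x \<in> S"
        have "norm ((d * real j / real N) *\<^sub>R i) \<le> d * norm i"
          using j \<open>d > 0\<close> \<open>N > 0\<close> by (auto simp: field_simps intro!: mult_right_mono)
        then show "norm ((d * real j / real N) *\<^sub>R i + x) \<le> B + d * norm i"
          using norm_triangle_ineq[of "(d * real j / real N) *\<^sub>R i" x] B[OF x] by simp
      qed
      show "(\<Union>j<N. T N j) \<in> sets lebesgue"
        using Tm by (intro sets.finite_UN) (auto simp: fmeasurable_def)
      show "C \<in> lmeasurable" by (simp add: C_def)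
    qed
    finally show ?thesis .
  qed
  have "m = 0"
  proof (rule ccontr)
    assume "m \<noteq> 0"
    then have "m > 0" by (simp add: m_def zero_less_measure_iff)
    then obtain N where N: "real N * m > measure lebesgue C"
      using reals_Archimedean3 by blast
    then have "N > 0" by (cases N) auto
    from le[OF this] N show False by linarith
  qed
  then show ?thesis
    using meas by (simp only: negligible_iff_measure0 m_def)
qed

text \<open>A zero \<open>x\<close> with nonzero derivative along \<open>i\<close> satisfies
  \<open>|f (x + s i)| \<ge> c |s|\<close> for small \<open>s\<close>, so it is isolated among the
  zeros on its line. Letting one integer control both slope and range splits these points into
  countably many closed sets \<open>E k\<close> with uniform isolation; intersecting with balls
  makes them compact.\<close>

lemma negligible_zero_set_derivative_nonzero:
  fixes f :: "'a::euclidean_space \<Rightarrow> 'b::real_normed_vector"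
  assumes "continuous_on UNIV f"
  shows "negligible {x. f x = 0 \<and> (\<exists>f'. (f has_derivative f') (at x) \<and> f' i \<noteq> 0)}"
proof -
  define E where "E = (\<lambda>k::nat. {x. f x = 0 \<and> (\<forall>s. \<bar>s\<bar> \<le> 1 / real (Suc k) \<longrightarrow>
      \<bar>s\<bar> / real (Suc k) \<le> norm (f (x + s *\<^sub>R i)))})"
  have cl: "closed (E k)" for k
  proof -
    have "E k = {x. f x = 0} \<inter> (\<Inter>s\<in>{s. \<bar>s\<bar> \<le> 1 / real (Suc k)}.
        {x. \<bar>s\<bar> / real (Suc k) \<le> norm (f (x + s *\<^sub>R i))})"
      by (auto simp: E_def)
    moreover have c: "continuous_on UNIV (\<lambda>x. f (x + s *\<^sub>R i))" for s
      by (intro continuous_on_compose2[OF assms] continuous_intros) auto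
    moreover have "closed {x. f x = 0}"
      by (intro closed_Collect_eq assms continuous_on_const)
    moreover have "closed {x. \<bar>s\<bar> / real (Suc k) \<le> norm (f (x + s *\<^sub>R i))}" for s
      by (intro closed_Collect_le continuous_on_norm c continuous_on_const)
    ultimately show ?thesis
      by (simp only:) (intro closed_Int closed_INT ballI)
  qed
  have "negligible (E k)" for k
  proof -
    have "negligible (E k \<inter> cball 0 (real r))" for r
    proof (rule negligible_if_isolated_in_direction[where d = "1 / real (Suc k)" and i = i])
      show "compact (E k \<inter> cball 0 (real r))"
        by (simp add: cl closed_Int_compact)
      fix x s assume "x \<in> E k \<inter> cball 0 (real r)" "0 < s" "s < 1 / real (Suc k)"
      then have "s / real (Suc k) \<le> norm (f (x + s *\<^sub>R i))" "s / real (Suc k) > 0"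
        unfolding E_def by (auto dest!: spec[of _ s] simp del: of_nat_Suc)
      then have "f (x + s *\<^sub>R i) \<noteq> 0" by auto
      then show "x + s *\<^sub>R i \<notin> E k \<inter> cball 0 (real r)" by (auto simp: E_def)
    qed simp
    then have "negligible (\<Union>r. E k \<inter> cball 0 (real r))" by (rule negligible_Union_nat)
    moreover have "(\<Union>r. E k \<inter> cball 0 (real r)) = E k"
      using real_arch_simple by auto
    ultimately show ?thesis by simp
  qed
  then have "negligible (\<Union>k. E k)" by (rule negligible_Union_nat)
  moreover have "{x. f x = 0 \<and> (\<exists>f'. (f has_derivative f') (at x) \<and> f' i \<noteq> 0)} \<subseteq> (\<Union>k. E k)"
  proof clarify
    fix x f' assume fx: "f x = 0" and d: "(f has_derivative f') (at x)" and nz: "f' i \<noteq> 0"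
    \<comment> \<open>Half of the slope; the other half absorbs the remainder of the linear
      approximation.\<close>
    define c where "c = norm (f' i) / 2"
    have c: "c > 0" using nz by (simp add: c_def)
    have i: "i \<noteq> 0" using nz linear_0[OF has_derivative_linear[OF d]] by auto
    obtain e where e: "e > 0" "\<And>y. norm (y - x) < e \<Longrightarrow> norm (f y - f x - f' (y - x)) \<le> c / norm i * norm (y - x)"
      using d[unfolded has_derivative_at_alt] c i by (metis divide_pos_pos zero_less_norm_iff)
    have lin: "f' (s *\<^sub>R i) = s *\<^sub>R f' i" for s
      using linear_scale[OF has_derivative_linear[OF d]] .
    have key: "c * \<bar>s\<bar> \<le> norm (f (x + s *\<^sub>R i))" if "\<bar>s\<bar> * norm i < e" for s
    proof -
      have "norm (f (x + s *\<^sub>R i) - s *\<^sub>R f' i) \<le> c * \<bar>s\<bar>"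
        using e(2)[of "x + s *\<^sub>R i"] that fx i by (simp add: lin)
      moreover have "norm (s *\<^sub>R f' i) = 2 * c * \<bar>s\<bar>" by (simp add: c_def)
      ultimately show ?thesis
        using norm_triangle_ineq2[of "s *\<^sub>R f' i" "f (x + s *\<^sub>R i)"]
          norm_minus_commute[of "s *\<^sub>R f' i" "f (x + s *\<^sub>R i)"] by linarith
    qed
    obtain k where k: "1 / real (Suc k) < min c (e / norm i)"
      using c e(1) i nat_approx_posE[of "min c (e / norm i)"] by auto
    have "x \<in> E k"
      unfolding E_def
    proof (clarsimp simp del: of_nat_Suc simp: fx)
      fix s :: real assume s: "\<bar>s\<bar> \<le> 1 / real (Suc k)"
      have "\<bar>s\<bar> < e / norm i" using s k by linarith
      then have "\<bar>s\<bar> * norm i < e" using i by (simp add: field_simps)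
      from key[OF this] have "c * \<bar>s\<bar> \<le> norm (f (x + s *\<^sub>R i))" .
      moreover have "1 / real (Suc k) * \<bar>s\<bar> \<le> c * \<bar>s\<bar>" using k by (intro mult_right_mono) auto
      ultimately show "\<bar>s\<bar> / real (Suc k) \<le> norm (f (x + s *\<^sub>R i))" by simp
    qed
    then show "x \<in> (\<Union>k. E k)" by blast
  qed
  ultimately show ?thesis by (rule negligible_subset)
qed

text \<open>Continuity is demanded one direction at a time, which keeps the closure rules at the
  level of ordinary functions; on \<open>real^'n\<close> this amounts to continuity of the
  operator-valued derivative. The derivative is the full one at \<open>x\<close>, so pieces on open
  sets can be glued.\<close>

definition C1_on :: "'a::real_normed_vector set \<Rightarrow> ('a \<Rightarrow> 'b::real_normed_vector) \<Rightarrow> bool" where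
  "C1_on S f \<longleftrightarrow> (\<exists>f'. (\<forall>x\<in>S. (f has_derivative f' x) (at x)) \<and> (\<forall>h. continuous_on S (\<lambda>x. f' x h)))"

lemma C1_onI:
  assumes "\<And>x. x \<in> S \<Longrightarrow> (f has_derivative f' x) (at x)" "\<And>h. continuous_on S (\<lambda>x. f' x h)"
  shows "C1_on S f"
  using assms unfolding C1_on_def by blast

lemma C1_on_frechet:
  assumes "C1_on S f"
  shows "\<And>x. x \<in> S \<Longrightarrow> (f has_derivative frechet_derivative f (at x)) (at x)"
    "\<And>h. continuous_on S (\<lambda>x. frechet_derivative f (at x) h)"
proof -
  from assms obtain f' where f': "\<And>x. x\<in>S \<Longrightarrow> (f has_derivative f' x) (at x)"
      "\<And>h. continuous_on S (\<lambda>x. f' x h)"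
    unfolding C1_on_def by blast
  have eq: "frechet_derivative f (at x) = f' x" if "x \<in> S" for x
    using frechet_derivative_at[OF f'(1)[OF that]] by simp
  show "\<And>x. x \<in> S \<Longrightarrow> (f has_derivative frechet_derivative f (at x)) (at x)"
    using f' eq by simp
  show "continuous_on S (\<lambda>x. frechet_derivative f (at x) h)" for h
    by (rule continuous_on_eq[OF f'(2)[of h]]) (simp add: eq)
qed

lemma C1_on_imp_continuous_on: "C1_on S f \<Longrightarrow> continuous_on S f"
  unfolding C1_on_def by (auto intro!: continuous_at_imp_continuous_on dest: has_derivative_continuous)

lemma C1_on_subset: "C1_on S f \<Longrightarrow> T \<subseteq> S \<Longrightarrow> C1_on T f"
  unfolding C1_on_def by (meson continuous_on_subset subsetD)

lemma C1_on_cong: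
  assumes "open S" "C1_on S f" "\<And>x. x \<in> S \<Longrightarrow> f x = g x"
  shows "C1_on S g"
proof (rule C1_onI)
  show "(g has_derivative frechet_derivative f (at x)) (at x)" if "x \<in> S" for x
    using has_derivative_transform_within_open[OF C1_on_frechet(1)[OF assms(2) that] assms(1) that] assms(3)
    by blast
qed (rule C1_on_frechet(2)[OF assms(2)])

text \<open>The Frechet derivative at a point does not depend on the set, so only continuity has to
  be glued, and that is local on open sets.\<close>

lemma C1_on_open_Un:
  assumes "open S" "open T" "C1_on S f" "C1_on T f"
  shows "C1_on (S \<union> T) f"
  using assms by (intro C1_onI[where f' = "\<lambda>x. frechet_derivative f (at x)"] continuous_on_open_Un)
    (auto intro: C1_on_frechet)

lemma C1_on_const [simp]: "C1_on S (\<lambda>x. c)"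
  by (rule C1_onI[where f' = "\<lambda>x h. 0"]) (auto intro!: derivative_eq_intros)

lemma C1_on_bounded_linear: "bounded_linear L \<Longrightarrow> C1_on S L"
  by (rule C1_onI[where f' = "\<lambda>x. L"]) (auto intro!: bounded_linear_imp_has_derivative)

lemma C1_on_add: "C1_on S f \<Longrightarrow> C1_on S g \<Longrightarrow> C1_on S (\<lambda>x. f x + g x)"
  by (rule C1_onI[where f' = "\<lambda>x h. frechet_derivative f (at x) h + frechet_derivative g (at x) h"])
    (auto intro!: has_derivative_add continuous_intros C1_on_frechet)

lemma C1_on_scaleR:
  assumes "C1_on S f" "C1_on S g"
  shows "C1_on S (\<lambda>x. f x *\<^sub>R g x)"
  by (rule C1_onI[where f' = "\<lambda>x h. f x *\<^sub>R frechet_derivative g (at x) h + frechet_derivative f (at x) h *\<^sub>R g x"])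
    (intro has_derivative_scaleR continuous_intros C1_on_frechet[OF assms(1)] C1_on_frechet[OF assms(2)]
      C1_on_imp_continuous_on[OF assms(1)] C1_on_imp_continuous_on[OF assms(2)]; assumption)+

lemma C1_on_mult: "C1_on S f \<Longrightarrow> C1_on S g \<Longrightarrow> C1_on S (\<lambda>x. f x * g x :: real)"
  using C1_on_scaleR[of S f g] by simp

lemma C1_on_prod:
  assumes "\<And>i. i \<in> I \<Longrightarrow> C1_on S (f i)"
  shows "C1_on S (\<lambda>x. \<Prod>i\<in>I. f i x :: real)"
  using assms by (induction I rule: infinite_finite_induct) (auto intro!: C1_on_mult)

lemma C1_on_compose_real:
  fixes F :: "real \<Rightarrow> real"
  assumes "\<And>y. y \<in> T \<Longrightarrow> (F has_real_derivative F' y) (at y)" "continuous_on T F'"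
    and f: "C1_on S f" and "f ` S \<subseteq> T"
  shows "C1_on S (\<lambda>x. F (f x))"
proof (rule C1_onI)
  show "((\<lambda>x. F (f x)) has_derivative (\<lambda>h. F' (f x) * frechet_derivative f (at x) h)) (at x)" if "x \<in> S" for x
  proof -
    have "(F has_derivative (*) (F' (f x))) (at (f x))"
      using assms(1,4) that by (auto simp: has_field_derivative_def)
    from has_derivative_compose[OF C1_on_frechet(1)[OF f that] this] show ?thesis .
  qed
  show "continuous_on S (\<lambda>x. F' (f x) * frechet_derivative f (at x) h)" for h
    using assms(4) by (intro continuous_intros C1_on_frechet(2)[OF f] 
        continuous_on_compose2[OF assms(2) C1_on_imp_continuous_on[OF f]]) auto
qed

lemma C1_on_norm:
  fixes f :: "'a::real_normed_vector \<Rightarrow> 'b::real_inner"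
  assumes "C1_on S f" "\<And>x. x \<in> S \<Longrightarrow> f x \<noteq> 0"
  shows "C1_on S (\<lambda>x. norm (f x))"
proof (rule C1_onI)
  show "((\<lambda>x. norm (f x)) has_derivative (\<lambda>h. sgn (f x) \<bullet> frechet_derivative f (at x) h)) (at x)" if "x \<in> S" for x
    using has_derivative_compose[OF C1_on_frechet(1)[OF assms(1) that] has_derivative_norm[OF assms(2)[OF that]]]
    by (simp add: inner_commute)
  show "continuous_on S (\<lambda>x. sgn (f x) \<bullet> frechet_derivative f (at x) h)" for h
    using assms by (intro continuous_intros C1_on_frechet(2) C1_on_imp_continuous_on) auto
qed

text \<open>\<Omega> and the complement of the support are open and cover the space, so the
  extension by zero is C^1 everywhere and the boundary of \<Omega> no longer matters.\<close>

lemma C1_0_iff: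
  fixes u :: "real^'n \<Rightarrow> complex^'m"
  assumes "open \<Omega>"
  shows "u \<in> C1_0 \<Omega> \<longleftrightarrow> C1_on UNIV u \<and> compact (closure {x. u x \<noteq> 0}) \<and> closure {x. u x \<noteq> 0} \<subseteq> \<Omega>"
proof
  assume "u \<in> C1_0 \<Omega>"
  then obtain u' where u': "\<And>x. x\<in>\<Omega> \<Longrightarrow> (u has_derivative blinfun_apply (u' x)) (at x)"
      "continuous_on \<Omega> u'" and supp: "compact (closure {x. u x \<noteq> 0})" "closure {x. u x \<noteq> 0} \<subseteq> \<Omega>"
    unfolding C1_0_def by auto
  have 1: "C1_on \<Omega> u"
    by (rule C1_onI[where f' = "\<lambda>x. blinfun_apply (u' x)"])
      (use u' in \<open>auto intro!: continuous_intros\<close>)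
  have "C1_on (- closure {x. u x \<noteq> 0}) u"
    by (rule C1_on_cong[where f = "\<lambda>x. 0"]) (use closure_subset[of "{x. u x \<noteq> 0}"] in auto)
  with 1 have "C1_on (\<Omega> \<union> - closure {x. u x \<noteq> 0}) u"
    using assms by (intro C1_on_open_Un) auto
  moreover have "\<Omega> \<union> - closure {x. u x \<noteq> 0} = UNIV" using supp by auto
  ultimately show "C1_on UNIV u \<and> compact (closure {x. u x \<noteq> 0}) \<and> closure {x. u x \<noteq> 0} \<subseteq> \<Omega>"
    using supp by simp
next
  assume a: "C1_on UNIV u \<and> compact (closure {x. u x \<noteq> 0}) \<and> closure {x. u x \<noteq> 0} \<subseteq> \<Omega>"
  define u' where "u' x = Blinfun (frechet_derivative u (at x))" for x
  have u': "blinfun_apply (u' x) = frechet_derivative u (at x)" for x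
    unfolding u'_def using a by (intro bounded_linear_Blinfun_apply has_derivative_bounded_linear[OF C1_on_frechet(1)]) auto
  have "continuous_on UNIV u'"
    by (rule continuous_on_blinfun_componentwise) (use a C1_on_frechet(2) in \<open>auto simp: u'\<close>)
  then show "u \<in> C1_0 \<Omega>"
    unfolding C1_0_def using a C1_on_frechet(1)[of UNIV u]
    by (auto intro!: exI[of _ u'] simp: u' intro: continuous_on_subset)
qed

section \<open>The function \<open>\<phi>\<close>\<close>

lemma C1_on_realI:
  assumes "\<And>y. y \<in> T \<Longrightarrow> (F has_real_derivative F' y) (at y)" "continuous_on T F'"
  shows "C1_on T F"
  by (rule C1_onI[where f' = "\<lambda>y h. F' y * h"])
    (use assms in \<open>auto simp: has_field_derivative_def intro!: continuous_intros\<close>)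

lemma C1_on_compose:
  fixes F :: "real \<Rightarrow> real"
  assumes F: "C1_on T F" and f: "C1_on S f" and "f ` S \<subseteq> T"
  shows "C1_on S (\<lambda>x. F (f x))"
proof (rule C1_on_compose_real[OF _ _ f assms(3)])
  show "(F has_real_derivative frechet_derivative F (at y) 1) (at y)" if "y \<in> T" for y
  proof -
    have d: "(F has_derivative frechet_derivative F (at y)) (at y)" by (rule C1_on_frechet(1)[OF F that])
    have "frechet_derivative F (at y) = (*) (frechet_derivative F (at y) 1)"
    proof
      fix h :: real
      show "frechet_derivative F (at y) h = frechet_derivative F (at y) 1 * h"
        using linear_scale[OF has_derivative_linear[OF d], of h 1] by simp
    qed
    with d show ?thesis by (simp add: has_field_derivative_def)
  qed
  show "continuous_on T (\<lambda>y. frechet_derivative F (at y) 1)" by (rule C1_on_frechet(2)[OF F])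
qed

text \<open>Intermediate values: the image is connected and meets both sides of each positive
  \<open>y\<close>.\<close>

lemma image_half_lineI:
  fixes F :: "real \<Rightarrow> real"
  assumes "continuous_on {0<..} F" "\<And>s. s > 0 \<Longrightarrow> F s > 0"
    and "\<And>y. y > 0 \<Longrightarrow> \<exists>s>0. F s \<le> y" "\<And>y. y > 0 \<Longrightarrow> \<exists>s>0. y \<le> F s"
  shows "F ` {0<..} = {0<..}"
proof -
  have conn: "connected (F ` {0<..})"
    by (rule connected_continuous_image[OF assms(1)]) simp
  have "y \<in> F ` {0<..}" if y: "y > 0" for y
  proof -
    obtain s1 s2 where "s1 > 0" "F s1 \<le> y" "s2 > 0" "y \<le> F s2"
      using assms(3,4)[OF y] by blast
    then show ?thesis
      using connectedD_interval[OF conn imageI imageI, of s1 s2 y] by simp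
  qed
  then show ?thesis using assms(2) by auto
qed

text \<open>Serves twice in full: for \<open>G\<close>, whose inverse recovers \<open>|u|\<close>
  from \<open>|v|\<close>, and for the auxiliary function \<open>Q\<close> behind the C^1 profile.
  For \<open>P\<close> only the monotonicity is taken from it.\<close>

lemma half_line_inverse:
  fixes F F' :: "real \<Rightarrow> real"
  assumes "\<forall>s>0. (F has_real_derivative F' s) (at s)"
    and cont: "continuous_on {0<..} F'" and "\<forall>s>0. F' s > 0"
    and img: "F ` {0<..} = {0<..}"
  defines "g \<equiv> the_inv_into {0<..} F"
  shows "\<And>s s'. 0 < s \<Longrightarrow> s < s' \<Longrightarrow> F s < F s'"
    and "\<And>y. y > 0 \<Longrightarrow> g y > 0" and "\<And>y. y > 0 \<Longrightarrow> F (g y) = y" and "\<And>s. s > 0 \<Longrightarrow> g (F s) = s"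
    and "\<And>y. y > 0 \<Longrightarrow> (g has_real_derivative inverse (F' (g y))) (at y)"
    and "continuous_on {0<..} (\<lambda>y. inverse (F' (g y)))"
    and "continuous_on {0<..} g"
proof -
  have der: "(F has_real_derivative F' s) (at s)" and pos: "F' s > 0" if "s > 0" for s
    using assms(1,3) that by auto
  show less: "F s < F s'" if "0 < s" "s < s'" for s s'
    using that by (intro DERIV_pos_imp_increasing[OF that(2)]) (metis der pos less_le_trans)
  have inj: "inj_on F {0<..}"
    by (rule linorder_inj_onI) (use less in force)+
  show gpos: "g y > 0" and Fg: "F (g y) = y" if "y > 0" for y
    using that the_inv_into_into[OF inj, of y "{0<..}"] f_the_inv_into_f[OF inj, of y]
    by (simp_all add: img g_def)
  show gF: "g (F s) = s" if "s > 0" for s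
    using that by (simp add: g_def the_inv_into_f_f[OF inj])
  have isCont: "isCont g y" if "y > 0" for y
  proof -
    have p: "g y > 0" by (rule gpos[OF that])
    have "isCont g (F (g y))"
    proof (rule isCont_inverse_function2[where f = F and x = "g y" and a = "g y / 2" and b = "g y + 1"])
      show "g (F z) = z" if "g y / 2 \<le> z" for z using that p by (intro gF) linarith
      show "isCont F z" if "g y / 2 \<le> z" for z using that p by (intro DERIV_isCont[OF der]) linarith
    qed (use p in auto)
    then show ?thesis by (simp only: Fg[OF that])
  qed
  show "(g has_real_derivative inverse (F' (g y))) (at y)" if "y > 0" for y
  proof (rule DERIV_inverse_function[where f = F and a = 0 and b = "y + 1"])
    show "DERIV F (g y) :> F' (g y)" by (rule der[OF gpos[OF that]])
    show "F' (g y) \<noteq> 0" using pos[OF gpos[OF that]] by simp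
  qed (use that Fg isCont in auto)
  show cg: "continuous_on {0<..} g" using isCont by (intro continuous_at_imp_continuous_on) auto
  have "F' (g y) \<noteq> 0" if "y > 0" for y using pos[OF gpos[OF that]] by simp
  moreover have "continuous_on {0<..} (\<lambda>y. F' (g y))"
    by (rule continuous_on_compose2[OF cont cg]) (use gpos in auto)
  ultimately show "continuous_on {0<..} (\<lambda>y. inverse (F' (g y)))"
    by (intro continuous_on_inverse) auto
qed

lemma mono_bounded_tendsto_at_top:
  fixes f :: "real \<Rightarrow> real"
  assumes mono: "\<And>s t. a < s \<Longrightarrow> s \<le> t \<Longrightarrow> f s \<le> f t" and bd: "\<And>t. a < t \<Longrightarrow> f t \<le> B"
  shows "\<exists>l. (f \<longlongrightarrow> l) at_top \<and> (\<forall>t>a. f t \<le> l)"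
proof (intro exI conjI)
  have bdd: "bdd_above (f ` {a<..})" using bd by (auto simp: bdd_above_def)
  show le: "\<forall>t>a. f t \<le> (SUP t\<in>{a<..}. f t)" by (auto intro!: cSUP_upper bdd)
  show "(f \<longlongrightarrow> (SUP t\<in>{a<..}. f t)) at_top"
  proof (rule order_tendstoI)
    fix y assume "y < (SUP t\<in>{a<..}. f t)"
    then obtain t where "t > a" "y < f t" using less_cSUP_iff[OF _ bdd, of y] by auto
    then have "y < f s" if "s \<ge> t" for s using mono[OF \<open>t > a\<close> that] by linarith
    then show "eventually (\<lambda>s. y < f s) at_top" by (auto simp: eventually_at_top_linorder)
  next
    fix y assume "(SUP t\<in>{a<..}. f t) < y"
    then have "f s < y" if "s > a" for s using le that le_less_trans by blast
    then show "eventually (\<lambda>s. f s < y) at_top"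
      by (intro eventually_mono[OF eventually_gt_at_top[of a]])
  qed
qed

locale admissible =
  fixes \<phi> :: "real \<Rightarrow> real"
  assumes admissible: "phi_admissible \<phi>"
begin

lemma \<phi>_pos: "s > 0 \<Longrightarrow> \<phi> s > 0"
  using admissible unfolding phi_admissible_def by blast

lemma \<phi>_deriv: "s > 0 \<Longrightarrow> (\<phi> has_real_derivative deriv \<phi> s) (at s)"
  using admissible unfolding phi_admissible_def by (simp add: DERIV_deriv_iff_real_differentiable)

lemma continuous_on_deriv: "continuous_on {0<..} (deriv \<phi>)"
  using admissible unfolding phi_admissible_def by blast

lemma continuous_on_\<phi>: "continuous_on {0<..} \<phi>"
  by (intro continuous_at_imp_continuous_on ballI DERIV_isCont[OF \<phi>_deriv]) simp

text \<open>For \<open>s = |u|\<close>, the numbers \<open>P s\<close> and \<open>G s\<close> are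
  the lengths of \<open>phi_mult \<phi> u\<close> and \<open>sqrt_phi_mult \<phi> u\<close>;
  \<open>S\<close> goes back from the latter length to \<open>|u|\<close>. The primed functions are
  the derivatives on the half-line.\<close>

definition P where "P s = s * \<phi> s"
definition P' where "P' s = \<phi> s + s * deriv \<phi> s"
definition G where "G s = s * sqrt (\<phi> s)"
definition G' where "G' s = sqrt (\<phi> s) + s * (deriv \<phi> s / (2 * sqrt (\<phi> s)))"
definition S where "S = the_inv_into {0<..} G"

lemma P_deriv: "s > 0 \<Longrightarrow> (P has_real_derivative P' s) (at s)"
  unfolding P_def[abs_def] P'_def by (auto intro!: derivative_eq_intros \<phi>_deriv)

lemma P'_pos: "s > 0 \<Longrightarrow> P' s > 0"
  using admissible DERIV_imp_deriv[OF P_deriv, of s]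
  unfolding phi_admissible_def P_def[abs_def] by metis

lemma P_pos: "s > 0 \<Longrightarrow> P s > 0"
  by (simp add: P_def \<phi>_pos)

lemma P_image: "P ` {0<..} = {0<..}"
  using admissible unfolding phi_admissible_def P_def[abs_def] by blast

lemma continuous_on_P': "continuous_on {0<..} P'"
  unfolding P'_def[abs_def] by (intro continuous_intros continuous_on_\<phi> continuous_on_deriv)

lemma G_deriv: "s > 0 \<Longrightarrow> (G has_real_derivative G' s) (at s)"
  unfolding G_def[abs_def] G'_def using \<phi>_pos[of s]
  by (auto intro!: derivative_eq_intros \<phi>_deriv DERIV_real_sqrt simp: field_simps)

lemma G_pos: "s > 0 \<Longrightarrow> G s > 0"
  by (simp add: G_def \<phi>_pos)

text \<open>The sum of \<open>P' s\<close> and \<open>\<phi> s\<close>, both positive. It is the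
  denominator of \<Lambda> and, up to a positive factor, the derivative of \<open>G\<close>.\<close>

lemma denom_pos: "s > 0 \<Longrightarrow> s * deriv \<phi> s + 2 * \<phi> s > 0"
  using P'_pos[of s] \<phi>_pos[of s] by (simp add: P'_def)

lemma G'_eq: "s > 0 \<Longrightarrow> G' s = (s * deriv \<phi> s + 2 * \<phi> s) / (2 * sqrt (\<phi> s))"
  using \<phi>_pos[of s] by (simp add: G'_def field_simps)

lemma G'_pos: "s > 0 \<Longrightarrow> G' s > 0"
  by (simp add: G'_eq denom_pos \<phi>_pos)

lemma continuous_on_G': "continuous_on {0<..} G'"
  unfolding G'_def[abs_def] using \<phi>_pos
  by (intro continuous_intros continuous_on_\<phi> continuous_on_deriv) (auto simp: less_imp_neq[symmetric])

lemma P_mono: "0 < s \<Longrightarrow> s \<le> s' \<Longrightarrow> P s \<le> P s'"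
  using half_line_inverse(1)[of P P' s s'] P_deriv continuous_on_P' P'_pos P_image by (cases "s = s'") auto

lemma G_sq: "s > 0 \<Longrightarrow> (G s)\<^sup>2 = s * P s"
  using \<phi>_pos[of s] by (simp add: G_def P_def power2_eq_square mult_ac real_sqrt_mult_self)

text \<open>The square of \<open>G s\<close> is the product of \<open>s\<close> and
  \<open>P s\<close>. If \<open>P s1 = y\<close>, both factors are at most \<open>y\<close> at
  \<open>min s1 y\<close> and at least \<open>y\<close> at \<open>max s1 y\<close>, so
  \<open>G\<close> takes values on both sides of \<open>y\<close>.\<close>

lemma G_image: "G ` {0<..} = {0<..}"
proof (rule image_half_lineI)
  show "continuous_on {0<..} G"
    by (intro continuous_at_imp_continuous_on ballI DERIV_isCont[OF G_deriv]) simp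
  fix y :: real assume y: "y > 0"
  obtain s1 where s1: "s1 > 0" "P s1 = y" using P_image y by (metis (no_types, lifting) greaterThan_iff imageE)
  define m where "m = min s1 y"
  have m: "m > 0" "m \<le> s1" "m \<le> y" using s1 y by (auto simp: m_def)
  have "m * P m \<le> y * y"
    using m P_mono[OF m(1,2)] P_pos[OF m(1)] s1 y by (intro mult_mono) auto
  then have "(G m)\<^sup>2 \<le> y\<^sup>2" by (simp only: G_sq[OF m(1)] power2_eq_square[of y])
  then have "G m \<le> y" by (rule power2_le_imp_le) (use y in simp)
  with m show "\<exists>s>0. G s \<le> y" by blast
  define n where "n = max s1 y"
  have n: "n > 0" "s1 \<le> n" "y \<le> n" using s1 y by (auto simp: n_def)
  have "y * y \<le> n * P n"
    using n P_mono[OF s1(1) n(2)] s1 y by (intro mult_mono) auto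
  then have "y\<^sup>2 \<le> (G n)\<^sup>2" by (simp only: G_sq[OF n(1)] power2_eq_square[of y])
  then have "y \<le> G n" by (rule power2_le_imp_le) (use G_pos[OF n(1)] in simp)
  with n show "\<exists>s>0. y \<le> G s" by blast
qed (rule G_pos)

lemma G_all: "\<forall>s>0. (G has_real_derivative G' s) (at s)" "\<forall>s>0. G' s > 0"
  using G_deriv G'_pos by auto

lemmas S_facts = half_line_inverse[OF G_all(1) continuous_on_G' G_all(2) G_image, folded S_def]

lemma S_pos: "t > 0 \<Longrightarrow> S t > 0" and G_S: "t > 0 \<Longrightarrow> G (S t) = t" and S_G: "s > 0 \<Longrightarrow> S (G s) = s"
  and continuous_on_S: "continuous_on {0<..} S" and C1_on_S: "C1_on {0<..} S"
  using S_facts(2,3,4,7) by (auto intro!: C1_on_realI[OF S_facts(5) S_facts(6)])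

lemma Lambda_eq: "Lambda \<phi> t = - (S t * deriv \<phi> (S t)) / (S t * deriv \<phi> (S t) + 2 * \<phi> (S t))"
  by (simp add: Lambda_def Let_def S_def G_def[abs_def])

lemma Lambda_G: "s > 0 \<Longrightarrow> Lambda \<phi> (G s) = - (s * deriv \<phi> s) / (s * deriv \<phi> s + 2 * \<phi> s)"
  by (simp add: Lambda_eq S_G)

text \<open>The two inequalities amount to positivity of \<phi> and of \<open>P'\<close>. The bound
  is not uniform in \<open>t\<close>; uniformity is what the hypothesis on
  \<open>Lambda_infinity\<close> adds.\<close>

lemma abs_Lambda_less: "t > 0 \<Longrightarrow> \<bar>Lambda \<phi> t\<bar> < 1"
  using denom_pos[OF S_pos, of t] P'_pos[OF S_pos, of t] \<phi>_pos[OF S_pos, of t]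
  by (simp add: Lambda_eq P'_def abs_less_iff field_simps)

lemma continuous_on_Lambda: "continuous_on {0<..} (Lambda \<phi>)"
proof -
  have c: "continuous_on {0<..} (\<lambda>t. deriv \<phi> (S t))" "continuous_on {0<..} (\<lambda>t. \<phi> (S t))"
    by (auto intro!: continuous_on_compose2[OF continuous_on_deriv continuous_on_S]
        continuous_on_compose2[OF continuous_on_\<phi> continuous_on_S] S_pos)
  have "continuous_on {0<..} (\<lambda>t. - (S t * deriv \<phi> (S t)) / (S t * deriv \<phi> (S t) + 2 * \<phi> (S t)))"
    by (intro continuous_intros c continuous_on_S) (use denom_pos[OF S_pos] in force)
  then show ?thesis by (simp add: Lambda_eq[abs_def])
qed

text \<open>The derivative of \<open>ln \<phi>\<close> with respect to \<open>ln s\<close>. At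
  \<open>G s\<close> the function \<Lambda> equals \<open>- a / (a + 2)\<close>, and the last
  admissibility condition says that \<open>|a|\<close> is nondecreasing.\<close>

definition a where "a s = s * deriv \<phi> s / \<phi> s"

lemma a_mono: "0 < s \<Longrightarrow> s \<le> s' \<Longrightarrow> \<bar>a s\<bar> \<le> \<bar>a s'\<bar>"
  using admissible unfolding phi_admissible_def a_def mono_on_def by force

lemma a_gt: "s > 0 \<Longrightarrow> a s > -1"
  using P'_pos[of s] \<phi>_pos[of s] by (simp add: a_def P'_def field_simps)

text \<open>A sign change forces a zero in between, and monotonicity of \<open>|a|\<close> then
  makes \<open>a\<close> vanish already at the smaller of the two points.\<close>

lemma a_constant_sign: "(\<forall>s>0. a s \<ge> 0) \<or> (\<forall>s>0. a s \<le> 0)"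
proof (rule ccontr)
  assume "\<not> ?thesis"
  then obtain s s' where s: "s > 0" "a s < 0" "s' > 0" "a s' > 0" by (auto simp: not_le)
  have "continuous_on {0<..} a"
    unfolding a_def[abs_def] using \<phi>_pos
    by (intro continuous_intros continuous_on_\<phi> continuous_on_deriv) (auto simp: less_imp_neq[symmetric])
  then have cont: "continuous_on {min s s'..max s s'} a"
    by (rule continuous_on_subset) (use s in auto)
  obtain z where z: "min s s' \<le> z" "a z = 0"
  proof (cases "s \<le> s'")
    case True
    then show ?thesis using IVT'[of a s 0 s'] s cont that by (auto simp: min_def max_def)
  next
    case False
    then show ?thesis using IVT2'[of a s 0 s'] s cont that by (auto simp: min_def max_def)
  qed
  then show False using a_mono[of "min s s'" z] s by (auto simp: min_def split: if_splits)
qed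

text \<open>Since \<open>x / (x + 2)\<close> increases for \<open>x > -1\<close>, a constant sign
  makes \<Lambda> nonnegative and nondecreasing, and it is bounded by 1. So the limit exists,
  \<open>Lim\<close> really denotes it, and it dominates every earlier value.\<close>

lemma Lambda_sq_le: 
  assumes "t > 0"
  shows "(Lambda \<phi> t)\<^sup>2 \<le> (Lambda_infinity \<phi>)\<^sup>2"
proof -
  have L: "Lambda \<phi> t = - a (S t) / (a (S t) + 2)" if "t > 0" for t
    using \<phi>_pos[OF S_pos[OF that]] denom_pos[OF S_pos[OF that]] a_gt[OF S_pos[OF that]]
    by (simp add: Lambda_eq a_def field_simps)
  have Smono: "S t \<le> S t'" if "0 < t" "t \<le> t'" for t t'
    using S_facts(1)[of "S t'" "S t"] that by (cases "S t \<le> S t'") (simp_all add: G_S S_pos)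
  have fracmono: "x / (x + 2) \<le> y / (y + 2)" if "-1 < x" "x \<le> y" for x y :: real
    using that by (simp add: frac_le_eq field_simps)
  \<comment> \<open>The sign of \<Lambda>, opposite to that of \<open>a\<close>: -1 if
    \<open>a \<ge> 0\<close>, and 1 if \<open>a \<le> 0\<close>.\<close>
  obtain c :: real where c: "c\<^sup>2 = 1" and mono: "\<And>t t'. 0 < t \<Longrightarrow> t \<le> t' \<Longrightarrow> c * Lambda \<phi> t \<le> c * Lambda \<phi> t'"
    and nn: "\<And>t. 0 < t \<Longrightarrow> 0 \<le> c * Lambda \<phi> t"
  proof -
    from a_constant_sign show ?thesis
    proof
      assume nn: "\<forall>s>0. a s \<ge> 0"
      show ?thesis
      proof (rule that[of "-1"])
        show "- 1 * Lambda \<phi> t \<le> - 1 * Lambda \<phi> t'" if "0 < t" "t \<le> t'" for t t'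
          using fracmono[of "a (S t)" "a (S t')"] a_mono[OF S_pos Smono[OF that]] nn that
            S_pos[of t] S_pos[of t'] a_gt[OF S_pos, of t] by (simp add: L)
        show "0 \<le> - 1 * Lambda \<phi> t" if "0 < t" for t
          using nn that S_pos[of t] by (simp add: L)
      qed simp
    next
      assume np: "\<forall>s>0. a s \<le> 0"
      show ?thesis
      proof (rule that[of "1"])
        show "1 * Lambda \<phi> t \<le> 1 * Lambda \<phi> t'" if "0 < t" "t \<le> t'" for t t'
        proof -
          have t': "t' > 0" using that by simp
          have "a (S t') \<le> a (S t)"
            using a_mono[OF S_pos[OF that(1)] Smono[OF that]] np S_pos[OF that(1)] S_pos[OF t'] by fastforce
          then show ?thesis
            using fracmono[of "a (S t')" "a (S t)"] that t' a_gt[OF S_pos[OF t']] by (simp add: L)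
        qed
        show "0 \<le> 1 * Lambda \<phi> t" if "0 < t" for t
          using np that S_pos[of t] a_gt[OF S_pos, of t] by (simp add: L divide_nonpos_pos)
      qed simp
    qed
  qed
  have c1: "\<bar>c\<bar> = 1" using c power2_eq_1_iff[of c] by auto
  have bd: "c * Lambda \<phi> t \<le> 1" if "0 < t" for t
  proof -
    have "\<bar>c * Lambda \<phi> t\<bar> = \<bar>Lambda \<phi> t\<bar>" by (simp only: abs_mult c1 mult_1)
    then show ?thesis using abs_Lambda_less[OF that] by linarith
  qed
  have "\<exists>l. ((\<lambda>t. c * Lambda \<phi> t) \<longlongrightarrow> l) at_top \<and> (\<forall>t>0. c * Lambda \<phi> t \<le> l)"
    by (rule mono_bounded_tendsto_at_top[where B = 1]) (use mono bd in auto)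
  then obtain l where l: "((\<lambda>t. c * Lambda \<phi> t) \<longlongrightarrow> l) at_top" "\<And>t. t > 0 \<Longrightarrow> c * Lambda \<phi> t \<le> l"
    by blast
  have "((\<lambda>t. c * (c * Lambda \<phi> t)) \<longlongrightarrow> c * l) at_top" by (intro tendsto_intros l)
  moreover have "c * (c * x) = x" for x
    using c by (simp only: mult.assoc[symmetric] power2_eq_square mult_1)
  ultimately have "(Lambda \<phi> \<longlongrightarrow> c * l) at_top" by simp
  then have "Lambda_infinity \<phi> = c * l"
    unfolding Lambda_infinity_def by (intro tendsto_Lim) auto
  then have "(Lambda_infinity \<phi>)\<^sup>2 = l\<^sup>2" using c by (simp add: power_mult_distrib)
  moreover have "(Lambda \<phi> t)\<^sup>2 = (c * Lambda \<phi> t)\<^sup>2" using c by (simp add: power_mult_distrib)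
  moreover have "(c * Lambda \<phi> t)\<^sup>2 \<le> l\<^sup>2" using l(2)[OF assms] nn[OF assms] by (intro power_mono)
  ultimately show ?thesis by simp
qed

text \<open>With \<open>Q s = s + P s + G s\<close>, the functions \<open>s\<close>, \<open>P\<close> and \<open>G\<close> all have derivative at most \<open>1\<close>
  with respect to the variable \<open>Q\<close>; squaring the argument makes the derivatives vanish at \<open>0\<close>.\<close>
lemma ex_C1_profile:
  "\<exists>\<tau>::real \<Rightarrow> real. \<tau> 0 = 0 \<and> (\<forall>y. y \<noteq> 0 \<longrightarrow> \<tau> y > 0) \<and> C1_on UNIV \<tau> \<and>
     C1_on UNIV (\<lambda>y. P (\<tau> y)) \<and> C1_on UNIV (\<lambda>y. G (\<tau> y)) \<and> (\<forall>t>0. \<exists>c>0. G (\<tau> c) = t)"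
proof -
  define Q where "Q s = s + P s + G s" for s
  define Q' where "Q' s = 1 + P' s + G' s" for s
  have Q_deriv: "(Q has_real_derivative Q' s) (at s)" if "s > 0" for s
    unfolding Q_def[abs_def] Q'_def by (auto intro!: derivative_eq_intros P_deriv G_deriv that)
  have Q'_cont: "continuous_on {0<..} Q'"
    unfolding Q'_def[abs_def] by (intro continuous_intros continuous_on_P' continuous_on_G')
  have Q'_pos: "Q' s > 0" if "s > 0" for s
    using P'_pos[OF that] G'_pos[OF that] by (simp add: Q'_def)
  have G_mono: "G s \<le> G s'" if "0 < s" "s \<le> s'" for s s'
    using S_facts(1)[of s s'] that by (cases "s = s'") auto
  have Q_image: "Q ` {0<..} = {0<..}"
  proof (rule image_half_lineI)
    show "continuous_on {0<..} Q"
      by (intro continuous_at_imp_continuous_on ballI DERIV_isCont[OF Q_deriv]) simp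
    show "Q s > 0" if "s > 0" for s using that P_pos[of s] G_pos[of s] by (simp add: Q_def)
    fix y :: real assume y: "y > 0"
    then have "y / 3 \<in> P ` {0<..}" "y / 3 \<in> G ` {0<..}" unfolding P_image G_image by simp_all
    then obtain s1 s2 where s: "s1 > 0" "P s1 = y / 3" "s2 > 0" "G s2 = y / 3"
      by (auto simp: image_iff)
    define m where "m = min s1 (min s2 (y / 3))"
    have m: "m > 0" "m \<le> s1" "m \<le> s2" "m \<le> y / 3" using s y by (auto simp: m_def)
    have "Q m \<le> y" using P_mono[OF m(1,2)] G_mono[OF m(1,3)] m s by (simp add: Q_def)
    with m show "\<exists>s>0. Q s \<le> y" by blast
    show "\<exists>s>0. y \<le> Q s" using y P_pos[of y] G_pos[of y] by (intro exI[of _ y]) (simp add: Q_def)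
  qed
  define \<sigma> where "\<sigma> = the_inv_into {0<..} Q"
  have Q_all: "\<forall>s>0. (Q has_real_derivative Q' s) (at s)" "\<forall>s>0. Q' s > 0"
    using Q_deriv Q'_pos by auto
  note \<sigma> = half_line_inverse[OF Q_all(1) Q'_cont Q_all(2) Q_image, folded \<sigma>_def]
  \<comment> \<open>The inverse of \<open>Q\<close> at \<open>y^2\<close>. The value at 0 is set by
    hand, because \<open>the_inv_into\<close> is meaningful only on the image of
    \<open>Q\<close>.\<close>
  define \<tau> where "\<tau> y = (if y = 0 then 0 else \<sigma> (y\<^sup>2))" for y
  have \<tau>_pos: "\<tau> y > 0" if "y \<noteq> 0" for y using that \<sigma>(2)[of "y\<^sup>2"] by (simp add: \<tau>_def)
  \<comment> \<open>Used for the identity, \<open>P\<close> and \<open>G\<close>. From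
    \<open>F \<le> Q\<close> follows \<open>|F (\<tau> y)| \<le> y^2\<close>, so the derivative at 0
    is 0; from \<open>F' \<le> Q'\<close> and the chain rule, the derivative elsewhere is at most
    \<open>2 |y|\<close>, hence continuous at 0.\<close>
  have C1: "C1_on UNIV (\<lambda>y. F (\<tau> y))"
    if F: "\<And>s. s > 0 \<Longrightarrow> (F has_real_derivative F' s) (at s)" "continuous_on {0<..} F'"
      "\<And>s. s > 0 \<Longrightarrow> 0 \<le> F s \<and> F s \<le> Q s" "\<And>s. s > 0 \<Longrightarrow> 0 \<le> F' s \<and> F' s \<le> Q' s" "F 0 = 0" for F F'
  proof -
    define K' where "K' y = (if y = 0 then 0 else F' (\<tau> y) * inverse (Q' (\<tau> y)) * (2 * y))" for y
    have bd: "\<bar>F (\<tau> y)\<bar> \<le> y\<^sup>2" for y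
    proof (cases "y = 0")
      case False
      then have "Q (\<tau> y) = y\<^sup>2" by (simp add: \<tau>_def \<sigma>(3))
      then show ?thesis using F(3)[OF \<tau>_pos[OF False]] by simp
    qed (simp add: \<tau>_def F(5))
    have bd': "\<bar>K' y\<bar> \<le> 2 * \<bar>y\<bar>" for y
    proof (cases "y = 0")
      case False
      have "\<bar>F' (\<tau> y) * inverse (Q' (\<tau> y))\<bar> \<le> 1"
        using F(4)[OF \<tau>_pos[OF False]] Q'_pos[OF \<tau>_pos[OF False]] by (simp add: abs_mult field_simps)
      then have "\<bar>F' (\<tau> y) * inverse (Q' (\<tau> y))\<bar> * \<bar>2 * y\<bar> \<le> 1 * \<bar>2 * y\<bar>"
        by (rule mult_right_mono) simp
      then show ?thesis using False by (simp add: K'_def abs_mult mult_ac)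
    qed (simp add: K'_def)
    have der: "((\<lambda>y. F (\<tau> y)) has_real_derivative K' y) (at y)" for y
    proof (cases "y = 0")
      case True
      have "((\<lambda>y. F (\<tau> y)) has_real_derivative 0) (at 0)"
        unfolding DERIV_def
      proof (rule Lim_null_comparison[where g = abs])
        show "\<forall>\<^sub>F y in at 0. norm ((F (\<tau> (0 + y)) - F (\<tau> 0)) / y) \<le> \<bar>y\<bar>" 
          using bd by (intro always_eventually allI)
            (auto simp: \<tau>_def[of 0] F(5) divide_le_eq power2_eq_square abs_mult[symmetric])
        show "(abs \<longlongrightarrow> (0::real)) (at 0)" by (rule tendsto_rabs_zero[OF tendsto_ident_at])
      qed
      with True show ?thesis by (simp add: K'_def)
    next
      case False
      have "((\<lambda>y. F (\<sigma> (y\<^sup>2))) has_real_derivative K' y) (at y)"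
      proof -
        have d1: "((\<lambda>y. y\<^sup>2) has_real_derivative 2 * y) (at y)"
          by (auto intro!: derivative_eq_intros)
        have y2: "y\<^sup>2 > 0" using False by simp
        have "\<sigma> (y\<^sup>2) = \<tau> y" using False by (simp add: \<tau>_def)
        then show ?thesis
          using DERIV_chain2[OF F(1)[OF \<sigma>(2)[OF y2]] DERIV_chain2[OF \<sigma>(5)[OF y2] d1]] False
          by (simp add: K'_def mult.assoc)
      qed
      then show ?thesis
        by (rule has_field_derivative_transform_within_open[of _ _ _ "-{0}"]) (use False in \<open>auto simp: \<tau>_def\<close>)
    qed
    have "isCont K' y" for y
    proof (cases "y = 0")
      case True
      have "(K' \<longlongrightarrow> 0) (at 0)"
      proof (rule Lim_null_comparison[where g = "\<lambda>y. 2 * \<bar>y\<bar>"])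
        show "\<forall>\<^sub>F y in at 0. norm (K' y) \<le> 2 * \<bar>y\<bar>" using bd' by simp
        have "((\<lambda>y::real. 2 * \<bar>y\<bar>) \<longlongrightarrow> 2 * \<bar>0\<bar>) (at 0)" by (intro tendsto_intros)
        then show "((\<lambda>y::real. 2 * \<bar>y\<bar>) \<longlongrightarrow> 0) (at 0)" by simp
      qed
      with True show ?thesis by (simp add: isCont_def K'_def)
    next
      case False
      have co: "continuous_on (-{0}) (\<lambda>y. \<sigma> (y\<^sup>2))"
        by (rule continuous_on_compose2[OF \<sigma>(7)]) (auto intro!: continuous_intros)
      have "continuous_on (-{0}) (\<lambda>y. F' (\<sigma> (y\<^sup>2)) * inverse (Q' (\<sigma> (y\<^sup>2))) * (2 * y))"
      proof (intro continuous_intros)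
        show "continuous_on (-{0}) (\<lambda>y. F' (\<sigma> (y\<^sup>2)))"
          by (rule continuous_on_compose2[OF F(2) co]) (auto intro: \<sigma>(2))
        show "continuous_on (-{0}) (\<lambda>y. Q' (\<sigma> (y\<^sup>2)))"
          by (rule continuous_on_compose2[OF Q'_cont co]) (auto intro: \<sigma>(2))
        show "\<forall>y\<in>-{0}. Q' (\<sigma> (y\<^sup>2)) \<noteq> 0"
          using Q'_pos[OF \<sigma>(2)] by (metis ComplD insertI1 less_irrefl zero_less_power2 singletonI)
      qed
      then have "continuous_on (-{0}) K'"
        by (rule continuous_on_eq) (auto simp: K'_def \<tau>_def)
      then show ?thesis using False by (simp add: continuous_on_eq_continuous_at open_Compl)
    qed
    then show ?thesis
      by (intro C1_on_realI[OF der] continuous_at_imp_continuous_on) auto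
  qed
  have c1: "C1_on UNIV (\<lambda>y. P (\<tau> y))"
    by (rule C1[OF P_deriv continuous_on_P'])
      (use P_pos G_pos P'_pos G'_pos in \<open>auto simp: Q_def Q'_def P_def[of 0] less_imp_le add_increasing2\<close>)
  have c2: "C1_on UNIV (\<lambda>y. G (\<tau> y))"
    by (rule C1[OF G_deriv continuous_on_G'])
      (use P_pos G_pos P'_pos G'_pos in \<open>auto simp: Q_def Q'_def G_def[of 0] less_imp_le add_increasing\<close>)
  have c3: "C1_on UNIV (\<lambda>y. (\<lambda>s. s) (\<tau> y))"
    by (rule C1[where F' = "\<lambda>_. 1"])
      (use P_pos G_pos P'_pos G'_pos in \<open>auto simp: Q_def Q'_def less_imp_le add_nonneg_nonneg\<close>)
  \<comment> \<open>\<tau> takes the value \<open>S t\<close> at the square root of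
    \<open>Q (S t)\<close>, so every height \<open>t\<close> of \<open>v\<close> is reached.\<close>
  have c4: "\<exists>c>0. G (\<tau> c) = t" if "t > 0" for t
  proof (intro exI conjI)
    have p: "Q (S t) > 0" using S_pos[OF that] P_pos[of "S t"] G_pos[of "S t"] by (simp add: Q_def)
    then show "sqrt (Q (S t)) > 0" by simp
    show "G (\<tau> (sqrt (Q (S t)))) = t"
      using p S_pos[OF that] by (simp add: \<tau>_def \<sigma>(4) G_S that)
  qed
  show ?thesis
    by (intro exI[of _ \<tau>] conjI allI impI \<tau>_pos c1 c2 c3 c4) (simp_all add: \<tau>_def)
qed

end

section \<open>Gradients on zero sets and a bound for the complex integrand\<close>

lemma negligible_frechet_nonzero_on_zero_set:
  fixes f :: "'a::euclidean_space \<Rightarrow> 'b::real_normed_vector"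
  assumes "C1_on UNIV f"
  shows "negligible {x. f x = 0 \<and> frechet_derivative f (at x) \<noteq> (\<lambda>h. 0)}"
proof -
  have "negligible (\<Union>i\<in>Basis. {x. f x = 0 \<and> (\<exists>f'. (f has_derivative f') (at x) \<and> f' i \<noteq> 0)})"
    by (intro negligible_Union) 
      (auto intro: negligible_zero_set_derivative_nonzero C1_on_imp_continuous_on[OF assms])
  moreover have "{x. f x = 0 \<and> frechet_derivative f (at x) \<noteq> (\<lambda>h. 0)} \<subseteq>
      (\<Union>i\<in>Basis. {x. f x = 0 \<and> (\<exists>f'. (f has_derivative f') (at x) \<and> f' i \<noteq> 0)})"
  proof clarify
    fix x assume "f x = 0" and ne: "frechet_derivative f (at x) \<noteq> (\<lambda>h. 0)"
    have d: "(f has_derivative frechet_derivative f (at x)) (at x)"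
      by (rule C1_on_frechet(1)[OF assms UNIV_I])
    have "\<exists>i\<in>Basis. frechet_derivative f (at x) i \<noteq> 0"
    proof (rule ccontr)
      assume "\<not> ?thesis"
      then have "frechet_derivative f (at x) i = (\<lambda>h. 0) i" if "i \<in> Basis" for i using that by auto
      then have "frechet_derivative f (at x) = (\<lambda>h. 0)"
        by (intro linear_eq_stdbasis[OF has_derivative_linear[OF d] module_hom_zero]) auto
      with ne show False ..
    qed
    then show "x \<in> (\<Union>i\<in>Basis. {x. f x = 0 \<and> (\<exists>f'. (f has_derivative f') (at x) \<and> f' i \<noteq> 0)})"
      using d \<open>f x = 0\<close> by blast
  qed
  ultimately show ?thesis by (rule negligible_subset)
qed

lemma AE_zero_set_frechet_zero:
  fixes f :: "'a::euclidean_space \<Rightarrow> 'b::real_normed_vector"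
  assumes "C1_on UNIV f"
  shows "AE x in lebesgue. f x = 0 \<longrightarrow> frechet_derivative f (at x) = (\<lambda>h. 0)"
  using negligible_frechet_nonzero_on_zero_set[OF assms]
  by (auto simp: negligible_iff_null_sets intro!: AE_I' )

lemma norm_hinner_le: "norm (hinner u v) \<le> norm u * norm v"
proof -
  have "norm (hinner u v) \<le> (\<Sum>i\<in>UNIV. norm (u $ i * cnj (v $ i)))"
    unfolding hinner_def by (rule norm_sum)
  also have "\<dots> = (\<Sum>i\<in>UNIV. \<bar>norm (u $ i)\<bar> * \<bar>norm (v $ i)\<bar>)"
    by (simp add: norm_mult)
  also have "\<dots> \<le> norm u * norm v"
    unfolding norm_vec_def by (rule L2_set_mult_ineq)
  finally show ?thesis .
qed

lemma entry_sum_conj_transpose: "entry_sum (conj_transpose M) = entry_sum M"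
  unfolding entry_sum_def conj_transpose_def by (simp) (rule sum.swap)

lemma entry_sum_diff_le: "entry_sum (M - N) \<le> entry_sum M + entry_sum N"
  unfolding entry_sum_def by (simp add: sum.distrib[symmetric] sum_mono norm_triangle_ineq4)

text \<open>Integrability concerns the complex integrand, so the estimate of the real form does not
  suffice. The three terms contribute 1, 2 and 1 to the constant, the 2 because a matrix and its
  adjoint have equal entry sums.\<close>

lemma norm_integral_Phi_integrand_diag_le:
  assumes "v x \<noteq> 0 \<Longrightarrow> \<bar>Lambda \<phi> (norm (v x))\<bar> \<le> 1"
  shows "norm (integral_Phi_integrand \<phi> (diag_system A) v x) \<le>
    (\<Sum>h\<in>UNIV. 4 * entry_sum (A h x) * (norm (partial_deriv h v x))\<^sup>2)"
proof (cases "v x = 0")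
  case True
  then show ?thesis by (simp add: integral_Phi_integrand_def sum_nonneg entry_sum_nonneg)
next
  case False
  define n where "n = norm (v x)"
  define l where "l = Lambda \<phi> n"
  have n: "n > 0" using False by (simp add: n_def)
  have l: "\<bar>l\<bar> \<le> 1" using assms[OF False] by (simp add: l_def n_def)
  show ?thesis
    unfolding integral_Phi_integrand_diag[of v x, OF False] n_def[symmetric] l_def[symmetric]
  proof (rule order_trans[OF norm_sum sum_mono])
    fix h
    define d where "d = partial_deriv h v x"
    define E where "E = entry_sum (A h x)"
    have E: "E \<ge> 0" by (simp add: E_def entry_sum_nonneg)
    have r: "\<bar>Re (hinner (v x) d)\<bar> \<le> n * norm d"
      using abs_Re_le_cmod[of "hinner (v x) d"] norm_hinner_le[of "v x" d] by (simp add: n_def)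
    have t1: "norm (hinner (A h x *v d) d) \<le> E * norm d * norm d"
      by (intro order_trans[OF norm_hinner_le] mult_right_mono) (auto simp: E_def norm_matrix_vector_le)
    have "norm ((A h x - conj_transpose (A h x)) *v v x) \<le> 2 * E * n"
      using order_trans[OF norm_matrix_vector_le mult_right_mono[OF entry_sum_diff_le norm_ge_zero],
          of "A h x" "conj_transpose (A h x)" "v x"]
      by (simp add: E_def n_def entry_sum_conj_transpose)
    then have t2: "norm (hinner ((A h x - conj_transpose (A h x)) *v v x) d) \<le> 2 * E * n * norm d"
      by (intro order_trans[OF norm_hinner_le] mult_right_mono) auto
    have t3: "norm (hinner (A h x *v v x) (v x)) \<le> E * n * n"
      unfolding n_def by (intro order_trans[OF norm_hinner_le] mult_right_mono) (auto simp: E_def norm_matrix_vector_le)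
    have "norm (of_real (l / n\<^sup>2) * hinner ((A h x - conj_transpose (A h x)) *v v x) d * of_real (Re (hinner (v x) d)))
        = \<bar>l\<bar> / n\<^sup>2 * norm (hinner ((A h x - conj_transpose (A h x)) *v v x) d) * \<bar>Re (hinner (v x) d)\<bar>"
      by (simp only: norm_mult norm_of_real abs_divide abs_power2)
    also have "\<dots> \<le> 1 / n\<^sup>2 * (2 * E * n * norm d) * (n * norm d)"
      using l n E by (intro mult_mono divide_right_mono t2 r) auto
    also have "\<dots> = 2 * E * norm d * norm d" using n by (simp add: field_simps power2_eq_square)
    finally have s2: "norm (of_real (l / n\<^sup>2) * hinner ((A h x - conj_transpose (A h x)) *v v x) d * of_real (Re (hinner (v x) d)))
       \<le> 2 * E * norm d * norm d" .
    have "norm (of_real (l\<^sup>2 / n^4) * hinner (A h x *v v x) (v x) * of_real (Re (hinner (v x) d)) * of_real (Re (hinner (v x) d)))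
        = l\<^sup>2 / n^4 * norm (hinner (A h x *v v x) (v x)) * \<bar>Re (hinner (v x) d)\<bar> * \<bar>Re (hinner (v x) d)\<bar>"
      by (simp only: norm_mult norm_of_real abs_divide abs_power2 power_even_abs_numeral even_numeral power_abs)
    also have "\<dots> \<le> 1 / n^4 * (E * n * n) * (n * norm d) * (n * norm d)"
      using l n E by (intro mult_mono divide_right_mono t3 r) (auto simp: abs_square_le_1)
    also have "\<dots> = E * norm d * norm d" using n by (simp add: field_simps power4_eq_xxxx)
    finally have s3: "norm (of_real (l\<^sup>2 / n^4) * hinner (A h x *v v x) (v x) * of_real (Re (hinner (v x) d)) * of_real (Re (hinner (v x) d)))
       \<le> E * norm d * norm d" .
    have tri: "norm (p + q - r) \<le> norm p + norm q + norm r" for p q r :: complex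
      using norm_triangle_ineq4[of "p + q" r] norm_triangle_ineq[of p q] by linarith
    have sum4: "4 * E * (norm d)\<^sup>2 = E * norm d * norm d + 2 * E * norm d * norm d + E * norm d * norm d"
      by (simp add: power2_eq_square)
    show "norm (hinner (A h x *v partial_deriv h v x) (partial_deriv h v x)
           + of_real (l / n\<^sup>2) * hinner ((A h x - conj_transpose (A h x)) *v v x) (partial_deriv h v x)
               * of_real (Re (hinner (v x) (partial_deriv h v x)))
           - of_real (l\<^sup>2 / n^4) * hinner (A h x *v v x) (v x)
               * of_real (Re (hinner (v x) (partial_deriv h v x)))
               * of_real (Re (hinner (v x) (partial_deriv h v x))))
          \<le> 4 * entry_sum (A h x) * (norm (partial_deriv h v x))\<^sup>2"
      unfolding d_def[symmetric] E_def[symmetric] sum4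
      by (intro order_trans[OF tri] add_mono t1 s2 s3)
  qed
qed

section \<open>The substitution \<open>v = sqrt_phi_mult \<phi> u\<close>\<close>

context admissible
begin

lemma G_norm: "norm (sqrt (\<phi> (norm y)) *\<^sub>R y) = G (norm y)"
  by (cases "y = 0") (auto simp: G_def \<phi>_pos less_imp_le)

lemma sqrt_phi_mult_eq_0_iff: "sqrt_phi_mult \<phi> u x = 0 \<longleftrightarrow> u x = 0"
  using \<phi>_pos[of "norm (u x)"] by (cases "u x = 0") (simp_all add: sqrt_phi_mult_def)

lemma phi_mult_eq_0_iff: "phi_mult \<phi> u x = 0 \<longleftrightarrow> u x = 0"
  using \<phi>_pos[of "norm (u x)"] by (cases "u x = 0") (simp_all add: phi_mult_def)

text \<open>Each derivative is that of \<open>u\<close> plus a radial correction. With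
  \<open>D\<close> the derivative of \<open>u\<close>, \<rho> its component along \<omega> and
  \<open>\<alpha> = a s\<close>, the derivative of \<open>sqrt_phi_mult \<phi> u\<close> is
  \<open>q (D + \<alpha>/2 \<rho> \<omega>)\<close> and that of \<open>phi_mult \<phi> u\<close> is
  \<open>q^2 (D + \<alpha> \<rho> \<omega>)\<close>.\<close>

lemma pointwise_identity:
  fixes u :: "real^'n \<Rightarrow> complex^'m"
  assumes d: "(u has_derivative d) (at x)" and nz: "u x \<noteq> 0"
  shows "(M *v partial_deriv h u x) \<bullet> partial_deriv h (phi_mult \<phi> u) x =
    ell_form M (sqrt_phi_mult \<phi> u x /\<^sub>R norm (sqrt_phi_mult \<phi> u x))
      (Lambda \<phi> (norm (sqrt_phi_mult \<phi> u x))) (partial_deriv h (sqrt_phi_mult \<phi> u) x)"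
proof -
  define s where "s = norm (u x)"
  define \<omega> where "\<omega> = sgn (u x)"
  define D where "D = d (axis h 1)"
  define \<rho> where "\<rho> = \<omega> \<bullet> D"
  define \<alpha> where "\<alpha> = a s"
  have s: "s > 0" using nz by (simp add: s_def)
  have \<phi>s: "\<phi> s > 0" by (rule \<phi>_pos[OF s])
  have ux: "u x = s *\<^sub>R \<omega>" using nz by (simp add: s_def \<omega>_def sgn_div_norm)
  have \<omega>\<omega>: "\<omega> \<bullet> \<omega> = 1" using nz by (simp add: \<omega>_def dot_square_norm norm_sgn)
  have dn: "((\<lambda>x. norm (u x)) has_derivative (\<lambda>k. \<omega> \<bullet> d k)) (at x)"
    using has_derivative_compose[OF d has_derivative_norm[OF nz]] by (simp add: \<omega>_def inner_commute)
  have chain: "((\<lambda>x. F (norm (u x))) has_derivative (\<lambda>k. F' * (\<omega> \<bullet> d k))) (at x)"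
    if "(F has_real_derivative F') (at s)" for F F'
    using has_derivative_compose[OF dn, of F "(*) F'"] that by (simp add: has_field_derivative_def s_def)
  have "((\<lambda>x. \<phi> (norm (u x)) *\<^sub>R u x) has_derivative
      (\<lambda>k. \<phi> s *\<^sub>R d k + (deriv \<phi> s * (\<omega> \<bullet> d k)) *\<^sub>R u x)) (at x)"
    using has_derivative_scaleR[OF chain[OF \<phi>_deriv[OF s]] d] by (simp add: s_def)
  then have pw: "partial_deriv h (phi_mult \<phi> u) x = \<phi> s *\<^sub>R D + (deriv \<phi> s * \<rho>) *\<^sub>R u x"
    by (simp add: partial_deriv_def phi_mult_def[abs_def] frechet_derivative_at[symmetric] D_def \<rho>_def)
  have "((\<lambda>s. sqrt (\<phi> s)) has_real_derivative deriv \<phi> s / (2 * sqrt (\<phi> s))) (at s)"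
    using \<phi>s by (auto intro!: derivative_eq_intros \<phi>_deriv[OF s] simp: field_simps)
  from has_derivative_scaleR[OF chain[OF this] d]
  have "((\<lambda>x. sqrt (\<phi> (norm (u x))) *\<^sub>R u x) has_derivative
      (\<lambda>k. sqrt (\<phi> s) *\<^sub>R d k + (deriv \<phi> s / (2 * sqrt (\<phi> s)) * (\<omega> \<bullet> d k)) *\<^sub>R u x)) (at x)"
    by (simp add: s_def)
  then have pv: "partial_deriv h (sqrt_phi_mult \<phi> u) x =
      sqrt (\<phi> s) *\<^sub>R D + (deriv \<phi> s / (2 * sqrt (\<phi> s)) * \<rho>) *\<^sub>R u x"
    by (simp add: partial_deriv_def sqrt_phi_mult_def[abs_def] frechet_derivative_at[symmetric] D_def \<rho>_def)
  have pu: "partial_deriv h u x = D"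
    by (simp add: partial_deriv_def frechet_derivative_at[OF d, symmetric] D_def)
  have v: "sqrt_phi_mult \<phi> u x = G s *\<^sub>R \<omega>"
  proof -
    have "sqrt_phi_mult \<phi> u x = sqrt (\<phi> s) *\<^sub>R u x" by (simp add: sqrt_phi_mult_def s_def)
    then show ?thesis by (simp add: ux G_def mult.commute)
  qed
  have nv: "norm (sqrt_phi_mult \<phi> u x) = G s"
    unfolding sqrt_phi_mult_def G_norm s_def ..
  have \<omega>eq: "sqrt_phi_mult \<phi> u x /\<^sub>R norm (sqrt_phi_mult \<phi> u x) = \<omega>"
    by (simp only: nv) (use G_pos[OF s] in \<open>simp add: v\<close>)
  define q where "q = sqrt (\<phi> s)"
  have q: "q > 0" "\<phi> s = q * q" using \<phi>s by (simp_all add: q_def)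
  have dq: "deriv \<phi> s * s = \<alpha> * (q * q)" unfolding \<alpha>_def a_def using \<phi>s by (simp add: q(2)[symmetric])
  have \<alpha>2: "\<alpha> + 2 > 0" using a_gt[OF s] by (simp add: \<alpha>_def)
  have L: "Lambda \<phi> (G s) = - \<alpha> / (\<alpha> + 2)"
    unfolding Lambda_G[OF s] \<alpha>_def a_def using \<phi>s denom_pos[OF s] by (simp add: field_simps)
  have pv': "partial_deriv h (sqrt_phi_mult \<phi> u) x = q *\<^sub>R (D + (\<alpha> / 2 * \<rho>) *\<^sub>R \<omega>)"
  proof -
    have "deriv \<phi> s / (2 * q) * \<rho> * s = q * (\<alpha> / 2 * \<rho>)"
      using q dq by (simp add: field_simps)
    then show ?thesis unfolding pv ux q_def[symmetric]
      by (simp add: scaleR_add_right)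
  qed
  have pw': "partial_deriv h (phi_mult \<phi> u) x = (q * q) *\<^sub>R (D + (\<alpha> * \<rho>) *\<^sub>R \<omega>)"
  proof -
    have "deriv \<phi> s * \<rho> * s = (q * q) * (\<alpha> * \<rho>)" using dq by (simp add: mult_ac)
    then show ?thesis unfolding pw ux q(2) by (simp add: scaleR_add_right)
  qed
  define \<xi> where "\<xi> = q *\<^sub>R (D + (\<alpha> / 2 * \<rho>) *\<^sub>R \<omega>)"
  have wx: "\<omega> \<bullet> \<xi> = q * (\<rho> * (\<alpha> + 2) / 2)"
    by (simp add: \<xi>_def inner_add_right \<omega>\<omega> \<rho>_def[symmetric] field_simps)
  \<comment> \<open>This is what \<Lambda> is made for: the radial part of \<xi> carries the factor
    \<open>(\<alpha> + 2) / 2\<close>, which cancels the denominator. Adding the result to \<xi>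
    removes the radial correction, subtracting it doubles the correction.\<close>
  have l: "Lambda \<phi> (G s) * (\<omega> \<bullet> \<xi>) = - (q * (\<alpha> / 2 * \<rho>))"
    unfolding L wx using \<alpha>2 by (simp add: field_simps)
  have e1: "\<xi> + (- (q * (\<alpha> / 2 * \<rho>))) *\<^sub>R \<omega> = q *\<^sub>R D"
    by (simp add: \<xi>_def scaleR_add_right)
  have "(q * (\<alpha> / 2 * \<rho>)) *\<^sub>R \<omega> + (q * (\<alpha> / 2 * \<rho>)) *\<^sub>R \<omega> = (q * (\<alpha> * \<rho>)) *\<^sub>R \<omega>"
    unfolding scaleR_add_left[symmetric] by simp
  then have e2: "\<xi> - (- (q * (\<alpha> / 2 * \<rho>))) *\<^sub>R \<omega> = q *\<^sub>R (D + (\<alpha> * \<rho>) *\<^sub>R \<omega>)"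
    by (simp add: \<xi>_def scaleR_add_right)
  have "ell_form M \<omega> (Lambda \<phi> (G s)) \<xi> = (M *v (q *\<^sub>R D)) \<bullet> (q *\<^sub>R (D + (\<alpha> * \<rho>) *\<^sub>R \<omega>))"
    unfolding ell_form_def l e1 e2 ..
  also have "\<dots> = (M *v partial_deriv h u x) \<bullet> partial_deriv h (phi_mult \<phi> u) x"
    unfolding pu pw' by (simp add: matrix_scaleR_vector)
  finally show ?thesis unfolding nv \<omega>eq[unfolded nv] pv' \<xi>_def by (rule sym)
qed

text \<open>\<open>|\<surd>\<phi>(|u|) u|\<^sup>2 = |u| |\<phi>(|u|) u|\<close>, and both factors are \<open>o(|y - x|)\<close>.\<close>
lemma sqrt_phi_mult_has_derivative_zero:
  fixes u :: "real^'n \<Rightarrow> complex^'m"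
  assumes "u x = 0" and u: "(u has_derivative (\<lambda>h. 0)) (at x)"
    and w: "(phi_mult \<phi> u has_derivative (\<lambda>h. 0)) (at x)"
  shows "(sqrt_phi_mult \<phi> u has_derivative (\<lambda>h. 0)) (at x)"
  unfolding has_derivative_at_alt
proof (intro conjI allI impI)
  have 0: "phi_mult \<phi> u x = 0" "sqrt_phi_mult \<phi> u x = 0"
    using assms(1) by (simp_all add: phi_mult_def sqrt_phi_mult_def)
  fix e :: real assume "e > 0"
  from u[unfolded has_derivative_at_alt, THEN conjunct2, rule_format, OF \<open>e > 0\<close>]
  obtain d1 where d1: "d1 > 0" "\<And>y. norm (y - x) < d1 \<Longrightarrow> norm (u y) \<le> e * norm (y - x)"
    unfolding assms(1) diff_0_right by metis
  from w[unfolded has_derivative_at_alt, THEN conjunct2, rule_format, OF \<open>e > 0\<close>]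
  obtain d2 where d2: "d2 > 0" "\<And>y. norm (y - x) < d2 \<Longrightarrow> norm (phi_mult \<phi> u y) \<le> e * norm (y - x)"
    unfolding 0(1) diff_0_right by metis
  note d = d1(1) d2(1) d1(2) d2(2)
  have "norm (sqrt_phi_mult \<phi> u y) \<le> e * norm (y - x)" if y: "norm (y - x) < min d1 d2" for y
  proof -
    have nn: "0 \<le> \<phi> (norm (u y)) \<or> u y = 0" using \<phi>_pos[of "norm (u y)"] by force
    have "(norm (sqrt_phi_mult \<phi> u y))\<^sup>2 = norm (u y) * norm (phi_mult \<phi> u y)"
      using nn by (auto simp: sqrt_phi_mult_def phi_mult_def power2_eq_square)
    also have "\<dots> \<le> (e * norm (y - x)) * (e * norm (y - x))"
      using y d(3,4)[of y] \<open>e > 0\<close> by (intro mult_mono) auto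
    finally have "(norm (sqrt_phi_mult \<phi> u y))\<^sup>2 \<le> (e * norm (y - x))\<^sup>2" by (simp add: power2_eq_square)
    then show ?thesis by (rule power2_le_imp_le) (use \<open>e > 0\<close> in simp)
  qed
  then show "\<exists>d>0. \<forall>y. norm (y - x) < d \<longrightarrow>
      norm (sqrt_phi_mult \<phi> u y - sqrt_phi_mult \<phi> u x - 0) \<le> e * norm (y - x)"
    using d(1,2) 0 by (intro exI[of _ "min d1 d2"]) auto
qed simp

text \<open>C^1 regularity of \<open>sqrt_phi_mult \<phi> u\<close> is not at hand, so the general
  result on zero sets is applied to \<open>u\<close> and \<open>phi_mult \<phi> u\<close>; where
  both gradients vanish, the geometric-mean estimate above settles the third.\<close>

lemma AE_zero_set_partial_deriv:
  fixes u :: "real^'n \<Rightarrow> complex^'m"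
  assumes u: "C1_on UNIV u" and w: "C1_on UNIV (phi_mult \<phi> u)"
  shows "AE x in lebesgue. u x = 0 \<longrightarrow> (\<forall>h. partial_deriv h u x = 0 \<and>
     partial_deriv h (phi_mult \<phi> u) x = 0 \<and> partial_deriv h (sqrt_phi_mult \<phi> u) x = 0)"
  using AE_zero_set_frechet_zero[OF u] AE_zero_set_frechet_zero[OF w]
proof eventually_elim
  case (elim x)
  show ?case
  proof
    assume z: "u x = 0"
    then have fu: "frechet_derivative u (at x) = (\<lambda>h. 0)" and fw: "frechet_derivative (phi_mult \<phi> u) (at x) = (\<lambda>h. 0)"
      using elim by (simp_all add: phi_mult_eq_0_iff)
    have "(sqrt_phi_mult \<phi> u has_derivative (\<lambda>h. 0)) (at x)"
      using C1_on_frechet(1)[OF u, of x] C1_on_frechet(1)[OF w, of x] fu fw z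
      by (intro sqrt_phi_mult_has_derivative_zero) auto
    from frechet_derivative_at[OF this, symmetric] fu fw
    show "\<forall>h. partial_deriv h u x = 0 \<and>
       partial_deriv h (phi_mult \<phi> u) x = 0 \<and> partial_deriv h (sqrt_phi_mult \<phi> u) x = 0"
      by (simp add: partial_deriv_def)
  qed
qed

lemma AE_Re_phi_integrand:
  fixes u :: "real^'n \<Rightarrow> complex^'m"
  assumes u: "C1_on UNIV u" and w: "C1_on UNIV (phi_mult \<phi> u)"
  shows "AE x in lebesgue. Re (\<Sum>h\<in>UNIV. \<Sum>k\<in>UNIV.
        hinner (diag_system A h k x *v partial_deriv k u x) (partial_deriv h (phi_mult \<phi> u) x)) =
      Re (integral_Phi_integrand \<phi> (diag_system A) (sqrt_phi_mult \<phi> u) x)"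
  using AE_zero_set_partial_deriv[OF u w]
proof eventually_elim
  case (elim x)
  have "Re (\<Sum>h\<in>UNIV. \<Sum>k\<in>UNIV.
        hinner (diag_system A h k x *v partial_deriv k u x) (partial_deriv h (phi_mult \<phi> u) x)) =
      (\<Sum>h\<in>UNIV. (A h x *v partial_deriv h u x) \<bullet> partial_deriv h (phi_mult \<phi> u) x)"
    by (subst sum_diag_system) (simp_all add: diag_system_def hinner_def[of 0] Re_hinner[symmetric])
  moreover have "\<dots> = Re (integral_Phi_integrand \<phi> (diag_system A) (sqrt_phi_mult \<phi> u) x)"
  proof (cases "u x = 0")
    case True
    with elim have "\<forall>h. partial_deriv h u x = 0" by blast
    moreover have "integral_Phi_integrand \<phi> (diag_system A) (sqrt_phi_mult \<phi> u) x = 0"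
      using True by (simp add: integral_Phi_integrand_def sqrt_phi_mult_eq_0_iff)
    ultimately show ?thesis by simp
  next
    case False
    then have nz: "sqrt_phi_mult \<phi> u x \<noteq> 0" by (simp add: sqrt_phi_mult_eq_0_iff)
    show ?thesis
      unfolding Re_integral_Phi_integrand_diag[of "sqrt_phi_mult \<phi> u" x, OF nz]
      by (intro sum.cong refl pointwise_identity[OF C1_on_frechet(1)[OF u UNIV_I] False])
  qed
  ultimately show ?case by simp
qed

end

section \<open>Integrability\<close>

lemma partial_deriv_zero_outside:
  fixes u :: "real^'n \<Rightarrow> complex^'m"
  assumes "x \<notin> closure {x. u x \<noteq> 0}"
  shows "partial_deriv h u x = 0"
proof -
  have "(u has_derivative (\<lambda>h. 0)) (at x)"
    by (rule has_derivative_transform_within_open[of "\<lambda>x. 0" _ _ _ "- closure {x. u x \<noteq> 0}"])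
      (use assms closure_subset[of "{x. u x \<noteq> 0}"] in auto)
  then show ?thesis by (simp add: partial_deriv_def frechet_derivative_at[symmetric])
qed

lemma continuous_on_partial_deriv:
  "C1_on UNIV u \<Longrightarrow> continuous_on UNIV (partial_deriv h u)"
  unfolding partial_deriv_def[abs_def] by (rule C1_on_frechet(2))

lemma partial_deriv_bounded:
  fixes u :: "real^'n \<Rightarrow> complex^'m"
  assumes "C1_on UNIV u" "compact (closure {x. u x \<noteq> 0})"
  obtains B where "B \<ge> 0" "\<And>h x. norm (partial_deriv h u x) \<le> B"
proof -
  have "\<exists>B. \<forall>x. norm (partial_deriv h u x) \<le> B" for h
  proof -
    have "bounded (partial_deriv h u ` closure {x. u x \<noteq> 0})"
      by (intro compact_imp_bounded compact_continuous_image assms(2)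
          continuous_on_subset[OF continuous_on_partial_deriv[OF assms(1)]]) simp
    then obtain B where B: "\<And>x. x \<in> closure {x. u x \<noteq> 0} \<Longrightarrow> norm (partial_deriv h u x) \<le> B"
      unfolding bounded_iff by auto
    have "norm (partial_deriv h u x) \<le> max B 0" for x
      using B[of x] partial_deriv_zero_outside[of x u h] by (cases "x \<in> closure {x. u x \<noteq> 0}") auto
    then show ?thesis by blast
  qed
  then obtain B where B: "\<And>h x. norm (partial_deriv h u x) \<le> B h" by metis
  have "norm (partial_deriv h u x) \<le> (\<Sum>h\<in>UNIV. \<bar>B h\<bar>)" for h x
    using B[of h x] member_le_sum[of h UNIV "\<lambda>h. \<bar>B h\<bar>"] by simp
  then show ?thesis by (intro that[of "\<Sum>h\<in>UNIV. \<bar>B h\<bar>"]) (auto intro: sum_nonneg)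
qed

definition measurable_matrix :: "(real^'n \<Rightarrow> complex^'m^'m) \<Rightarrow> bool" where
  "measurable_matrix B \<longleftrightarrow> (\<forall>i j. (\<lambda>x. B x $ i $ j) \<in> borel_measurable lebesgue)"

lemma borel_measurable_component:
  fixes p :: "'a \<Rightarrow> complex^'m"
  assumes "p \<in> borel_measurable M"
  shows "(\<lambda>x. p x $ j) \<in> borel_measurable M"
  by (rule borel_measurable_continuous_on[OF _ assms]) (intro continuous_intros)

lemma borel_measurable_cnj:
  "f \<in> borel_measurable M \<Longrightarrow> (\<lambda>x. cnj (f x)) \<in> borel_measurable M"
  by (rule borel_measurable_continuous_on) (intro continuous_intros)

lemma borel_measurable_hinner:
  fixes B :: "real^'n \<Rightarrow> complex^'m^'m"
  assumes "measurable_matrix B" "p \<in> borel_measurable lebesgue" "q \<in> borel_measurable lebesgue"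
  shows "(\<lambda>x. hinner (B x *v p x) (q x)) \<in> borel_measurable lebesgue"
  unfolding hinner_def matrix_vector_mult_def vec_lambda_beta
  by (intro borel_measurable_sum borel_measurable_times borel_measurable_cnj borel_measurable_component
      assms(2,3) assms(1)[unfolded measurable_matrix_def, rule_format])

lemma borel_measurable_hinner':
  fixes p q :: "real^'n \<Rightarrow> complex^'m"
  assumes "p \<in> borel_measurable lebesgue" "q \<in> borel_measurable lebesgue"
  shows "(\<lambda>x. hinner (p x) (q x)) \<in> borel_measurable lebesgue"
  unfolding hinner_def
  by (intro borel_measurable_sum borel_measurable_times borel_measurable_cnj borel_measurable_component assms)

lemma measurable_matrix_diff_conj_transpose:
  assumes "measurable_matrix B"
  shows "measurable_matrix (\<lambda>x. B x - conj_transpose (B x))"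
  unfolding measurable_matrix_def conj_transpose_def
  using assms[unfolded measurable_matrix_def, rule_format]
  by (auto intro!: borel_measurable_diff borel_measurable_cnj)

lemma borel_measurable_continuous_lebesgue:
  fixes f :: "'a::euclidean_space \<Rightarrow> 'b::topological_space"
  assumes "continuous_on UNIV f"
  shows "f \<in> borel_measurable lebesgue"
  using borel_measurable_continuous_onI[OF assms] by (intro measurable_completion) simp

context
  fixes \<Omega> :: "(real^'n) set" and A :: "'n \<Rightarrow> real^'n \<Rightarrow> complex^'m^'m"
  assumes L1: "\<And>h. L1_loc_matrix \<Omega> (A h)"
begin

lemma integrable_entry:
  assumes "compact K" "K \<subseteq> \<Omega>"
  shows "integrable lebesgue (\<lambda>x. (indicat_real K x *\<^sub>R A h x) $ i $ j)"
  using L1[of h] assms unfolding L1_loc_matrix_def set_integrable_def by simp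

text \<open>Nothing is known about the coefficients off \<Omega>, so measurability is claimed after
  cutting off to a compact set. The integrands do not notice the cutoff when it contains the support
  of the test function.\<close>

lemma measurable_matrix_restrict:
  assumes "compact K" "K \<subseteq> \<Omega>"
  shows "measurable_matrix (\<lambda>x. indicat_real K x *\<^sub>R A h x)"
  unfolding measurable_matrix_def using borel_measurable_integrable[OF integrable_entry[OF assms]] by blast

lemma integrable_entry_sum:
  assumes "compact K" "K \<subseteq> \<Omega>"
  shows "integrable lebesgue (\<lambda>x. entry_sum (indicat_real K x *\<^sub>R A h x))"
  unfolding entry_sum_def by (intro Bochner_Integration.integrable_sum Bochner_Integration.integrable_norm integrable_entry assms)

lemma integrable_if_entry_sum_bound:
  fixes F :: "real^'n \<Rightarrow> 'c::{banach, second_countable_topology}"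
  assumes "compact K" "K \<subseteq> \<Omega>" "F \<in> borel_measurable lebesgue"
    and "\<And>x. norm (F x) \<le> C * (\<Sum>h\<in>UNIV. entry_sum (indicat_real K x *\<^sub>R A h x))"
  shows "integrable lebesgue F"
proof (rule Bochner_Integration.integrable_bound[OF _ assms(3)])
  show "integrable lebesgue (\<lambda>x. C * (\<Sum>h\<in>UNIV. entry_sum (indicat_real K x *\<^sub>R A h x)))"
    by (intro Bochner_Integration.integrable_mult_right Bochner_Integration.integrable_sum integrable_entry_sum assms)
  show "AE x in lebesgue. norm (F x) \<le> norm (C * (\<Sum>h\<in>UNIV. entry_sum (indicat_real K x *\<^sub>R A h x)))"
    using assms(4) by (intro AE_I2) (metis abs_ge_self order_trans real_norm_def)
qed

lemma integrable_phi_integrand: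
  assumes "open \<Omega>" "u \<in> C1_0 \<Omega>" "w \<in> C1_0 \<Omega>"
  shows "integrable lebesgue (\<lambda>x. indicat_real \<Omega> x *\<^sub>R (\<Sum>h\<in>UNIV. \<Sum>k\<in>UNIV.
        hinner (diag_system A h k x *v partial_deriv k u x) (partial_deriv h w x)))"
proof -
  note u = C1_0_iff[OF assms(1), THEN iffD1, OF assms(2)]
  note w = C1_0_iff[OF assms(1), THEN iffD1, OF assms(3)]
  define K where "K = closure {x. u x \<noteq> 0}"
  have K: "compact K" "K \<subseteq> \<Omega>" using u by (auto simp: K_def)
  define B where "B h x = indicat_real K x *\<^sub>R A h x" for h x
  have eq: "indicat_real \<Omega> x *\<^sub>R (\<Sum>h\<in>UNIV. \<Sum>k\<in>UNIV.
        hinner (diag_system A h k x *v partial_deriv k u x) (partial_deriv h w x)) =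
      (\<Sum>h\<in>UNIV. hinner (B h x *v partial_deriv h u x) (partial_deriv h w x))" for x
  proof -
    have "(\<Sum>h\<in>UNIV. \<Sum>k\<in>UNIV.
        hinner (diag_system A h k x *v partial_deriv k u x) (partial_deriv h w x)) =
      (\<Sum>h\<in>UNIV. hinner (A h x *v partial_deriv h u x) (partial_deriv h w x))"
      by (subst sum_diag_system) (simp_all add: diag_system_def hinner_def)
    then show ?thesis
      using K(2) partial_deriv_zero_outside[of x u] unfolding K_def[symmetric]
      by (cases "x \<in> K") (auto simp: B_def hinner_def)
  qed
  obtain Bu where Bu: "Bu \<ge> 0" "\<And>h x. norm (partial_deriv h u x) \<le> Bu"
    using partial_deriv_bounded[of u] u by blast
  obtain Bw where Bw: "Bw \<ge> 0" "\<And>h x. norm (partial_deriv h w x) \<le> Bw"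
    using partial_deriv_bounded[of w] w by blast
  show ?thesis unfolding eq
  proof (rule integrable_if_entry_sum_bound[OF K, where C = "Bu * Bw"])
    show "(\<lambda>x. \<Sum>h\<in>UNIV. hinner (B h x *v partial_deriv h u x) (partial_deriv h w x)) \<in> borel_measurable lebesgue"
      unfolding B_def using u w
      by (intro borel_measurable_sum borel_measurable_hinner measurable_matrix_restrict K
          borel_measurable_continuous_lebesgue continuous_on_partial_deriv) auto
    fix x
    have "norm (\<Sum>h\<in>UNIV. hinner (B h x *v partial_deriv h u x) (partial_deriv h w x)) \<le>
        (\<Sum>h\<in>UNIV. (entry_sum (B h x) * Bu) * Bw)"
    proof (rule order_trans[OF norm_sum sum_mono])
      fix h
      show "norm (hinner (B h x *v partial_deriv h u x) (partial_deriv h w x)) \<le> (entry_sum (B h x) * Bu) * Bw"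
        by (intro order_trans[OF norm_hinner_le] mult_mono order_trans[OF norm_matrix_vector_le]
            mult_left_mono Bu Bw entry_sum_nonneg mult_nonneg_nonneg norm_ge_zero)
    qed
    then show "norm (\<Sum>h\<in>UNIV. hinner (B h x *v partial_deriv h u x) (partial_deriv h w x)) \<le>
        Bu * Bw * (\<Sum>h\<in>UNIV. entry_sum (indicat_real K x *\<^sub>R A h x))"
      by (simp add: B_def[symmetric] sum_distrib_left mult_ac)
  qed
qed

end

context admissible
begin

text \<open>\<Lambda> is continuous on positive arguments only; the value 0 at zeros of
  \<open>v\<close> fits the convention for the integrand.\<close>

lemma measurable_Lambda_norm:
  fixes v :: "real^'n \<Rightarrow> complex^'m"
  assumes "continuous_on UNIV v"
  shows "(\<lambda>x. if v x = 0 then 0 else Lambda \<phi> (norm (v x))) \<in> borel_measurable lebesgue"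
proof -
  have "(\<lambda>t. if t \<in> {0<..} then Lambda \<phi> t else 0) \<in> borel_measurable borel"
    by (intro borel_measurable_continuous_on_if continuous_on_Lambda) auto
  moreover have "(\<lambda>x. norm (v x)) \<in> borel_measurable lebesgue"
    by (intro borel_measurable_continuous_lebesgue continuous_on_norm assms)
  ultimately have "(\<lambda>x. (\<lambda>t. if t \<in> {0<..} then Lambda \<phi> t else 0) (norm (v x))) \<in> borel_measurable lebesgue"
    by (rule measurable_compose[rotated])
  moreover have "(\<lambda>x. (\<lambda>t. if t \<in> {0<..} then Lambda \<phi> t else 0) (norm (v x))) =
      (\<lambda>x. if v x = 0 then 0 else Lambda \<phi> (norm (v x)))" by auto
  ultimately show ?thesis by simp
qed

lemma borel_measurable_integral_Phi_integrand:
  fixes B :: "'n \<Rightarrow> real^'n \<Rightarrow> complex^'m^'m"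
  assumes B: "\<And>h. measurable_matrix (B h)" and v: "C1_on UNIV v"
  shows "integral_Phi_integrand \<phi> (diag_system B) v \<in> borel_measurable lebesgue"
proof -
  define l where "l x = (if v x = 0 then 0 else Lambda \<phi> (norm (v x)))" for x
  have cv: "continuous_on UNIV v" by (rule C1_on_imp_continuous_on[OF v])
  note m = measurable_Lambda_norm[OF cv, folded l_def]
    borel_measurable_continuous_lebesgue[OF cv]
    borel_measurable_continuous_lebesgue[OF continuous_on_partial_deriv[OF v]]
  note [measurable] = m(1,2) borel_measurable_hinner'[OF m(2) m(3)] borel_measurable_hinner[OF B m(3) m(3)]
    borel_measurable_hinner[OF measurable_matrix_diff_conj_transpose[OF B] m(2) m(3)]
    borel_measurable_hinner[OF B m(2) m(2)]
  have "integral_Phi_integrand \<phi> (diag_system B) v = (\<lambda>x. if v x = 0 then 0 else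
    (\<Sum>h\<in>UNIV. hinner (B h x *v partial_deriv h v x) (partial_deriv h v x)
           + of_real (l x / (norm (v x))\<^sup>2)
               * hinner ((B h x - conj_transpose (B h x)) *v v x) (partial_deriv h v x)
               * of_real (Re (hinner (v x) (partial_deriv h v x)))
           - of_real ((l x)\<^sup>2 / (norm (v x))^4)
               * hinner (B h x *v v x) (v x)
               * of_real (Re (hinner (v x) (partial_deriv h v x)))
               * of_real (Re (hinner (v x) (partial_deriv h v x)))))" (is "_ = ?R")
  proof
    fix x
    show "integral_Phi_integrand \<phi> (diag_system B) v x = ?R x"
    proof (cases "v x = 0")
      case False
      then show ?thesis by (simp only: integral_Phi_integrand_diag[of v x, OF False] l_def if_False)
    qed (simp add: integral_Phi_integrand_def)
  qed
  also have "?R \<in> borel_measurable lebesgue"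
    by measurable
  finally show ?thesis .
qed

lemma integral_Phi_integrand_restrict:
  fixes A :: "'n \<Rightarrow> real^'n \<Rightarrow> complex^'m^'m"
  assumes "closure {x. v x \<noteq> 0} \<subseteq> K" "K \<subseteq> \<Omega>"
  shows "indicat_real \<Omega> x *\<^sub>R integral_Phi_integrand \<phi> (diag_system A) v x =
    integral_Phi_integrand \<phi> (diag_system (\<lambda>h x. indicat_real K x *\<^sub>R A h x)) v x"
proof (cases "v x = 0")
  case False
  then have "x \<in> K" "x \<in> \<Omega>" using assms closure_subset[of "{x. v x \<noteq> 0}"] by auto
  then show ?thesis
    by (simp add: integral_Phi_integrand_diag[of v x, OF False])
qed (simp add: integral_Phi_integrand_def)

lemma integrable_integral_Phi_integrand:
  fixes A :: "'n \<Rightarrow> real^'n \<Rightarrow> complex^'m^'m"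
  assumes L1: "\<And>h. L1_loc_matrix \<Omega> (A h)" and \<Omega>: "open \<Omega>" and v: "v \<in> C1_0 \<Omega>"
  shows "integrable lebesgue (\<lambda>x. indicat_real \<Omega> x *\<^sub>R integral_Phi_integrand \<phi> (diag_system A) v x)"
proof -
  note v' = C1_0_iff[OF \<Omega>, THEN iffD1, OF v]
  define K where "K = closure {x. v x \<noteq> 0}"
  have K: "compact K" "K \<subseteq> \<Omega>" using v' by (auto simp: K_def)
  have eq: "indicat_real \<Omega> x *\<^sub>R integral_Phi_integrand \<phi> (diag_system A) v x =
      integral_Phi_integrand \<phi> (diag_system (\<lambda>h x. indicat_real K x *\<^sub>R A h x)) v x" for x
    by (rule integral_Phi_integrand_restrict) (use K in \<open>auto simp: K_def\<close>)
  obtain Bd where Bd: "Bd \<ge> 0" "\<And>h x. norm (partial_deriv h v x) \<le> Bd"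
    using partial_deriv_bounded[of v] v' by blast
  show ?thesis unfolding eq
  proof (rule integrable_if_entry_sum_bound[OF L1 K, where C = "4 * Bd\<^sup>2"])
    show "integral_Phi_integrand \<phi> (diag_system (\<lambda>h x. indicat_real K x *\<^sub>R A h x)) v \<in> borel_measurable lebesgue"
      using v' by (intro borel_measurable_integral_Phi_integrand measurable_matrix_restrict[OF L1 K]) auto
    fix x
    have "norm (integral_Phi_integrand \<phi> (diag_system (\<lambda>h x. indicat_real K x *\<^sub>R A h x)) v x) \<le>
      (\<Sum>h\<in>UNIV. 4 * entry_sum (indicat_real K x *\<^sub>R A h x) * (norm (partial_deriv h v x))\<^sup>2)"
      by (rule norm_integral_Phi_integrand_diag_le) (use abs_Lambda_less[of "norm (v x)"] in simp)
    also have "\<dots> \<le> (\<Sum>h\<in>UNIV. 4 * entry_sum (indicat_real K x *\<^sub>R A h x) * Bd\<^sup>2)"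
      by (intro sum_mono mult_left_mono power_mono Bd mult_nonneg_nonneg entry_sum_nonneg) auto
    also have "\<dots> = 4 * Bd\<^sup>2 * (\<Sum>h\<in>UNIV. entry_sum (indicat_real K x *\<^sub>R A h x))"
      by (simp add: sum_distrib_left mult_ac)
    finally show "norm (integral_Phi_integrand \<phi> (diag_system (\<lambda>h x. indicat_real K x *\<^sub>R A h x)) v x) \<le>
      4 * Bd\<^sup>2 * (\<Sum>h\<in>UNIV. entry_sum (indicat_real K x *\<^sub>R A h x))" .
  qed
qed

section \<open>Integrating pointwise ellipticity\<close>

lemma grad_sq_nonneg: "0 \<le> grad_sq v x"
  by (simp add: grad_sq_def sum_nonneg)

text \<open>At zeros of \<open>v\<close> the integrand is 0 by convention, so the gradient must
  vanish there too. This is assumed here because C^1 functions and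
  \<open>sqrt_phi_mult \<phi> u\<close> obtain it from different sources.\<close>

lemma AE_pointwise_elliptic_integrand:
  fixes A :: "'n \<Rightarrow> real^'n \<Rightarrow> complex^'m^'m"
  assumes ell: "pointwise_elliptic \<phi> \<Omega> A \<kappa>"
    and z: "AE x in lebesgue. v x = 0 \<longrightarrow> (\<forall>h. partial_deriv h v x = 0)"
  shows "AE x in lebesgue. x \<in> \<Omega> \<longrightarrow> \<kappa> * grad_sq v x \<le> Re (integral_Phi_integrand \<phi> (diag_system A) v x)"
  using ell[unfolded pointwise_elliptic_def] z
proof eventually_elim
  case (elim x)
  show ?case
  proof
    assume x: "x \<in> \<Omega>"
    show "\<kappa> * grad_sq v x \<le> Re (integral_Phi_integrand \<phi> (diag_system A) v x)"
    proof (cases "v x = 0")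
      case True
      then show ?thesis using elim(2) by (simp add: grad_sq_def integral_Phi_integrand_def)
    next
      case False
      have "\<kappa> * grad_sq v x = (\<Sum>h\<in>UNIV. \<kappa> * (norm (partial_deriv h v x))\<^sup>2)"
        by (simp add: grad_sq_def sum_distrib_left)
      also have "\<dots> \<le> (\<Sum>h\<in>UNIV. ell_form (A h x) (v x /\<^sub>R norm (v x)) (Lambda \<phi> (norm (v x))) (partial_deriv h v x))"
        using elim(1)[rule_format, OF x, of "v x /\<^sub>R norm (v x)" "norm (v x)"] False
        by (intro sum_mono) simp
      finally show ?thesis by (simp only: Re_integral_Phi_integrand_diag[of v x, OF False])
    qed
  qed
qed

lemma Re_LINT:
  assumes "integrable lebesgue (\<lambda>x. indicat_real \<Omega> x *\<^sub>R F x :: complex)"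
  shows "Re (LINT x:\<Omega>|lebesgue. F x) = (LINT x|lebesgue. indicat_real \<Omega> x * Re (F x))"
    "integrable lebesgue (\<lambda>x. indicat_real \<Omega> x * Re (F x))"
  using integral_Re[OF assms] integrable_Re[OF assms] by (simp_all add: set_lebesgue_integral_def)

text \<open>If the integral of \<open>g\<close> fails to exist, it is 0 by default and nonnegativity
  of the right side is enough. That covers \<open>grad_sq (sqrt_phi_mult \<phi> u)\<close>, which is
  not shown to be continuous.\<close>

lemma LINT_lower_bound:
  fixes F :: "real^'n \<Rightarrow> complex" and g :: "real^'n \<Rightarrow> real"
  assumes int: "integrable lebesgue (\<lambda>x. indicat_real \<Omega> x *\<^sub>R F x)" and "\<kappa> \<ge> 0"
    and le: "AE x in lebesgue. x \<in> \<Omega> \<longrightarrow> \<kappa> * g x \<le> Re (F x)" and g: "\<And>x. 0 \<le> g x"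
  shows "\<kappa> * (LINT x:\<Omega>|lebesgue. g x) \<le> Re (LINT x:\<Omega>|lebesgue. F x)"
proof -
  have "\<kappa> * (LINT x:\<Omega>|lebesgue. g x) = (LINT x|lebesgue. indicat_real \<Omega> x * (\<kappa> * g x))"
    by (simp add: set_lebesgue_integral_def mult.left_commute[of _ \<kappa>])
  also have "\<dots> \<le> (LINT x|lebesgue. indicat_real \<Omega> x * Re (F x))"
  proof (rule integral_mono_AE'[OF Re_LINT(2)[OF int]])
    show "AE x in lebesgue. indicat_real \<Omega> x * (\<kappa> * g x) \<le> indicat_real \<Omega> x * Re (F x)"
      using le by eventually_elim (auto simp: indicator_def)
    show "AE x in lebesgue. 0 \<le> indicat_real \<Omega> x * Re (F x)"
      using le by eventually_elim (use g \<open>\<kappa> \<ge> 0\<close> in \<open>auto simp: indicator_def intro: order_trans[rotated]\<close>)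
  qed
  finally show ?thesis by (simp only: Re_LINT(1)[OF int])
qed

lemma pointwise_imp_integral_bound:
  fixes A :: "'n \<Rightarrow> real^'n \<Rightarrow> complex^'m^'m"
  assumes L1: "\<And>h. L1_loc_matrix \<Omega> (A h)" and \<Omega>: "open \<Omega>" and "\<kappa> \<ge> 0"
    and ell: "pointwise_elliptic \<phi> \<Omega> A \<kappa>" and v: "v \<in> C1_0 \<Omega>"
  shows "\<kappa> * (LINT x:\<Omega>|lebesgue. grad_sq v x) \<le>
    Re (LINT x:\<Omega>|lebesgue. integral_Phi_integrand \<phi> (diag_system A) v x)"
proof (rule LINT_lower_bound[OF integrable_integral_Phi_integrand[OF L1 \<Omega> v] \<open>\<kappa> \<ge> 0\<close> _ grad_sq_nonneg])
  have "C1_on UNIV v" using v by (simp add: C1_0_iff[OF \<Omega>])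
  then have "AE x in lebesgue. v x = 0 \<longrightarrow> (\<forall>h. partial_deriv h v x = 0)"
    using AE_zero_set_frechet_zero[of v] by (auto simp: partial_deriv_def elim: eventually_mono)
  then show "AE x in lebesgue. x \<in> \<Omega> \<longrightarrow> \<kappa> * grad_sq v x \<le> Re (integral_Phi_integrand \<phi> (diag_system A) v x)"
    by (rule AE_pointwise_elliptic_integrand[OF ell])
qed

lemma phi_test_functionsD:
  assumes "open \<Omega>" "u \<in> phi_test_functions \<phi> \<Omega>"
  shows "u \<in> C1_0 \<Omega>" "phi_mult \<phi> u \<in> C1_0 \<Omega>" "C1_on UNIV u" "C1_on UNIV (phi_mult \<phi> u)"
  using assms(2) by (auto simp: phi_test_functions_def C1_0_iff[OF assms(1)])

lemma pointwise_imp_phi_form_bound: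
  fixes A :: "'n \<Rightarrow> real^'n \<Rightarrow> complex^'m^'m"
  assumes L1: "\<And>h. L1_loc_matrix \<Omega> (A h)" and \<Omega>: "open \<Omega>" and "\<kappa> \<ge> 0"
    and ell: "pointwise_elliptic \<phi> \<Omega> A \<kappa>" and u: "u \<in> phi_test_functions \<phi> \<Omega>"
  shows "\<kappa> * (LINT x:\<Omega>|lebesgue. grad_sq (sqrt_phi_mult \<phi> u) x) \<le> Re (phi_form \<phi> \<Omega> (diag_system A) u)"
  unfolding phi_form_def
proof (rule LINT_lower_bound[OF _ \<open>\<kappa> \<ge> 0\<close> _ grad_sq_nonneg])
  note u' = phi_test_functionsD[OF \<Omega> u]
  show "integrable lebesgue (\<lambda>x. indicat_real \<Omega> x *\<^sub>R (\<Sum>h\<in>UNIV. \<Sum>k\<in>UNIV.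
        hinner (diag_system A h k x *v partial_deriv k u x) (partial_deriv h (phi_mult \<phi> u) x)))"
    by (rule integrable_phi_integrand[OF L1 \<Omega> u'(1,2)])
  have "AE x in lebesgue. sqrt_phi_mult \<phi> u x = 0 \<longrightarrow> (\<forall>h. partial_deriv h (sqrt_phi_mult \<phi> u) x = 0)"
    using AE_zero_set_partial_deriv[OF u'(3,4)] by eventually_elim (simp add: sqrt_phi_mult_eq_0_iff)
  from AE_pointwise_elliptic_integrand[OF ell this] AE_Re_phi_integrand[OF u'(3,4), of A]
  show "AE x in lebesgue. x \<in> \<Omega> \<longrightarrow> \<kappa> * grad_sq (sqrt_phi_mult \<phi> u) x \<le> Re (\<Sum>h\<in>UNIV. \<Sum>k\<in>UNIV.
        hinner (diag_system A h k x *v partial_deriv k u x) (partial_deriv h (phi_mult \<phi> u) x))"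
    by eventually_elim simp
qed

lemma Re_phi_form:
  fixes A :: "'n \<Rightarrow> real^'n \<Rightarrow> complex^'m^'m"
  assumes L1: "\<And>h. L1_loc_matrix \<Omega> (A h)" and \<Omega>: "open \<Omega>"
    and u: "u \<in> phi_test_functions \<phi> \<Omega>" and v: "sqrt_phi_mult \<phi> u \<in> C1_0 \<Omega>"
  shows "Re (phi_form \<phi> \<Omega> (diag_system A) u) =
    Re (LINT x:\<Omega>|lebesgue. integral_Phi_integrand \<phi> (diag_system A) (sqrt_phi_mult \<phi> u) x)"
proof -
  note u' = phi_test_functionsD[OF \<Omega> u]
  note i1 = integrable_phi_integrand[OF L1 \<Omega> u'(1,2)] and i2 = integrable_integral_Phi_integrand[OF L1 \<Omega> v]
  show ?thesis
    unfolding phi_form_def Re_LINT(1)[OF i1] Re_LINT(1)[OF i2]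
  proof (rule integral_cong_AE)
    show "AE x in lebesgue. indicat_real \<Omega> x * Re (\<Sum>h\<in>UNIV. \<Sum>k\<in>UNIV.
        hinner (diag_system A h k x *v partial_deriv k u x) (partial_deriv h (phi_mult \<phi> u) x)) =
        indicat_real \<Omega> x * Re (integral_Phi_integrand \<phi> (diag_system A) (sqrt_phi_mult \<phi> u) x)"
      using AE_Re_phi_integrand[OF u'(3,4), of A] by eventually_elim simp
  qed (use Re_LINT(2)[OF i1] Re_LINT(2)[OF i2] in auto)
qed

end

section \<open>Localized test functions\<close>

lemma C1_on_pos_part_sq: "C1_on UNIV (\<lambda>y::real. (max 0 y)\<^sup>2)"
proof (rule C1_on_realI)
  show "((\<lambda>y::real. (max 0 y)\<^sup>2) has_real_derivative 2 * max 0 y) (at y)" for y :: real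
  proof -
    consider "y > 0" | "y < 0" | "y = 0" by linarith
    then show ?thesis
    proof cases
      case 1
      have "((\<lambda>y::real. y\<^sup>2) has_real_derivative 2 * max 0 y) (at y)"
        using 1 by (auto intro!: derivative_eq_intros)
      then show ?thesis
        by (rule has_field_derivative_transform_within_open[of _ _ _ "{0<..}"]) (use 1 in auto)
    next
      case 2
      have "((\<lambda>y::real. 0) has_real_derivative 2 * max 0 y) (at y)"
        using 2 by simp
      then show ?thesis
        by (rule has_field_derivative_transform_within_open[of _ _ _ "{..<0}"]) (use 2 in auto)
    next
      case 3
      have "((\<lambda>y::real. (max 0 y)\<^sup>2) has_real_derivative 0) (at 0)"
        unfolding DERIV_def
      proof (rule Lim_null_comparison[where g = abs])
        show "\<forall>\<^sub>F y in at 0. norm (((max 0 (0 + y))\<^sup>2 - (max 0 0)\<^sup>2) / y) \<le> \<bar>y :: real\<bar>"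
          by (intro always_eventually allI) (auto simp: max_def power2_eq_square)
        show "(abs \<longlongrightarrow> (0::real)) (at 0)" by (rule tendsto_rabs_zero[OF tendsto_ident_at])
      qed
      with 3 show ?thesis by simp
    qed
  qed
  show "continuous_on UNIV (\<lambda>y::real. 2 * max 0 y)" by (intro continuous_intros)
qed

text \<open>A C^1 transition from 0 to 1 over the unit interval; \<open>y\<close> and
  \<open>1 - y\<close> are never both nonpositive, which keeps the denominator positive.\<close>

definition smooth_step :: "real \<Rightarrow> real" where
  "smooth_step y = (max 0 y)\<^sup>2 * inverse ((max 0 y)\<^sup>2 + (max 0 (1 - y))\<^sup>2)"

lemma smooth_step_denom: "(max 0 y)\<^sup>2 + (max 0 (1 - y))\<^sup>2 > (0::real)"
proof (cases "y > 0")
  case True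
  then have "(max 0 y)\<^sup>2 > 0" by simp
  then show ?thesis by (rule add_pos_nonneg) simp
next
  case False
  then have "(max 0 (1 - y))\<^sup>2 > 0" by simp
  then show ?thesis by (rule add_nonneg_pos[rotated]) simp
qed

lemma C1_on_smooth_step: "C1_on UNIV smooth_step"
proof -
  have l: "C1_on UNIV (\<lambda>y::real. 1 - y)"
    by (rule C1_on_realI[where F' = "\<lambda>_. -1"]) (auto intro!: derivative_eq_intros)
  have c: "C1_on UNIV (\<lambda>y::real. (max 0 (1 - y))\<^sup>2)"
    by (rule C1_on_compose[OF C1_on_pos_part_sq l]) simp
  have "C1_on {0<..} (inverse :: real \<Rightarrow> real)"
    by (rule C1_on_realI[where F' = "\<lambda>y. - (inverse y * inverse y)"])
      (auto intro!: derivative_eq_intros continuous_intros)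
  from C1_on_compose[OF this C1_on_add[OF C1_on_pos_part_sq c]]
  have "C1_on UNIV (\<lambda>y::real. inverse ((max 0 y)\<^sup>2 + (max 0 (1 - y))\<^sup>2))"
    using smooth_step_denom by blast
  from C1_on_mult[OF C1_on_pos_part_sq this] show ?thesis by (simp only: smooth_step_def[abs_def])
qed

lemma smooth_step_le_0: "y \<le> 0 \<Longrightarrow> smooth_step y = 0"
  by (simp add: smooth_step_def)

lemma smooth_step_ge_1: "y \<ge> 1 \<Longrightarrow> smooth_step y = 1"
  by (simp add: smooth_step_def)

lemma smooth_step_bounds: "0 \<le> smooth_step y" "smooth_step y \<le> 1"
proof -
  have "smooth_step y = (max 0 y)\<^sup>2 / ((max 0 y)\<^sup>2 + (max 0 (1 - y))\<^sup>2)"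
    by (simp add: smooth_step_def divide_inverse)
  then show "smooth_step y \<le> 1" using smooth_step_denom[of y] by (simp add: divide_le_eq)
  show "0 \<le> smooth_step y" using smooth_step_denom[of y] by (simp add: smooth_step_def less_imp_le)
qed

lemma C1_on_vec_nth: "C1_on S (\<lambda>x::real^'n. x $ i)"
  by (rule C1_on_bounded_linear[OF bounded_linear_vec_nth])

lemma C1_on_diff:
  "C1_on S f \<Longrightarrow> C1_on S g \<Longrightarrow> C1_on S (\<lambda>x. f x - g x)"
  using C1_on_add[of S f "\<lambda>x. (-1) *\<^sub>R g x"] C1_on_scaleR[of S "\<lambda>x. -1" g] by simp

text \<open>Positivity exactly on the open box is the point: \<open>smooth_step\<close> of growing
  multiples converges to the indicator of the box, and one large multiple is already constant on a
  given compact part of it.\<close>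

lemma ex_C1_box_function:
  fixes a b :: "real^'n"
  shows "\<exists>g::real^'n \<Rightarrow> real. C1_on UNIV g \<and> (\<forall>x. 0 \<le> g x) \<and> (\<forall>x. 0 < g x \<longleftrightarrow> x \<in> box a b)"
proof -
  define g where "g x = (\<Prod>i\<in>UNIV. (max 0 (x $ i - a $ i))\<^sup>2 * (max 0 (b $ i - x $ i))\<^sup>2)" for x :: "real^'n"
  have "C1_on UNIV (\<lambda>x::real^'n. (max 0 (x $ i - a $ i))\<^sup>2 * (max 0 (b $ i - x $ i))\<^sup>2)" for i
    by (intro C1_on_mult C1_on_compose[OF C1_on_pos_part_sq] C1_on_diff C1_on_vec_nth C1_on_const) auto
  then have "C1_on UNIV g" unfolding g_def[abs_def] by (rule C1_on_prod)
  moreover have nn: "0 \<le> g x" for x unfolding g_def by (intro prod_nonneg) simp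
  moreover have "0 < g x \<longleftrightarrow> x \<in> box a b" for x
  proof
    assume x: "x \<in> box a b"
    show "0 < g x" unfolding g_def by (intro prod_pos ballI mult_pos_pos zero_less_power)
      (use x in \<open>auto simp: mem_box_cart less_max_iff_disj\<close>)
  next
    assume pos: "0 < g x"
    have nz: "(max 0 (x $ i - a $ i))\<^sup>2 * (max 0 (b $ i - x $ i))\<^sup>2 \<noteq> 0" for i
    proof
      assume "(max 0 (x $ i - a $ i))\<^sup>2 * (max 0 (b $ i - x $ i))\<^sup>2 = 0"
      then have "g x = 0" unfolding g_def by (intro prod_zero) (rule finite, rule bexI[of _ i], auto)
      with pos show False by simp
    qed
    have "a $ i < x $ i \<and> x $ i < b $ i" for i using nz[of i] by (auto simp: max_def split: if_splits)
    then show "x \<in> box a b" by (simp add: mem_box_cart)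
  qed
  ultimately show ?thesis by blast
qed

lemma C1_0_if_supported_in_cbox:
  fixes u :: "real^'n \<Rightarrow> complex^'m"
  assumes "open \<Omega>" "C1_on UNIV u" "cbox a b \<subseteq> \<Omega>" "\<And>x. x \<notin> cbox a b \<Longrightarrow> u x = 0"
  shows "u \<in> C1_0 \<Omega>"
proof -
  have "closure {x. u x \<noteq> 0} \<subseteq> cbox a b"
    by (rule closure_minimal) (use assms(4) in auto)
  moreover have "compact (closure {x. u x \<noteq> 0})"
    using closed_Int_compact[OF closed_closure compact_cbox, of "{x. u x \<noteq> 0}" a b] calculation
    by (simp add: Int_absorb2)
  ultimately show ?thesis using assms by (auto simp: C1_0_iff)
qed

context admissible
begin

text \<open>Two open sets cover the space. On \<open>U\<close> the length of \<open>v\<close> is at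
  least \<open>t / 2\<close>, so inverting the substitution stays away from the singularity of
  \<phi> at 0. Off \<open>cbox a b\<close> the perturbation vanishes and \<open>u\<close> is
  \<open>\<tau> f\<close> times the fixed vector \<omega>, where the profile makes \<open>u\<close>,
  \<open>phi_mult \<phi> u\<close> and \<open>v\<close> all C^1 even at zeros of
  \<open>f\<close>.\<close>

lemma ex_localized_test_functions:
  fixes \<omega> :: "complex^'m" and a b :: "real^'n"
  assumes \<Omega>: "open \<Omega>" and ab: "cbox a b \<subseteq> box a' b'" and a'b': "cbox a' b' \<subseteq> \<Omega>"
    and \<omega>: "norm \<omega> = 1" and t: "t > 0"
  shows "\<exists>v0 U. open U \<and> cbox a b \<subseteq> U \<and> (\<forall>x\<in>U. v0 x = t *\<^sub>R \<omega>) \<and> v0 \<in> C1_0 \<Omega> \<and>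
    (\<forall>\<zeta>. C1_on UNIV \<zeta> \<longrightarrow> (\<forall>x. x \<notin> cbox a b \<longrightarrow> \<zeta> x = 0) \<longrightarrow> (\<forall>x. norm (\<zeta> x) \<le> t / 2) \<longrightarrow>
      (\<exists>u\<in>phi_test_functions \<phi> \<Omega>. (\<lambda>x. v0 x + \<zeta> x) = sqrt_phi_mult \<phi> u) \<and> (\<lambda>x. v0 x + \<zeta> x) \<in> C1_0 \<Omega>)"
proof -
  obtain \<tau> :: "real \<Rightarrow> real" where \<tau>0: "\<tau> 0 = 0" and \<tau>pos: "\<And>y. y \<noteq> 0 \<Longrightarrow> \<tau> y > 0" and \<tau>: "C1_on UNIV \<tau>"
      "C1_on UNIV (\<lambda>y. P (\<tau> y))" "C1_on UNIV (\<lambda>y. G (\<tau> y))" and surj: "\<And>t. t > 0 \<Longrightarrow> \<exists>c>0. G (\<tau> c) = t"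
    using ex_C1_profile by blast
  obtain c where c: "c > 0" "G (\<tau> c) = t" using surj[OF t] by blast
  obtain g :: "real^'n \<Rightarrow> real" where g: "C1_on UNIV g" "\<And>x. 0 \<le> g x" "\<And>x. 0 < g x \<longleftrightarrow> x \<in> box a' b'"
    using ex_C1_box_function[of a' b'] by blast
  \<comment> \<open>A positive minimum over the compact box; placing the plateau of \<open>f\<close>
    at half of it leaves room for an open neighbourhood \<open>U\<close>.\<close>
  obtain \<mu> where \<mu>: "\<mu> > 0" "\<And>x. x \<in> cbox a b \<Longrightarrow> \<mu> \<le> g x"
  proof (cases "cbox a b = {}")
    case True
    then show ?thesis using that[of 1] by simp
  next
    case False
    obtain x0 where "x0 \<in> cbox a b" "\<And>x. x \<in> cbox a b \<Longrightarrow> g x0 \<le> g x"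
      using continuous_attains_inf[OF compact_cbox False continuous_on_subset[OF C1_on_imp_continuous_on[OF g(1)]]]
      by blast
    then show ?thesis using that[of "g x0"] g(3)[of x0] ab by blast
  qed
  define f where "f x = c * smooth_step (2 / \<mu> * g x)" for x
  have f: "C1_on UNIV f"
    unfolding f_def[abs_def] by (intro C1_on_mult C1_on_compose[OF C1_on_smooth_step] g C1_on_const) simp
  define U where "U = {x. \<mu> / 2 < g x}"
  have U: "open U" unfolding U_def
    by (intro open_Collect_less continuous_on_const C1_on_imp_continuous_on[OF g(1)])
  have abU: "cbox a b \<subseteq> U" using \<mu> by (force simp: U_def)
  have fU: "f x = c" if "x \<in> U" for x
    using that \<mu>(1) by (simp add: f_def U_def smooth_step_ge_1 field_simps)
  have f0: "f x = 0" if "x \<notin> cbox a' b'" for x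
  proof -
    have "x \<notin> box a' b'" using that box_subset_cbox by blast
    then have "g x = 0" using g(2,3)[of x] by force
    then show ?thesis by (simp add: f_def smooth_step_le_0)
  qed
  define v0 where "v0 x = G (\<tau> (f x)) *\<^sub>R \<omega>" for x
  have v0C1: "C1_on UNIV v0"
    unfolding v0_def[abs_def] by (intro C1_on_scaleR C1_on_const C1_on_compose[OF \<tau>(3) f]) simp
  have v00: "v0 x = 0" if "x \<notin> cbox a' b'" for x
    by (simp add: v0_def f0[OF that] \<tau>0 G_def)
  have main: "(\<exists>u\<in>phi_test_functions \<phi> \<Omega>. (\<lambda>x. v0 x + \<zeta> x) = sqrt_phi_mult \<phi> u) \<and> (\<lambda>x. v0 x + \<zeta> x) \<in> C1_0 \<Omega>"
    if \<zeta>: "C1_on UNIV \<zeta>" "\<And>x. x \<notin> cbox a b \<Longrightarrow> \<zeta> x = 0" "\<And>x. norm (\<zeta> x) \<le> t / 2" for \<zeta>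
  proof -
    define v where "v x = v0 x + \<zeta> x" for x
    have vC1: "C1_on UNIV v" unfolding v_def[abs_def] by (rule C1_on_add[OF v0C1 \<zeta>(1)])
    have v_out: "v x = 0" if "x \<notin> cbox a' b'" for x
    proof -
      have "x \<notin> cbox a b" using that ab box_subset_cbox by blast
      then show ?thesis using v00[OF that] \<zeta>(2) by (simp add: v_def)
    qed
    have vU: "v x \<noteq> 0" if "x \<in> U" for x
    proof
      assume "v x = 0"
      then have "norm (v0 x) = norm (\<zeta> x)" by (simp add: v_def eq_neg_iff_add_eq_0[symmetric])
      moreover have "norm (v0 x) = t" using c t by (simp add: v0_def fU[OF that] \<omega>)
      ultimately show False using \<zeta>(3)[of x] t by simp
    qed
    \<comment> \<open>Inverts \<open>u \<mapsto> \<surd>\<phi>(|u|) u\<close>; division by \<open>0\<close> yields the required value \<open>0\<close> where \<open>v\<close> vanishes.\<close>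
    define u where "u x = (S (norm (v x)) / norm (v x)) *\<^sub>R v x" for x
    have nu: "norm (u x) = S (norm (v x))" if "v x \<noteq> 0" for x
      using that S_pos[of "norm (v x)"] by (simp add: u_def)
    have pm: "phi_mult \<phi> u x = (P (S (norm (v x))) / norm (v x)) *\<^sub>R v x" for x
    proof (cases "v x = 0")
      case False
      then show ?thesis unfolding phi_mult_def nu[OF False] by (simp add: u_def P_def mult.commute)
    qed (simp add: phi_mult_def u_def)
    have sm: "sqrt_phi_mult \<phi> u x = v x" for x
    proof (cases "v x = 0")
      case False
      have "sqrt_phi_mult \<phi> u x = (G (S (norm (v x))) / norm (v x)) *\<^sub>R v x"
        unfolding sqrt_phi_mult_def nu[OF False] by (simp add: u_def G_def mult.commute)
      also have "\<dots> = v x" using False G_S[of "norm (v x)"] by simp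
      finally show ?thesis .
    qed (simp add: sqrt_phi_mult_def u_def)
    \<comment> \<open>Applied to the identity, which gives \<open>u\<close>, and to
      \<open>P\<close>, which gives \<open>phi_mult \<phi> u\<close>.\<close>
    have C1F: "C1_on UNIV (\<lambda>x. (F (S (norm (v x))) / norm (v x)) *\<^sub>R v x)"
      if F: "C1_on {0<..} F" "C1_on UNIV (\<lambda>y. F (\<tau> y))" "F 0 = 0" for F
    proof -
      have inv: "C1_on {0<..} (inverse :: real \<Rightarrow> real)"
        by (rule C1_on_realI[where F' = "\<lambda>y. - (inverse y * inverse y)"])
          (auto intro!: derivative_eq_intros continuous_intros)
      have nv: "C1_on U (\<lambda>x. norm (v x))" by (intro C1_on_norm vU C1_on_subset[OF vC1]) auto
      have im: "(\<lambda>x. norm (v x)) ` U \<subseteq> {0<..}" using vU by auto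
      have "C1_on U (\<lambda>x. (F (S (norm (v x))) * inverse (norm (v x))) *\<^sub>R v x)"
        using S_pos vU
        by (intro C1_on_scaleR C1_on_mult C1_on_compose[OF F(1)] C1_on_compose[OF C1_on_S nv im]
            C1_on_compose[OF inv nv im] C1_on_subset[OF vC1]) auto
      then have 1: "C1_on U (\<lambda>x. (F (S (norm (v x))) / norm (v x)) *\<^sub>R v x)"
        by (simp only: divide_inverse)
      \<comment> \<open>Here \<zeta> vanishes and the function equals \<open>F (\<tau> f)\<close>
        times \<omega>, so the profile takes care of the points where \<open>f = 0\<close>.\<close>
      have 2: "C1_on (- cbox a b) (\<lambda>x. (F (S (norm (v x))) / norm (v x)) *\<^sub>R v x)"
      proof (rule C1_on_cong[of _ "\<lambda>x. F (\<tau> (f x)) *\<^sub>R \<omega>"])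
        show "open (- cbox a b)" by (rule open_Compl[OF closed_cbox])
        show "C1_on (- cbox a b) (\<lambda>x. F (\<tau> (f x)) *\<^sub>R \<omega>)"
          by (intro C1_on_scaleR C1_on_const C1_on_compose[OF F(2)] C1_on_subset[OF f]) auto
        fix x assume "x \<in> - cbox a b"
        then have vx: "v x = G (\<tau> (f x)) *\<^sub>R \<omega>" using \<zeta>(2) by (simp add: v_def v0_def)
        show "F (\<tau> (f x)) *\<^sub>R \<omega> = (F (S (norm (v x))) / norm (v x)) *\<^sub>R v x"
        proof (cases "f x = 0")
          case True
          then show ?thesis by (simp add: vx \<tau>0 F(3) G_def)
        next
          case False
          then have p: "\<tau> (f x) > 0" by (rule \<tau>pos)
          then have "norm (v x) = G (\<tau> (f x))" using G_pos[OF p] by (simp add: vx \<omega>)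
          then show ?thesis using G_pos[OF p] by (simp add: vx S_G[OF p])
        qed
      qed
      have "U \<union> - cbox a b = UNIV" using abU by auto
      then show ?thesis using C1_on_open_Un[OF U open_Compl[OF closed_cbox] 1 2] by simp
    qed
    have "C1_on UNIV (\<lambda>x. ((\<lambda>s. s) (S (norm (v x))) / norm (v x)) *\<^sub>R v x)"
      by (rule C1F) (auto intro: \<tau>(1) C1_on_bounded_linear bounded_linear_ident)
    then have uC1: "C1_on UNIV u" by (simp only: u_def[abs_def])
    have PC1: "C1_on {0<..} P"
      by (rule C1_on_realI[OF _ continuous_on_P']) (simp add: P_deriv)
    have pC: "C1_on UNIV (\<lambda>x. (P (S (norm (v x))) / norm (v x)) *\<^sub>R v x)"
      by (rule C1F[OF PC1 \<tau>(2)]) (simp add: P_def)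
    have "phi_mult \<phi> u = (\<lambda>x. (P (S (norm (v x))) / norm (v x)) *\<^sub>R v x)" using pm by (rule ext)
    with pC have pC1: "C1_on UNIV (phi_mult \<phi> u)" by (simp only:)
    have "u \<in> phi_test_functions \<phi> \<Omega>"
      unfolding phi_test_functions_def
      using C1_0_if_supported_in_cbox[OF \<Omega> uC1 a'b'] C1_0_if_supported_in_cbox[OF \<Omega> pC1 a'b'] v_out
      by (simp add: u_def pm)
    moreover have "v \<in> C1_0 \<Omega>" by (rule C1_0_if_supported_in_cbox[OF \<Omega> vC1 a'b' v_out])
    moreover have "v = sqrt_phi_mult \<phi> u" using sm by auto
    ultimately show ?thesis unfolding v_def[abs_def] by blast
  qed
  show ?thesis
  proof (intro exI[of _ v0] exI[of _ U] conjI allI impI ballI)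
    show "open U" "cbox a b \<subseteq> U" by (fact U abU)+
    show "v0 x = t *\<^sub>R \<omega>" if "x \<in> U" for x by (simp add: v0_def fU[OF that] c)
    show "v0 \<in> C1_0 \<Omega>" by (rule C1_0_if_supported_in_cbox[OF \<Omega> v0C1 a'b' v00])
    fix \<zeta> :: "real^'n \<Rightarrow> complex^'m" assume "C1_on UNIV \<zeta>" "\<forall>x. x \<notin> cbox a b \<longrightarrow> \<zeta> x = 0" "\<forall>x. norm (\<zeta> x) \<le> t / 2"
    then have m: "(\<exists>u\<in>phi_test_functions \<phi> \<Omega>. (\<lambda>x. v0 x + \<zeta> x) = sqrt_phi_mult \<phi> u) \<and> (\<lambda>x. v0 x + \<zeta> x) \<in> C1_0 \<Omega>"
      by (intro main) auto
    show "\<exists>u\<in>phi_test_functions \<phi> \<Omega>. (\<lambda>x. v0 x + \<zeta> x) = sqrt_phi_mult \<phi> u"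
      by (rule conjunct1[OF m])
    show "(\<lambda>x. v0 x + \<zeta> x) \<in> C1_0 \<Omega>" by (rule conjunct2[OF m])
  qed
qed

end

section \<open>Oscillating test functions\<close>

text \<open>The gradient is written as \<open>r\<close> times a bounded factor: with amplitude
  \<open>1/r\<close> and frequency \<open>r^2\<close> the oscillation contributes order
  \<open>r\<close>, and only in direction \<open>h\<close>, while the derivative of the cutoff is
  smaller by \<open>1/r^2\<close>.\<close>

lemma partial_deriv_oscillation:
  fixes \<psi> :: "real^'n \<Rightarrow> real" and \<eta> :: "complex^'m" and cs cs' :: "real \<Rightarrow> real" and r :: real
    and h k :: 'n and x :: "real^'n"
  assumes \<psi>: "C1_on UNIV \<psi>" and cs: "\<And>y. (cs has_real_derivative cs' y) (at y)" "continuous_on UNIV cs'"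
    and r: "r > 0"
  defines "\<zeta> \<equiv> \<lambda>x. (1 / r * \<psi> x * cs (r\<^sup>2 * x $ h)) *\<^sub>R \<eta>"
  shows "C1_on UNIV \<zeta>"
    and "(\<zeta> has_derivative frechet_derivative \<zeta> (at x)) (at x)"
    and "partial_deriv k \<zeta> x = (r * (1 / r\<^sup>2 * frechet_derivative \<psi> (at x) (axis k 1) * cs (r\<^sup>2 * x $ h)
      + (if k = h then \<psi> x * cs' (r\<^sup>2 * x $ h) else 0))) *\<^sub>R \<eta>"
proof -
  have l: "C1_on UNIV (\<lambda>x::real^'n. r\<^sup>2 * x $ h)" by (intro C1_on_mult C1_on_vec_nth C1_on_const)
  have "C1_on UNIV cs" by (rule C1_on_realI[OF cs])
  from C1_on_compose[OF this l] have c: "C1_on UNIV (\<lambda>x::real^'n. cs (r\<^sup>2 * x $ h))" by simp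
  show C1: "C1_on UNIV \<zeta>"
    unfolding \<zeta>_def by (intro C1_on_scaleR C1_on_mult C1_on_const \<psi> c)
  show "(\<zeta> has_derivative frechet_derivative \<zeta> (at x)) (at x)" by (rule C1_on_frechet(1)[OF C1 UNIV_I])
  have dl: "((\<lambda>x::real^'n. r\<^sup>2 * x $ h) has_derivative (\<lambda>k. r\<^sup>2 * k $ h)) (at x)"
    by (rule bounded_linear_imp_has_derivative) 
      (rule bounded_linear_const_mult[OF bounded_linear_vec_nth])
  have dc: "((\<lambda>x. cs (r\<^sup>2 * x $ h)) has_derivative (\<lambda>k. cs' (r\<^sup>2 * x $ h) * (r\<^sup>2 * k $ h))) (at x)"
    using has_derivative_compose[OF dl, of cs "(*) (cs' (r\<^sup>2 * x $ h))"] cs(1)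
    by (simp add: has_field_derivative_def)
  have dp: "(\<psi> has_derivative frechet_derivative \<psi> (at x)) (at x)" by (rule C1_on_frechet(1)[OF \<psi> UNIV_I])
  have "((\<lambda>x. (1 / r) *\<^sub>R (\<psi> x * cs (r\<^sup>2 * x $ h)) *\<^sub>R \<eta>) has_derivative
      (\<lambda>k. (1 / r) *\<^sub>R (\<psi> x * (cs' (r\<^sup>2 * x $ h) * (r\<^sup>2 * k $ h))
         + frechet_derivative \<psi> (at x) k * cs (r\<^sup>2 * x $ h)) *\<^sub>R \<eta>)) (at x)"
    by (intro has_derivative_scaleR_right has_derivative_scaleR_left has_derivative_mult dp dc)
  then have "(\<zeta> has_derivative
      (\<lambda>k. (1 / r) *\<^sub>R (\<psi> x * (cs' (r\<^sup>2 * x $ h) * (r\<^sup>2 * k $ h))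
         + frechet_derivative \<psi> (at x) k * cs (r\<^sup>2 * x $ h)) *\<^sub>R \<eta>)) (at x)"
    unfolding \<zeta>_def by (simp add: mult.assoc)
  from frechet_derivative_at[OF this, symmetric]
  have "partial_deriv k \<zeta> x = (1 / r) *\<^sub>R (\<psi> x * (cs' (r\<^sup>2 * x $ h) * (r\<^sup>2 * axis k 1 $ h))
         + frechet_derivative \<psi> (at x) (axis k 1) * cs (r\<^sup>2 * x $ h)) *\<^sub>R \<eta>"
    by (simp add: partial_deriv_def)
  moreover have "1 / r * (\<psi> x * (cs' (r\<^sup>2 * x $ h) * (r\<^sup>2 * (axis k 1 :: real^'n) $ h))
         + frechet_derivative \<psi> (at x) (axis k 1) * cs (r\<^sup>2 * x $ h)) =
     r * (1 / r\<^sup>2 * frechet_derivative \<psi> (at x) (axis k 1) * cs (r\<^sup>2 * x $ h)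
      + (if k = h then \<psi> x * cs' (r\<^sup>2 * x $ h) else 0))"
    using r by (auto simp: axis_def field_simps power2_eq_square)
  ultimately show "partial_deriv k \<zeta> x = (r * (1 / r\<^sup>2 * frechet_derivative \<psi> (at x) (axis k 1) * cs (r\<^sup>2 * x $ h)
      + (if k = h then \<psi> x * cs' (r\<^sup>2 * x $ h) else 0))) *\<^sub>R \<eta>"
    by (simp only: scaleR_scaleR)
qed

text \<open>The constant \<open>c\<close> lets \<open>v\<close> be compared with \<zeta> where
  \<open>v0\<close> is constant, and with \<open>v0\<close> where \<zeta> vanishes.\<close>

lemma partial_deriv_cong:
  fixes u w :: "real^'n \<Rightarrow> complex^'m"
  assumes "open U" "x \<in> U" "\<And>y. y \<in> U \<Longrightarrow> u y = c + w y" "(w has_derivative frechet_derivative w (at x)) (at x)"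
  shows "partial_deriv k u x = partial_deriv k w x"
proof -
  have "((\<lambda>y. c + w y) has_derivative frechet_derivative w (at x)) (at x)"
    using has_derivative_add[OF has_derivative_const assms(4)] by simp
  then have "(u has_derivative frechet_derivative w (at x)) (at x)"
    by (rule has_derivative_transform_within_open[OF _ assms(1,2)]) (simp add: assms(3))
  then show ?thesis by (simp add: partial_deriv_def frechet_derivative_at[symmetric])
qed

lemma integrable_grad_sq:
  fixes v :: "real^'n \<Rightarrow> complex^'m"
  assumes "C1_on UNIV v" "compact (closure {x. v x \<noteq> 0})"
  shows "integrable lebesgue (grad_sq v)"
proof -
  define K where "K = closure {x. v x \<noteq> 0}"
  obtain B where B: "B \<ge> 0" "\<And>h x. norm (partial_deriv h v x) \<le> B" using partial_deriv_bounded[OF assms] by blast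
  have "integrable lebesgue (\<lambda>x. indicat_real K x * (real CARD('n) * B\<^sup>2))"
    using lmeasurable_compact[OF assms(2)] by (simp add: K_def fmeasurable_def)
  then show ?thesis
  proof (rule Bochner_Integration.integrable_bound)
    show "grad_sq v \<in> borel_measurable lebesgue"
      unfolding grad_sq_def[abs_def]
      by (intro borel_measurable_continuous_lebesgue continuous_intros continuous_on_partial_deriv[OF assms(1)])
    have "norm (grad_sq v x) \<le> norm (indicat_real K x * (real CARD('n) * B\<^sup>2))" for x
    proof (cases "x \<in> K")
      case True
      have "grad_sq v x \<le> (\<Sum>h\<in>(UNIV::'n set). B\<^sup>2)"
        unfolding grad_sq_def by (intro sum_mono power_mono B) auto
      then show ?thesis using True by (simp add: grad_sq_def sum_nonneg)
    next
      case False
      then show ?thesis using partial_deriv_zero_outside[of x v] by (simp add: K_def grad_sq_def)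
    qed
    then show "AE x in lebesgue. norm (grad_sq v x) \<le> norm (indicat_real K x * (real CARD('n) * B\<^sup>2))" by simp
  qed
qed

lemma bounded_linear_matrix_vector: "bounded_linear ((*v) (M :: complex^'n^'m))"
  unfolding linear_conv_bounded_linear[symmetric]
  by (rule linearI) (simp_all add: matrix_vector_right_distrib matrix_scaleR_vector)

lemma tendsto_ell_form:
  assumes "(w \<longlongrightarrow> \<omega>) F" "(l \<longlongrightarrow> l0) F" "(e \<longlongrightarrow> \<eta>) F"
  shows "((\<lambda>j. ell_form M (w j) (l j) (e j)) \<longlongrightarrow> ell_form M \<omega> l0 \<eta>) F"
  unfolding ell_form_def
  by (intro tendsto_inner bounded_linear.tendsto[OF bounded_linear_matrix_vector] tendsto_add tendsto_diff
      tendsto_scaleR tendsto_mult assms)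

lemma tendsto_bounded_mult_zero:
  fixes p e :: "nat \<Rightarrow> real"
  assumes "\<And>j. \<bar>p j\<bar> \<le> C" "e \<longlonglongrightarrow> 0"
  shows "(\<lambda>j. p j * e j) \<longlonglongrightarrow> 0"
proof (rule Lim_null_comparison)
  show "\<forall>\<^sub>F j in sequentially. norm (p j * e j) \<le> C * \<bar>e j\<bar>"
    using assms(1) by (intro always_eventually allI) (simp add: abs_mult mult_right_mono)
  have "(\<lambda>j. C * \<bar>e j\<bar>) \<longlonglongrightarrow> C * \<bar>0\<bar>" by (intro tendsto_intros assms(2))
  then show "(\<lambda>j. C * \<bar>e j\<bar>) \<longlonglongrightarrow> 0" by simp
qed

context admissible
begin

text \<open>All partial derivatives are multiples of the same vector \<eta>, so each form is a
  square times its value at \<eta>, and \<open>r^2\<close> factors out of the whole deficit.\<close>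

lemma Phi_deficit_oscillating:
  fixes B :: "'n \<Rightarrow> real^'n \<Rightarrow> complex^'m^'m" and v :: "real^'n \<Rightarrow> complex^'m"
    and r \<kappa> :: real and \<gamma> :: "'n \<Rightarrow> real"
  assumes "v x \<noteq> 0" "\<And>k. partial_deriv k v x = (r * \<gamma> k) *\<^sub>R \<eta>"
  shows "Re (integral_Phi_integrand \<phi> (diag_system B) v x) - \<kappa> * grad_sq v x =
    r\<^sup>2 * (\<Sum>k\<in>UNIV. (\<gamma> k)\<^sup>2 * (ell_form (B k x) (v x /\<^sub>R norm (v x)) (Lambda \<phi> (norm (v x))) \<eta> - \<kappa> * (norm \<eta>)\<^sup>2))"
proof -
  have "Re (integral_Phi_integrand \<phi> (diag_system B) v x) - \<kappa> * grad_sq v x =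
    (\<Sum>k\<in>UNIV. (r * \<gamma> k)\<^sup>2 * ell_form (B k x) (v x /\<^sub>R norm (v x)) (Lambda \<phi> (norm (v x))) \<eta>)
      - \<kappa> * (\<Sum>k\<in>UNIV. (r * \<gamma> k)\<^sup>2 * (norm \<eta>)\<^sup>2)"
    unfolding Re_integral_Phi_integrand_diag[of v x, OF assms(1)] grad_sq_def assms(2) ell_form_scale norm_scaleR
    by (simp add: power_mult_distrib)
  also have "\<dots> = r\<^sup>2 * (\<Sum>k\<in>UNIV. (\<gamma> k)\<^sup>2 * (ell_form (B k x) (v x /\<^sub>R norm (v x)) (Lambda \<phi> (norm (v x))) \<eta> - \<kappa> * (norm \<eta>)\<^sup>2))"
    by (simp add: sum_distrib_left sum_subtractf[symmetric] power_mult_distrib algebra_simps)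
  finally show ?thesis .
qed

text \<open>\<open>H j\<close> is the sum of the two deficits divided by \<open>r^2\<close>; its
  integral is nonnegative by \<open>test\<close>, and dominated convergence carries this over to the
  limit. The real \<kappa> is arbitrary: positive values serve \<open>A\<close>, and 0 serves
  \<open>A - \<kappa>\<Delta>\<close>.\<close>

lemma localized_integral_nonneg:
  fixes B :: "'n \<Rightarrow> real^'n \<Rightarrow> complex^'m^'m" and \<omega> \<eta> :: "complex^'m" and a b a' b' :: "real^'n"
  assumes L1: "\<And>h. L1_loc_matrix \<Omega> (B h)" and \<Omega>: "open \<Omega>"
    and test: "\<And>v u. v \<in> C1_0 \<Omega> \<Longrightarrow> u \<in> phi_test_functions \<phi> \<Omega> \<Longrightarrow> v = sqrt_phi_mult \<phi> u \<Longrightarrow>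
      \<kappa> * (LINT x:\<Omega>|lebesgue. grad_sq v x) \<le> Re (LINT x:\<Omega>|lebesgue. integral_Phi_integrand \<phi> (diag_system B) v x)"
    and ab: "cbox a b \<subseteq> box a' b'" and a'b': "cbox a' b' \<subseteq> \<Omega>" and \<omega>: "norm \<omega> = 1" and t: "t > 0"
  shows "0 \<le> (LINT x|lebesgue. indicat_real (box a b) x * (ell_form (B h x) \<omega> (Lambda \<phi> t) \<eta> - \<kappa> * (norm \<eta>)\<^sup>2))"
proof -
  obtain v0 :: "real^'n \<Rightarrow> complex^'m" and U where U: "open U" "cbox a b \<subseteq> U"
    and v0U: "\<And>x. x \<in> U \<Longrightarrow> v0 x = t *\<^sub>R \<omega>" and v0: "v0 \<in> C1_0 \<Omega>"
    and pert: "\<forall>\<zeta>. C1_on UNIV \<zeta> \<longrightarrow> (\<forall>x. x \<notin> cbox a b \<longrightarrow> \<zeta> x = 0) \<longrightarrow> (\<forall>x. norm (\<zeta> x) \<le> t / 2) \<longrightarrow>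
      (\<exists>u\<in>phi_test_functions \<phi> \<Omega>. (\<lambda>x. v0 x + \<zeta> x) = sqrt_phi_mult \<phi> u) \<and> (\<lambda>x. v0 x + \<zeta> x) \<in> C1_0 \<Omega>"
    using ex_localized_test_functions[OF \<Omega> ab a'b' \<omega> t] by blast
  have ab\<Omega>: "cbox a b \<subseteq> \<Omega>" using ab a'b' box_subset_cbox by blast
  obtain g :: "real^'n \<Rightarrow> real" where g: "C1_on UNIV g" "\<And>x. 0 \<le> g x" "\<And>x. 0 < g x \<longleftrightarrow> x \<in> box a b"
    using ex_C1_box_function[of a b] by blast
  \<comment> \<open>Cutoffs with values between 0 and 1 that tend to 1 on the open box. Their
    gradient bounds \<open>M j\<close> may blow up with \<open>j\<close>; the choice of
    \<open>r\<close> compensates for it.\<close>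
  define \<psi> where "\<psi> j x = smooth_step (real j * g x)" for j x
  have \<psi>C1: "C1_on UNIV (\<psi> j)" for j
    unfolding \<psi>_def[abs_def] by (intro C1_on_compose[OF C1_on_smooth_step] C1_on_mult g C1_on_const) simp
  have \<psi>b: "0 \<le> \<psi> j x" "\<psi> j x \<le> 1" for j x by (simp_all add: \<psi>_def smooth_step_bounds)
  have \<psi>0: "\<psi> j x = 0" if "x \<notin> cbox a b" for j x
  proof -
    have "x \<notin> box a b" using that box_subset_cbox by blast
    then have "g x = 0" using g(2,3)[of x] by force
    then show ?thesis by (simp add: \<psi>_def smooth_step_le_0)
  qed
  have \<psi>1: "(\<lambda>j. \<psi> j x) \<longlonglongrightarrow> 1" if "x \<in> box a b" for x
  proof (rule tendsto_eventually)
    have gx: "g x > 0" using that g(3) by blast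
    obtain N where "1 < real N * g x" using reals_Archimedean3[OF gx] by blast
    moreover have "real N * g x \<le> real j * g x" if "j \<ge> N" for j
      using that gx by (intro mult_right_mono) auto
    ultimately have "\<psi> j x = 1" if "j \<ge> N" for j
      unfolding \<psi>_def using that by (intro smooth_step_ge_1) (meson less_imp_le order_trans)
    then show "\<forall>\<^sub>F j in sequentially. \<psi> j x = 1" by (auto simp: eventually_sequentially)
  qed
  have "\<exists>M\<ge>0. \<forall>k x. \<bar>frechet_derivative (\<psi> j) (at x) (axis k 1)\<bar> \<le> M" for j
  proof -
    \<comment> \<open>Multiplying by the unit vector \<omega> makes the scalar cutoff accessible to
      \<open>partial_deriv_bounded\<close>.\<close>
    have C1: "C1_on UNIV (\<lambda>x. \<psi> j x *\<^sub>R \<omega>)" by (intro C1_on_scaleR \<psi>C1 C1_on_const)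
    have "(\<lambda>x. \<psi> j x *\<^sub>R \<omega>) \<in> C1_0 \<Omega>"
      by (rule C1_0_if_supported_in_cbox[OF \<Omega> C1 ab\<Omega>]) (simp add: \<psi>0)
    then obtain M where M: "M \<ge> 0" "\<And>k x. norm (partial_deriv k (\<lambda>x. \<psi> j x *\<^sub>R \<omega>) x) \<le> M"
      using partial_deriv_bounded[OF C1] by (auto simp: C1_0_iff[OF \<Omega>])
    have "partial_deriv k (\<lambda>x. \<psi> j x *\<^sub>R \<omega>) x = frechet_derivative (\<psi> j) (at x) (axis k 1) *\<^sub>R \<omega>" for k x
      using frechet_derivative_at[OF has_derivative_scaleR_left[OF C1_on_frechet(1)[OF \<psi>C1 UNIV_I]], of j x \<omega>, symmetric]
      by (simp add: partial_deriv_def)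
    then have "\<bar>frechet_derivative (\<psi> j) (at x) (axis k 1)\<bar> \<le> M" for k x using M(2)[of k x] \<omega> by simp
    with M(1) show ?thesis by blast
  qed
  then obtain M where M: "\<And>j. M j \<ge> 0" "\<And>j k x. \<bar>frechet_derivative (\<psi> j) (at x) (axis k 1)\<bar> \<le> M j" by metis
  \<comment> \<open>Large enough for \<open>|\<zeta>| \<le> t / 2\<close>, and so large that \<open>\<nabla>\<psi>\<^sub>j\<close> is negligible after division by \<open>r\<^sup>2\<close>.\<close>
  define r where "r j = (real j + 1 + 2 * norm \<eta> / t) * (1 + M j)" for j
  have q: "2 * norm \<eta> / t \<ge> 0" using t by simp
  have r_ge: "real j + 1 + 2 * norm \<eta> / t \<le> r j" for j
    unfolding r_def using M(1)[of j] q mult_left_mono[of 1 "1 + M j" "real j + 1 + 2 * norm \<eta> / t"] by simp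
  have r1: "r j \<ge> 1" and rj: "r j \<ge> real j + 1" for j
    using r_ge[of j] q by linarith+
  have rpos: "r j > 0" for j using r1[of j] by linarith
  have r\<eta>: "norm \<eta> / r j \<le> t / 2" for j
  proof -
    have "2 * norm \<eta> / t \<le> r j" using r_ge[of j] by linarith
    then show ?thesis using t rpos[of j] by (simp add: field_simps)
  qed
  have rM: "M j / (r j)\<^sup>2 \<le> 1 / (real j + 1)" for j
  proof -
    have "M j * (real j + 1) \<le> r j"
      unfolding r_def using M(1)[of j] q by (subst mult.commute) (intro mult_mono; simp)
    also have "\<dots> \<le> (r j)\<^sup>2" using r1[of j] by (simp add: power2_eq_square)
    finally show ?thesis using rpos[of j] by (simp add: field_simps)
  qed
  have inv_lim: "(\<lambda>j. 1 / (real j + 1)) \<longlonglongrightarrow> 0"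
    using LIMSEQ_inverse_real_of_nat by (simp add: inverse_eq_divide add.commute)
  \<comment> \<open>The squares of the two derivatives \<open>cs'\<close> add up to \<open>1\<close>.\<close>
  define cs cs' :: "bool \<Rightarrow> real \<Rightarrow> real" where
    "cs \<nu> = (if \<nu> then cos else sin)" and "cs' \<nu> = (if \<nu> then (\<lambda>y. - sin y) else cos)" for \<nu>
  have cs: "(cs \<nu> has_real_derivative cs' \<nu> y) (at y)" "continuous_on UNIV (cs' \<nu>)"
      "\<bar>cs \<nu> y\<bar> \<le> 1" "\<bar>cs' \<nu> y\<bar> \<le> 1" for \<nu> y
    by (auto simp: cs_def cs'_def intro!: derivative_eq_intros continuous_intros)
  define \<zeta> where "\<zeta> \<nu> j x = (1 / r j * \<psi> j x * cs \<nu> ((r j)\<^sup>2 * x $ h)) *\<^sub>R \<eta>" for \<nu> j x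
  define v where "v \<nu> j x = v0 x + \<zeta> \<nu> j x" for \<nu> j x
  \<comment> \<open>The coefficient of \<eta> in the derivative of \<zeta>, divided by
    \<open>r\<close>: a small cutoff part, later called \<open>err\<close>, and the oscillating part
    in direction \<open>h\<close>.\<close>
  define \<gamma> where "\<gamma> \<nu> j x k = 1 / (r j)\<^sup>2 * frechet_derivative (\<psi> j) (at x) (axis k 1) * cs \<nu> ((r j)\<^sup>2 * x $ h)
      + (if k = h then \<psi> j x * cs' \<nu> ((r j)\<^sup>2 * x $ h) else 0)" for \<nu> j x k
  have \<zeta>eq: "\<zeta> \<nu> j = (\<lambda>x. (1 / r j * \<psi> j x * cs \<nu> ((r j)\<^sup>2 * x $ h)) *\<^sub>R \<eta>)" for \<nu> j
    by (rule ext) (rule \<zeta>_def)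
  have osc: "C1_on UNIV (\<zeta> \<nu> j)" "(\<zeta> \<nu> j has_derivative frechet_derivative (\<zeta> \<nu> j) (at x)) (at x)"
      "partial_deriv k (\<zeta> \<nu> j) x = (r j * \<gamma> \<nu> j x k) *\<^sub>R \<eta>" for \<nu> j x k
    unfolding \<zeta>eq \<gamma>_def by (rule partial_deriv_oscillation[OF \<psi>C1 cs(1) cs(2) rpos])+
  have \<zeta>le: "norm (\<zeta> \<nu> j x) \<le> norm \<eta> / r j" for \<nu> j x
  proof -
    have "\<bar>\<psi> j x * cs \<nu> ((r j)\<^sup>2 * x $ h)\<bar> \<le> 1 * 1"
      unfolding abs_mult by (intro mult_mono cs(3)) (use \<psi>b[of j x] in auto)
    then have "\<bar>\<psi> j x * cs \<nu> ((r j)\<^sup>2 * x $ h)\<bar> * (norm \<eta> / r j) \<le> 1 * (norm \<eta> / r j)"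
      using rpos[of j] by (intro mult_right_mono) auto
    then show ?thesis using rpos[of j] by (simp add: \<zeta>_def abs_mult)
  qed
  have \<zeta>0: "\<zeta> \<nu> j x = 0" if "x \<notin> cbox a b" for \<nu> j x by (simp add: \<zeta>_def \<psi>0[OF that])
  have vtest: "(\<exists>u\<in>phi_test_functions \<phi> \<Omega>. v \<nu> j = sqrt_phi_mult \<phi> u) \<and> v \<nu> j \<in> C1_0 \<Omega>" for \<nu> j
    unfolding v_def[abs_def]
    by (rule pert[rule_format, OF osc(1)]; (erule \<zeta>0 | rule order_trans[OF \<zeta>le r\<eta>]))
  have vC1: "C1_on UNIV (v \<nu> j)" "compact (closure {x. v \<nu> j x \<noteq> 0})" for \<nu> j
    using vtest[of \<nu> j] by (auto simp: C1_0_iff[OF \<Omega>])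
  define D where "D w x = Re (integral_Phi_integrand \<phi> (diag_system B) w x) - \<kappa> * grad_sq w x"
    for w :: "real^'n \<Rightarrow> complex^'m" and x
  have D_int: "integrable lebesgue (\<lambda>x. indicat_real \<Omega> x * D w x)"
      "(LINT x|lebesgue. indicat_real \<Omega> x * D w x) =
        Re (LINT x:\<Omega>|lebesgue. integral_Phi_integrand \<phi> (diag_system B) w x) - \<kappa> * (LINT x:\<Omega>|lebesgue. grad_sq w x)"
    if "w \<in> C1_0 \<Omega>" for w
  proof -
    note i1 = Re_LINT[OF integrable_integral_Phi_integrand[OF L1 \<Omega> that]]
    have \<Omega>m: "\<Omega> \<in> sets lebesgue" using \<Omega> by (simp add: borel_open)
    have "integrable lebesgue (grad_sq w)"
      using that by (intro integrable_grad_sq) (auto simp: C1_0_iff[OF \<Omega>])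
    then have i2: "integrable lebesgue (\<lambda>x. indicat_real \<Omega> x * grad_sq w x)"
      using integrable_mult_indicator[OF \<Omega>m, of "grad_sq w"] by simp
    have eq: "(\<lambda>x. indicat_real \<Omega> x * D w x) = (\<lambda>x. indicat_real \<Omega> x * Re (integral_Phi_integrand \<phi> (diag_system B) w x)
        - \<kappa> * (indicat_real \<Omega> x * grad_sq w x))"
      by (auto simp: D_def algebra_simps)
    show "integrable lebesgue (\<lambda>x. indicat_real \<Omega> x * D w x)"
      unfolding eq by (intro Bochner_Integration.integrable_diff i1(2) Bochner_Integration.integrable_mult_right i2)
    show "(LINT x|lebesgue. indicat_real \<Omega> x * D w x) =
        Re (LINT x:\<Omega>|lebesgue. integral_Phi_integrand \<phi> (diag_system B) w x) - \<kappa> * (LINT x:\<Omega>|lebesgue. grad_sq w x)"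
      unfolding eq i1(1) by (subst Bochner_Integration.integral_diff)
        (use i1(2) i2 in \<open>auto simp: set_lebesgue_integral_def\<close>)
  qed
  have D_nonneg: "0 \<le> (LINT x|lebesgue. indicat_real \<Omega> x * D (v \<nu> j) x)" for \<nu> j
    using vtest[of \<nu> j] test[of "v \<nu> j"] by (auto simp: D_int(2))
  define H where "H j x = (1 / (r j)\<^sup>2) * (\<Sum>\<nu>\<in>UNIV. indicat_real \<Omega> x * D (v \<nu> j) x)" for j x
  have H_int: "integrable lebesgue (H j)" for j
    unfolding H_def[abs_def] using vtest
    by (intro Bochner_Integration.integrable_mult_right Bochner_Integration.integrable_sum D_int(1)) auto
  have H_nonneg: "0 \<le> (LINT x|lebesgue. H j x)" for j
  proof -
    have "(LINT x|lebesgue. H j x) = (1 / (r j)\<^sup>2) * (\<Sum>\<nu>\<in>UNIV. LINT x|lebesgue. indicat_real \<Omega> x * D (v \<nu> j) x)"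
    proof -
      have "(\<Sum>\<nu>\<in>(UNIV::bool set). LINT x|lebesgue. indicat_real \<Omega> x * D (v \<nu> j) x) =
          (LINT x|lebesgue. (\<Sum>\<nu>\<in>(UNIV::bool set). indicat_real \<Omega> x * D (v \<nu> j) x))"
        by (rule Bochner_Integration.integral_sum[symmetric]) (use vtest D_int(1) in blast)
      then show ?thesis unfolding H_def by (simp only: integral_mult_right_zero)
    qed
    also have "\<dots> \<ge> 0" by (intro mult_nonneg_nonneg sum_nonneg D_nonneg) simp
    finally show ?thesis .
  qed
  define err where "err \<nu> j x k = 1 / (r j)\<^sup>2 * frechet_derivative (\<psi> j) (at x) (axis k 1) * cs \<nu> ((r j)\<^sup>2 * x $ h)" for \<nu> j x k
  have err: "\<bar>err \<nu> j x k\<bar> \<le> 1 / (real j + 1)" for \<nu> j x k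
  proof -
    have "\<bar>err \<nu> j x k\<bar> = (1 / (r j)\<^sup>2 * \<bar>frechet_derivative (\<psi> j) (at x) (axis k 1)\<bar>) * \<bar>cs \<nu> ((r j)\<^sup>2 * x $ h)\<bar>"
      by (simp add: err_def abs_mult)
    also have "\<dots> \<le> (1 / (r j)\<^sup>2 * M j) * 1"
      by (intro mult_mono mult_left_mono M cs(3)) (use M(1)[of j] in auto)
    also have "\<dots> \<le> 1 / (real j + 1)" using rM[of j] by simp
    finally show ?thesis .
  qed
  have \<gamma>_bound: "\<bar>\<gamma> \<nu> j x k\<bar> \<le> 2" for \<nu> j x k
  proof -
    have "\<bar>err \<nu> j x k\<bar> \<le> 1" using err[of \<nu> j x k] by (rule order_trans) simp
    moreover have "\<bar>\<psi> j x * cs' \<nu> ((r j)\<^sup>2 * x $ h)\<bar> \<le> 1 * 1"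
      unfolding abs_mult by (intro mult_mono cs(4)) (use \<psi>b[of j x] in auto)
    ultimately show ?thesis unfolding \<gamma>_def err_def[symmetric] by auto
  qed
  have v_ne: "v \<nu> j x \<noteq> 0" if "x \<in> cbox a b" for \<nu> j x
  proof
    assume "v \<nu> j x = 0"
    then have "norm (v0 x) = norm (\<zeta> \<nu> j x)" by (simp add: v_def eq_neg_iff_add_eq_0[symmetric])
    moreover have "norm (v0 x) = t" using v0U[of x] that U(2) \<omega> t by auto
    ultimately show False using order_trans[OF \<zeta>le r\<eta>, of \<nu> j x] t by simp
  qed
  have D_in: "D (v \<nu> j) x = (r j)\<^sup>2 * (\<Sum>k\<in>UNIV. (\<gamma> \<nu> j x k)\<^sup>2 * (ell_form (B k x)
      (v \<nu> j x /\<^sub>R norm (v \<nu> j x)) (Lambda \<phi> (norm (v \<nu> j x))) \<eta> - \<kappa> * (norm \<eta>)\<^sup>2))"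
    if "x \<in> cbox a b" for \<nu> j x
    unfolding D_def
  proof (rule Phi_deficit_oscillating[where v = "v \<nu> j" and r = "r j" and \<gamma> = "\<gamma> \<nu> j x" and \<eta> = \<eta> and \<kappa> = \<kappa>])
    show "v \<nu> j x \<noteq> 0" by (rule v_ne[OF that])
    fix k
    have "partial_deriv k (v \<nu> j) x = partial_deriv k (\<zeta> \<nu> j) x"
    proof (rule partial_deriv_cong[OF U(1)])
      show "x \<in> U" using that U(2) by blast
      show "v \<nu> j y = t *\<^sub>R \<omega> + \<zeta> \<nu> j y" if "y \<in> U" for y by (simp add: v_def v0U[OF that])
    qed (rule osc(2))
    then show "partial_deriv k (v \<nu> j) x = (r j * \<gamma> \<nu> j x k) *\<^sub>R \<eta>"
      unfolding osc(3) .
  qed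
  have D_out: "D (v \<nu> j) x = D v0 x" if "x \<notin> cbox a b" for \<nu> j x
  proof -
    have vx: "v \<nu> j x = v0 x" using \<zeta>0[OF that] by (simp add: v_def)
    have pd: "partial_deriv k (v \<nu> j) x = partial_deriv k v0 x" for k
    proof (rule partial_deriv_cong[of "- cbox a b" _ _ 0])
      show "(v0 has_derivative frechet_derivative v0 (at x)) (at x)"
        using v0 by (intro C1_on_frechet(1)[of UNIV]) (auto simp: C1_0_iff[OF \<Omega>])
    qed (use that \<zeta>0 in \<open>auto simp: v_def intro: open_Compl[OF closed_cbox]\<close>)
    show ?thesis unfolding D_def integral_Phi_integrand_def grad_sq_def vx pd ..
  qed
  have H_in: "H j x = (\<Sum>\<nu>\<in>UNIV. \<Sum>k\<in>UNIV. (\<gamma> \<nu> j x k)\<^sup>2 * (ell_form (B k x)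
      (v \<nu> j x /\<^sub>R norm (v \<nu> j x)) (Lambda \<phi> (norm (v \<nu> j x))) \<eta> - \<kappa> * (norm \<eta>)\<^sup>2))"
    if "x \<in> cbox a b" for j x
  proof -
    have "x \<in> \<Omega>" using that ab\<Omega> by blast
    then show ?thesis unfolding H_def D_in[OF that]
      by (subst sum_distrib_left) (use rpos[of j] in simp)
  qed
  have H_out: "H j x = 1 / (r j)\<^sup>2 * (2 * (indicat_real \<Omega> x * D v0 x))" if "x \<notin> cbox a b" for j x
    unfolding H_def D_out[OF that] by (simp add: UNIV_bool)
  \<comment> \<open>Outside the box two copies of the deficit of \<open>v0\<close> remain, which the
    first term dominates. Inside, the 8 comes from two phases and
    \<open>\<gamma>^2 \<le> 4\<close>.\<close>
  define W where "W x = 2 * \<bar>indicat_real \<Omega> x * D v0 x\<bar> + 8 * (\<Sum>k\<in>UNIV.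
      4 * entry_sum (indicat_real (cbox a b) x *\<^sub>R B k x) * (norm \<eta>)\<^sup>2
        + indicat_real (cbox a b) x * (\<bar>\<kappa>\<bar> * (norm \<eta>)\<^sup>2))" for x
  have W_nonneg: "0 \<le> (\<Sum>k\<in>UNIV. 4 * entry_sum (indicat_real (cbox a b) x *\<^sub>R B k x) * (norm \<eta>)\<^sup>2
        + indicat_real (cbox a b) x * (\<bar>\<kappa>\<bar> * (norm \<eta>)\<^sup>2))" for x
    by (intro sum_nonneg add_nonneg_nonneg mult_nonneg_nonneg entry_sum_nonneg) auto
  have W_int: "integrable lebesgue W"
  proof -
    have c: "integrable lebesgue (\<lambda>x. indicat_real (cbox a b) x * (\<bar>\<kappa>\<bar> * (norm \<eta>)\<^sup>2))"
      using lmeasurable_cbox[of a b] by (simp add: fmeasurable_def)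
    show ?thesis unfolding W_def[abs_def]
      by (intro Bochner_Integration.integrable_add Bochner_Integration.integrable_mult_right
          Bochner_Integration.integrable_mult_left Bochner_Integration.integrable_sum c
          integrable_entry_sum[OF L1 compact_cbox ab\<Omega>] Bochner_Integration.integrable_abs D_int(1)[OF v0])
  qed
  have H_le_W: "norm (H j x) \<le> W x" for j x
  proof (cases "x \<in> cbox a b")
    case True
    have "\<bar>H j x\<bar> \<le> (\<Sum>\<nu>\<in>(UNIV::bool set). \<Sum>k\<in>UNIV. 4 * (4 * entry_sum (B k x) * (norm \<eta>)\<^sup>2 + \<bar>\<kappa>\<bar> * (norm \<eta>)\<^sup>2))"
      unfolding H_in[OF True]
    proof (intro order_trans[OF sum_abs] sum_mono)
      fix \<nu> :: bool and k
      let ?E = "ell_form (B k x) (v \<nu> j x /\<^sub>R norm (v \<nu> j x)) (Lambda \<phi> (norm (v \<nu> j x))) \<eta>"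
      have 1: "(\<gamma> \<nu> j x k)\<^sup>2 \<le> 4" using \<gamma>_bound[of \<nu> j x k] abs_le_square_iff[of "\<gamma> \<nu> j x k" 2] by simp
      have "\<bar>?E\<bar> \<le> 4 * entry_sum (B k x) * (norm \<eta>)\<^sup>2"
        using v_ne[OF True, of \<nu> j] abs_Lambda_less[of "norm (v \<nu> j x)"] by (intro ell_form_bound) auto
      then have "\<bar>?E - \<kappa> * (norm \<eta>)\<^sup>2\<bar> \<le> 4 * entry_sum (B k x) * (norm \<eta>)\<^sup>2 + \<bar>\<kappa>\<bar> * (norm \<eta>)\<^sup>2"
        using abs_triangle_ineq4[of ?E "\<kappa> * (norm \<eta>)\<^sup>2"] by (simp add: abs_mult)
      with 1 show "\<bar>(\<gamma> \<nu> j x k)\<^sup>2 * (?E - \<kappa> * (norm \<eta>)\<^sup>2)\<bar> \<le> 4 * (4 * entry_sum (B k x) * (norm \<eta>)\<^sup>2 + \<bar>\<kappa>\<bar> * (norm \<eta>)\<^sup>2)"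
        unfolding abs_mult abs_power2 by (intro mult_mono) auto
    qed
    also have "\<dots> = 8 * (\<Sum>k\<in>UNIV. 4 * entry_sum (B k x) * (norm \<eta>)\<^sup>2 + \<bar>\<kappa>\<bar> * (norm \<eta>)\<^sup>2)"
      unfolding sum_distrib_left[symmetric] by simp
    also have "\<dots> \<le> W x" unfolding W_def using True by simp
    finally show ?thesis by simp
  next
    case False
    have "1 / (r j)\<^sup>2 \<le> 1" using r1[of j] by simp
    then have "1 / (r j)\<^sup>2 * \<bar>2 * (indicat_real \<Omega> x * D v0 x)\<bar> \<le> 1 * \<bar>2 * (indicat_real \<Omega> x * D v0 x)\<bar>"
      by (rule mult_right_mono) simp
    then have "\<bar>H j x\<bar> \<le> 2 * \<bar>indicat_real \<Omega> x * D v0 x\<bar>"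
      unfolding H_out[OF False] abs_mult by simp
    also have "\<dots> \<le> W x" using W_nonneg[of x] by (simp add: W_def)
    finally show ?thesis by simp
  qed
  \<comment> \<open>The pointwise limit of \<open>H j\<close>; the local name hides the library
    operator \<open>Lim\<close>.\<close>
  define Lim where "Lim x = indicat_real (box a b) x * (ell_form (B h x) \<omega> (Lambda \<phi> t) \<eta> - \<kappa> * (norm \<eta>)\<^sup>2)" for x
  have r_inv: "(\<lambda>j. 1 / (r j)\<^sup>2) \<longlonglongrightarrow> 0"
  proof (rule Lim_null_comparison[OF _ inv_lim])
    have "1 / (r j)\<^sup>2 \<le> 1 / (real j + 1)" for j
    proof (rule divide_left_mono)
      have "r j * 1 \<le> r j * r j" using r1[of j] by (intro mult_left_mono) auto
      then show "real j + 1 \<le> (r j)\<^sup>2" using rj[of j] unfolding power2_eq_square by linarith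
    qed (use rpos[of j] in auto)
    then show "\<forall>\<^sub>F j in sequentially. norm (1 / (r j)\<^sup>2) \<le> 1 / (real j + 1)" by simp
  qed
  have H_lim_in: "(\<lambda>j. H j x) \<longlonglongrightarrow> Lim x" if x: "x \<in> box a b" for x
  proof -
    have xc: "x \<in> cbox a b" using x box_subset_cbox by blast
    define E where "E k = ell_form (B k x) \<omega> (Lambda \<phi> t) \<eta>" for k
    define c where "c = \<kappa> * (norm \<eta>)\<^sup>2"
    define Ej where "Ej \<nu> k j = ell_form (B k x) (v \<nu> j x /\<^sub>R norm (v \<nu> j x)) (Lambda \<phi> (norm (v \<nu> j x))) \<eta>" for \<nu> k j
    have v_lim: "(\<lambda>j. v \<nu> j x) \<longlonglongrightarrow> t *\<^sub>R \<omega>" for \<nu>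
    proof -
      have "(\<lambda>j. \<zeta> \<nu> j x) \<longlonglongrightarrow> 0"
      proof (rule Lim_null_comparison)
        have "norm \<eta> / r j \<le> norm \<eta> * (1 / (real j + 1))" for j
          using divide_left_mono[OF rj[of j], of "norm \<eta>"] rpos[of j] by simp
        then show "\<forall>\<^sub>F j in sequentially. norm (\<zeta> \<nu> j x) \<le> norm \<eta> * (1 / (real j + 1))"
          using order_trans[OF \<zeta>le] by (intro always_eventually) blast
        show "(\<lambda>j. norm \<eta> * (1 / (real j + 1))) \<longlonglongrightarrow> 0"
          using tendsto_mult[OF tendsto_const inv_lim, of "norm \<eta>"] by simp
      qed
      then have "(\<lambda>j. t *\<^sub>R \<omega> + \<zeta> \<nu> j x) \<longlonglongrightarrow> t *\<^sub>R \<omega> + 0" by (intro tendsto_intros)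
      moreover have "v0 x = t *\<^sub>R \<omega>" using v0U xc U(2) by blast
      ultimately show ?thesis by (simp add: v_def)
    qed
    have n_lim: "(\<lambda>j. norm (v \<nu> j x)) \<longlonglongrightarrow> t" for \<nu>
      using tendsto_norm[OF v_lim, of \<nu>] \<omega> t by simp
    have w_lim: "(\<lambda>j. v \<nu> j x /\<^sub>R norm (v \<nu> j x)) \<longlonglongrightarrow> \<omega>" for \<nu>
      using tendsto_scaleR[OF tendsto_inverse[OF n_lim] v_lim, of \<nu> \<nu>] t by simp
    have L_lim: "(\<lambda>j. Lambda \<phi> (norm (v \<nu> j x))) \<longlonglongrightarrow> Lambda \<phi> t" for \<nu>
      by (rule continuous_on_tendsto_compose[OF continuous_on_Lambda n_lim])
        (use t v_ne[OF xc] in auto)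
    have E_lim: "Ej \<nu> k \<longlonglongrightarrow> E k" for \<nu> k
      unfolding Ej_def[abs_def] E_def by (intro tendsto_ell_form w_lim L_lim tendsto_const)
    have \<gamma>2: "\<bar>(\<gamma> \<nu> j x k)\<^sup>2\<bar> \<le> 4" for \<nu> j k
      using \<gamma>_bound[of \<nu> j x k] abs_le_square_iff[of "\<gamma> \<nu> j x k" 2] by simp
    have err_lim: "(\<lambda>j. err \<nu> j x k) \<longlonglongrightarrow> 0" for \<nu> k
      by (rule Lim_null_comparison[OF _ inv_lim]) (use err in simp)
    have diff_lim: "(\<lambda>j. (\<gamma> \<nu> j x k)\<^sup>2 * (Ej \<nu> k j - E k)) \<longlonglongrightarrow> 0" for \<nu> k
    proof (rule tendsto_bounded_mult_zero[OF \<gamma>2])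
      show "(\<lambda>j. Ej \<nu> k j - E k) \<longlonglongrightarrow> 0" using E_lim[of \<nu> k] by (simp add: LIM_zero_iff)
    qed
    \<comment> \<open>A single squared weight keeps oscillating; in direction \<open>h\<close> only
      the sum over both phases converges, because the squares of sine and cosine add up to 1. For
      \<open>k \<noteq> h\<close> just the vanishing cutoff part is left.\<close>
    have weight_lim: "(\<lambda>j. \<Sum>\<nu>\<in>UNIV. (\<gamma> \<nu> j x k)\<^sup>2) \<longlonglongrightarrow> (if k = h then 1 else 0)" for k
    proof (cases "k = h")
      case True
      have bd: "\<bar>2 * (\<psi> j x * cs' \<nu> ((r j)\<^sup>2 * x $ h))\<bar> \<le> 2" for \<nu> j
      proof -
        have "\<bar>\<psi> j x * cs' \<nu> ((r j)\<^sup>2 * x $ h)\<bar> \<le> 1 * 1"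
          unfolding abs_mult by (intro mult_mono cs(4)) (use \<psi>b[of j x] in auto)
        then show ?thesis by simp
      qed
      have eq: "(\<Sum>\<nu>\<in>UNIV. (\<gamma> \<nu> j x k)\<^sup>2) = (\<Sum>\<nu>\<in>UNIV. (err \<nu> j x k)\<^sup>2
          + (2 * (\<psi> j x * cs' \<nu> ((r j)\<^sup>2 * x $ h))) * err \<nu> j x k) + (\<psi> j x)\<^sup>2" for j
      proof -
        have \<gamma>eq: "\<gamma> \<nu> j x k = err \<nu> j x k + \<psi> j x * cs' \<nu> ((r j)\<^sup>2 * x $ h)" for \<nu>
          using True by (simp add: \<gamma>_def err_def)
        have alg: "(p + y * (- s'))\<^sup>2 + (q + y * c')\<^sup>2 =
            (p\<^sup>2 + 2 * (y * (- s')) * p) + (q\<^sup>2 + 2 * (y * c') * q) + y\<^sup>2"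
          if "s'\<^sup>2 + c'\<^sup>2 = 1" for p q y s' c' :: real
        proof -
          have "(p + y * (- s'))\<^sup>2 + (q + y * c')\<^sup>2 =
            (p\<^sup>2 + 2 * (y * (- s')) * p) + (q\<^sup>2 + 2 * (y * c') * q) + y\<^sup>2 * (s'\<^sup>2 + c'\<^sup>2)"
            by (simp add: power2_eq_square algebra_simps)
          then show ?thesis by (simp only: that mult_1_right)
        qed
        have sumb: "(\<Sum>\<nu>\<in>UNIV. f \<nu>) = f True + f False" for f :: "bool \<Rightarrow> real"
          by (simp add: UNIV_bool)
        show ?thesis unfolding sumb \<gamma>eq cs'_def if_True if_False
          by (rule alg) simp
      qed
      have "(\<lambda>j. (\<Sum>\<nu>\<in>UNIV. (err \<nu> j x k)\<^sup>2 + (2 * (\<psi> j x * cs' \<nu> ((r j)\<^sup>2 * x $ h))) * err \<nu> j x k) + (\<psi> j x)\<^sup>2)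
          \<longlonglongrightarrow> (\<Sum>\<nu>\<in>(UNIV::bool set). 0\<^sup>2 + 0) + 1\<^sup>2"
        by (intro tendsto_add tendsto_sum tendsto_power err_lim \<psi>1[OF x] tendsto_bounded_mult_zero[OF bd])
      then show ?thesis unfolding eq using True by simp
    next
      case False
      have "(\<lambda>j. \<Sum>\<nu>\<in>UNIV. (err \<nu> j x k)\<^sup>2) \<longlonglongrightarrow> (\<Sum>\<nu>\<in>(UNIV::bool set). 0\<^sup>2)"
        by (intro tendsto_sum tendsto_power err_lim)
      then show ?thesis using False by (simp add: \<gamma>_def err_def)
    qed
    \<comment> \<open>\<open>Ej - c\<close> is split into \<open>Ej - E\<close>, which tends to 0
      against bounded weights, and \<open>E - c\<close>, which is independent of the phase, so that
      its weights can be summed over the phases before the limit.\<close>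
    have "(\<lambda>j. \<Sum>k\<in>UNIV. ((\<Sum>\<nu>\<in>UNIV. (\<gamma> \<nu> j x k)\<^sup>2 * (Ej \<nu> k j - E k)) + (\<Sum>\<nu>\<in>UNIV. (\<gamma> \<nu> j x k)\<^sup>2) * (E k - c)))
        \<longlonglongrightarrow> (\<Sum>k\<in>UNIV. ((\<Sum>\<nu>\<in>(UNIV::bool set). 0) + (if k = h then 1 else 0) * (E k - c)))"
      by (intro tendsto_sum tendsto_add tendsto_mult diff_lim weight_lim tendsto_const)
    moreover have "(\<Sum>k\<in>UNIV. ((\<Sum>\<nu>\<in>(UNIV::bool set). 0) + (if k = h then 1 else 0) * (E k - c))) = Lim x"
      using x by (simp add: Lim_def E_def c_def if_distrib[of "\<lambda>z. z * _"] cong: if_cong)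
    moreover have "(\<Sum>k\<in>UNIV. ((\<Sum>\<nu>\<in>UNIV. (\<gamma> \<nu> j x k)\<^sup>2 * (Ej \<nu> k j - E k)) + (\<Sum>\<nu>\<in>UNIV. (\<gamma> \<nu> j x k)\<^sup>2) * (E k - c))) = H j x" for j
    proof -
      have "H j x = (\<Sum>k\<in>UNIV. \<Sum>\<nu>\<in>UNIV. (\<gamma> \<nu> j x k)\<^sup>2 * (Ej \<nu> k j - c))"
        unfolding H_in[OF xc] Ej_def c_def by (rule sum.swap)
      also have "\<dots> = (\<Sum>k\<in>UNIV. ((\<Sum>\<nu>\<in>UNIV. (\<gamma> \<nu> j x k)\<^sup>2 * (Ej \<nu> k j - E k)) + (\<Sum>\<nu>\<in>UNIV. (\<gamma> \<nu> j x k)\<^sup>2) * (E k - c)))"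
        unfolding sum_distrib_right sum.distrib[symmetric]
        by (intro sum.cong refl) (simp only: distrib_left[symmetric], simp)
      finally show ?thesis by simp
    qed
    ultimately show ?thesis by simp
  qed
  have H_lim_out: "(\<lambda>j. H j x) \<longlonglongrightarrow> Lim x" if x: "x \<notin> cbox a b" for x
  proof -
    have "(\<lambda>j. 1 / (r j)\<^sup>2 * (2 * (indicat_real \<Omega> x * D v0 x))) \<longlonglongrightarrow> 0 * (2 * (indicat_real \<Omega> x * D v0 x))"
      by (intro tendsto_mult r_inv tendsto_const)
    moreover have "Lim x = 0" using x box_subset_cbox[of a b] by (auto simp: Lim_def indicator_def)
    ultimately show ?thesis by (simp add: H_out[OF x])
  qed
  have AE_lim: "AE x in lebesgue. (\<lambda>j. H j x) \<longlonglongrightarrow> Lim x"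
  proof (rule AE_I')
    show "cbox a b - box a b \<in> null_sets lebesgue"
      using negligible_frontier_interval[of a b] by (simp add: negligible_iff_null_sets)
    show "{x \<in> space lebesgue. \<not> (\<lambda>j. H j x) \<longlonglongrightarrow> Lim x} \<subseteq> cbox a b - box a b"
      using H_lim_in H_lim_out by blast
  qed
  have Lim_m: "Lim \<in> borel_measurable lebesgue"
  proof -
    have eq: "Lim = (\<lambda>x. indicat_real (box a b) x * (ell_form (indicat_real (cbox a b) x *\<^sub>R B h x) \<omega> (Lambda \<phi> t) \<eta> - \<kappa> * (norm \<eta>)\<^sup>2))"
      using box_subset_cbox[of a b] by (auto simp: Lim_def indicator_def fun_eq_iff)
    have "(\<lambda>x. ell_form (indicat_real (cbox a b) x *\<^sub>R B h x) \<omega> (Lambda \<phi> t) \<eta>) \<in> borel_measurable lebesgue"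
      unfolding ell_form_def Re_hinner[symmetric]
      by (rule borel_measurable_continuous_on[where f = Re, OF _ borel_measurable_hinner])
        (intro continuous_intros measurable_matrix_restrict[OF L1 compact_cbox ab\<Omega>] borel_measurable_const)+
    then show ?thesis unfolding eq
      by (intro borel_measurable_times borel_measurable_diff borel_measurable_const borel_measurable_indicator) auto
  qed
  have "(\<lambda>j. LINT x|lebesgue. H j x) \<longlonglongrightarrow> (LINT x|lebesgue. Lim x)"
    by (rule integral_dominated_convergence[OF Lim_m borel_measurable_integrable[OF H_int] W_int AE_lim])
      (rule AE_I2, rule H_le_W)
  then have "0 \<le> (LINT x|lebesgue. Lim x)"
    by (rule LIMSEQ_le_const) (use H_nonneg in blast)
  then show ?thesis by (simp only: Lim_def)
qed

end

section \<open>From integrals over boxes to almost every point\<close>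

lemma AE_nonneg_if_box_integrals_nonneg:
  fixes f :: "'a::euclidean_space \<Rightarrow> real"
  assumes f: "integrable lebesgue f" and S: "open S"
    and nn: "\<And>a b. cbox a b \<subseteq> S \<Longrightarrow> 0 \<le> (LINT x|lebesgue. indicat_real (box a b) x * f x)"
  shows "AE x in lebesgue. x \<in> S \<longrightarrow> 0 \<le> f x"
proof -
  have si: "set_integrable lebesgue T f" if "T \<in> sets lebesgue" for T
    unfolding set_integrable_def using integrable_mult_indicator[OF that f] by simp
  have m: "(\<lambda>x. indicat_real T x *\<^sub>R f x) \<in> borel_measurable lebesgue" if "T \<in> sets lebesgue" for T
    by (rule borel_measurable_integrable[OF si[OF that, unfolded set_integrable_def]])
  have cb: "f integrable_on cbox a b" for a b
    using set_lebesgue_integral_eq_integral(1)[OF si[of "cbox a b"]] by simp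
  have int_eq: "integral (cbox a b) f = (LINT x|lebesgue. indicat_real (box a b) x * f x)" for a b
  proof -
    have "integral (cbox a b) f = (LINT x:cbox a b|lebesgue. f x)"
      using set_lebesgue_integral_eq_integral(2)[OF si[of "cbox a b"]] by simp
    also have "\<dots> = (LINT x|lebesgue. indicat_real (box a b) x * f x)"
      unfolding set_lebesgue_integral_def
    proof (rule integral_cong_AE)
      show "AE x in lebesgue. indicat_real (cbox a b) x *\<^sub>R f x = indicat_real (box a b) x * f x"
      proof (rule AE_I')
        show "cbox a b - box a b \<in> null_sets lebesgue"
          using negligible_frontier_interval[of a b] by (simp add: negligible_iff_null_sets)
      qed (use box_subset_cbox[of a b] in \<open>auto simp: indicator_def\<close>)
    qed (use m[of "cbox a b"] m[of "box a b"] in simp_all)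
    finally show ?thesis .
  qed
  \<comment> \<open>Lebesgue differentiation along cubes with corner \<open>x\<close>: a negative
    value of \<open>f\<close> at \<open>x\<close> would make the integral over a small cube
    negative.\<close>
  obtain N where N: "negligible N" and lim: "\<And>x e. x \<notin> N \<Longrightarrow> 0 < e \<Longrightarrow>
      \<exists>d>0. \<forall>h. 0 < h \<and> h < d \<longrightarrow> norm (integral (cbox x (x + h *\<^sub>R One)) f /\<^sub>R h ^ DIM('a) - f x) < e"
    using integrable_ccontinuous_explicit[OF cb] by blast
  have "0 \<le> f x" if x: "x \<in> S" "x \<notin> N" for x
  proof (rule ccontr)
    assume "\<not> 0 \<le> f x"
    then obtain d where d: "d > 0" "\<And>h. 0 < h \<Longrightarrow> h < d \<Longrightarrow>
        norm (integral (cbox x (x + h *\<^sub>R One)) f /\<^sub>R h ^ DIM('a) - f x) < - f x"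
      using lim[OF x(2), of "- f x"] by auto
    obtain e where e: "e > 0" "ball x e \<subseteq> S" using S x(1) open_contains_ball by blast
    \<comment> \<open>Dividing by the dimension keeps the sum norm over the cube below the radius
      \<open>e\<close>; the factors 2 make both bounds strict.\<close>
    define h where "h = min (d / 2) (e / (2 * real DIM('a)))"
    have h: "0 < h" "h < d" using d(1) e(1) by (auto simp: h_def min_less_iff_disj)
    have hD: "real DIM('a) * h < e"
    proof -
      have "real DIM('a) * h \<le> real DIM('a) * (e / (2 * real DIM('a)))"
        unfolding h_def by (intro mult_left_mono) auto
      also have "\<dots> = e / 2" by simp
      finally show ?thesis using e(1) by linarith
    qed
    have "cbox x (x + h *\<^sub>R One) \<subseteq> ball x e"
    proof
      fix y assume y: "y \<in> cbox x (x + h *\<^sub>R One)"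
      have "norm (y - x) \<le> (\<Sum>i\<in>Basis. \<bar>(y - x) \<bullet> i\<bar>)" by (rule norm_le_l1)
      also have "\<dots> \<le> (\<Sum>i\<in>(Basis::'a set). h)"
      proof (rule sum_mono)
        fix i :: 'a assume "i \<in> Basis"
        then have "x \<bullet> i \<le> y \<bullet> i" "y \<bullet> i \<le> x \<bullet> i + h" using y by (auto simp: mem_box inner_add_left)
        then show "\<bar>(y - x) \<bullet> i\<bar> \<le> h" by (simp add: inner_diff_left)
      qed
      also have "\<dots> < e" using hD by simp
      finally show "y \<in> ball x e" by (simp add: dist_norm norm_minus_commute)
    qed
    then have "0 \<le> integral (cbox x (x + h *\<^sub>R One)) f"
      unfolding int_eq using e(2) by (intro nn) blast
    then have "0 \<le> integral (cbox x (x + h *\<^sub>R One)) f /\<^sub>R h ^ DIM('a)"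
      using h by simp
    moreover have "\<bar>integral (cbox x (x + h *\<^sub>R One)) f /\<^sub>R h ^ DIM('a) - f x\<bar> < - f x"
      using d(2)[OF h] by simp
    ultimately show False by linarith
  qed
  then show ?thesis
    using N by (intro AE_I'[of N]) (auto simp: negligible_iff_null_sets)
qed

context admissible
begin

text \<open>The coefficients are integrable on compact sets only, so the differentiation argument
  runs on each of countably many closed boxes with union \<Omega>, with the form cut off to the
  box.\<close>

lemma AE_ell_form_ge:
  fixes B :: "'n \<Rightarrow> real^'n \<Rightarrow> complex^'m^'m" and \<omega> \<eta> :: "complex^'m"
  assumes L1: "\<And>h. L1_loc_matrix \<Omega> (B h)" and \<Omega>: "open \<Omega>"
    and test: "\<And>v u. v \<in> C1_0 \<Omega> \<Longrightarrow> u \<in> phi_test_functions \<phi> \<Omega> \<Longrightarrow> v = sqrt_phi_mult \<phi> u \<Longrightarrow>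
      \<kappa> * (LINT x:\<Omega>|lebesgue. grad_sq v x) \<le> Re (LINT x:\<Omega>|lebesgue. integral_Phi_integrand \<phi> (diag_system B) v x)"
    and \<omega>: "norm \<omega> = 1" and t: "t > 0"
  shows "AE x in lebesgue. x \<in> \<Omega> \<longrightarrow> \<kappa> * (norm \<eta>)\<^sup>2 \<le> ell_form (B h x) \<omega> (Lambda \<phi> t) \<eta>"
proof -
  define F where "F x = ell_form (B h x) \<omega> (Lambda \<phi> t) \<eta> - \<kappa> * (norm \<eta>)\<^sup>2" for x
  have box: "AE x in lebesgue. x \<in> cbox c d \<longrightarrow> 0 \<le> F x" if cd: "cbox c d \<subseteq> \<Omega>" for c d
  proof -
    define f where "f x = indicat_real (cbox c d) x * F x" for x
    have eq: "f x = ell_form (indicat_real (cbox c d) x *\<^sub>R B h x) \<omega> (Lambda \<phi> t) \<eta>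
        - indicat_real (cbox c d) x * (\<kappa> * (norm \<eta>)\<^sup>2)" for x
      by (auto simp: f_def F_def indicator_def)
    have "integrable lebesgue (\<lambda>x. ell_form (indicat_real (cbox c d) x *\<^sub>R B h x) \<omega> (Lambda \<phi> t) \<eta>)"
    proof (rule Bochner_Integration.integrable_bound)
      show "integrable lebesgue (\<lambda>x. 4 * entry_sum (indicat_real (cbox c d) x *\<^sub>R B h x) * (norm \<eta>)\<^sup>2)"
        by (intro Bochner_Integration.integrable_mult_left Bochner_Integration.integrable_mult_right
            integrable_entry_sum[OF L1 compact_cbox cd])
      show "(\<lambda>x. ell_form (indicat_real (cbox c d) x *\<^sub>R B h x) \<omega> (Lambda \<phi> t) \<eta>) \<in> borel_measurable lebesgue"
        unfolding ell_form_def Re_hinner[symmetric]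
        by (rule borel_measurable_continuous_on[where f = Re, OF _ borel_measurable_hinner])
          (intro continuous_intros measurable_matrix_restrict[OF L1 compact_cbox cd] borel_measurable_const)+
      have bd: "\<bar>ell_form (indicat_real (cbox c d) x *\<^sub>R B h x) \<omega> (Lambda \<phi> t) \<eta>\<bar>
          \<le> 4 * entry_sum (indicat_real (cbox c d) x *\<^sub>R B h x) * (norm \<eta>)\<^sup>2" for x
        using abs_Lambda_less[OF t] by (intro ell_form_bound \<omega>) simp
      show "AE x in lebesgue. norm (ell_form (indicat_real (cbox c d) x *\<^sub>R B h x) \<omega> (Lambda \<phi> t) \<eta>)
          \<le> norm (4 * entry_sum (indicat_real (cbox c d) x *\<^sub>R B h x) * (norm \<eta>)\<^sup>2)"
        unfolding real_norm_def by (rule AE_I2) (rule order_trans[OF bd abs_ge_self])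
    qed
    moreover have "integrable lebesgue (\<lambda>x. indicat_real (cbox c d) x * (\<kappa> * (norm \<eta>)\<^sup>2))"
      using lmeasurable_cbox[of c d] by (simp add: fmeasurable_def)
    ultimately have f_int: "integrable lebesgue f"
      unfolding eq[abs_def] by (rule Bochner_Integration.integrable_diff)
    have "AE x in lebesgue. x \<in> box c d \<longrightarrow> 0 \<le> f x"
    proof (rule AE_nonneg_if_box_integrals_nonneg[OF f_int open_box])
      fix a b assume ab: "cbox a b \<subseteq> box c d"
      have "indicat_real (box a b) x * f x = indicat_real (box a b) x * F x" for x
      proof (cases "x \<in> box a b")
        case True
        then have "x \<in> cbox c d" using ab box_subset_cbox by blast
        then show ?thesis by (simp add: f_def)
      qed simp
      moreover have "0 \<le> (LINT x|lebesgue. indicat_real (box a b) x * F x)"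
        unfolding F_def by (rule localized_integral_nonneg[OF L1 \<Omega> _ ab cd \<omega> t]) (rule test)
      ultimately show "0 \<le> (LINT x|lebesgue. indicat_real (box a b) x * f x)" by (simp only:)
    qed
    moreover have "AE x in lebesgue. x \<notin> cbox c d - box c d"
      using negligible_frontier_interval[of c d] by (intro AE_not_in) (simp add: negligible_iff_null_sets)
    ultimately show ?thesis
    proof eventually_elim
      case (elim x)
      then show ?case by (auto simp: f_def)
    qed
  qed
  obtain \<D> where \<D>: "countable \<D>" "\<And>X. X \<in> \<D> \<Longrightarrow> X \<subseteq> \<Omega> \<and> (\<exists>a b. X = cbox a b)" "\<Union>\<D> = \<Omega>"
    using open_countable_Union_open_cbox[OF \<Omega>] by (metis Pow_iff subsetD)
  have "AE x in lebesgue. \<forall>X\<in>\<D>. x \<in> X \<longrightarrow> 0 \<le> F x"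
    using \<D>(1) by (rule AE_ball_countable[THEN iffD2]) (use \<D>(2) box in blast)
  then show ?thesis
  proof eventually_elim
    case (elim x)
    then show ?case using \<D>(3) by (auto simp: F_def)
  qed
qed

lemma continuous_on_ell_form:
  "continuous_on (sphere 0 1 \<times> {0<..} \<times> UNIV) (\<lambda>(\<omega>, t, \<eta>). ell_form M \<omega> (Lambda \<phi> t) \<eta>)"
proof -
  have L: "continuous_on (sphere 0 1 \<times> {0<..} \<times> UNIV) (\<lambda>p. Lambda \<phi> (fst (snd p)))"
    by (rule continuous_on_compose2[OF continuous_on_Lambda]) (auto intro!: continuous_intros)
  show ?thesis
    unfolding ell_form_def split_beta
    by (intro continuous_intros L bounded_linear.continuous_on[OF bounded_linear_matrix_vector])
qed

text \<open>\<open>test\<close> concerns only functions lying in both test classes, so integral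
  ellipticity supplies it just as dissipativity does. The exceptional null set depends on \<omega>,
  \<open>t\<close> and \<eta>, which is why countably many parameters are treated before continuity
  extends the bound.\<close>

lemma pointwise_elliptic_if_test:
  fixes B :: "'n \<Rightarrow> real^'n \<Rightarrow> complex^'m^'m"
  assumes L1: "\<And>h. L1_loc_matrix \<Omega> (B h)" and \<Omega>: "open \<Omega>"
    and test: "\<And>v u. v \<in> C1_0 \<Omega> \<Longrightarrow> u \<in> phi_test_functions \<phi> \<Omega> \<Longrightarrow> v = sqrt_phi_mult \<phi> u \<Longrightarrow>
      \<kappa> * (LINT x:\<Omega>|lebesgue. grad_sq v x) \<le> Re (LINT x:\<Omega>|lebesgue. integral_Phi_integrand \<phi> (diag_system B) v x)"
  shows "pointwise_elliptic \<phi> \<Omega> B \<kappa>"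
proof -
  define X :: "((complex^'m) \<times> real \<times> (complex^'m)) set" where "X = sphere 0 1 \<times> {0<..} \<times> UNIV"
  \<comment> \<open>The dense set is taken inside \<open>X\<close>, since its points must satisfy
    the constraints on \<omega> and \<open>t\<close> exactly.\<close>
  obtain T where T: "countable T" "T \<subseteq> X" "X \<subseteq> closure T"
    using separable[of X] by blast
  have "AE x in lebesgue. \<forall>h. \<forall>p\<in>T. x \<in> \<Omega> \<longrightarrow>
      \<kappa> * (norm (snd (snd p)))\<^sup>2 \<le> ell_form (B h x) (fst p) (Lambda \<phi> (fst (snd p))) (snd (snd p))"
    unfolding AE_all_countable
  proof (intro allI)
    fix h
    show "AE x in lebesgue. \<forall>p\<in>T. x \<in> \<Omega> \<longrightarrow>
      \<kappa> * (norm (snd (snd p)))\<^sup>2 \<le> ell_form (B h x) (fst p) (Lambda \<phi> (fst (snd p))) (snd (snd p))"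
    proof (rule AE_ball_countable[THEN iffD2, OF T(1)], intro ballI)
      fix p assume "p \<in> T"
      then have p: "norm (fst p) = 1" "fst (snd p) > 0" using T(2) by (auto simp: X_def)
      show "AE x in lebesgue. x \<in> \<Omega> \<longrightarrow>
        \<kappa> * (norm (snd (snd p)))\<^sup>2 \<le> ell_form (B h x) (fst p) (Lambda \<phi> (fst (snd p))) (snd (snd p))"
        by (rule AE_ell_form_ge[OF L1 \<Omega> _ p]) (rule test)
    qed
  qed
  then show ?thesis
    unfolding pointwise_elliptic_def
  proof (eventually_elim, intro impI allI)
    fix x h and \<eta> \<omega> :: "complex^'m" and t :: real
    assume dense: "\<forall>h. \<forall>p\<in>T. x \<in> \<Omega> \<longrightarrow>
      \<kappa> * (norm (snd (snd p)))\<^sup>2 \<le> ell_form (B h x) (fst p) (Lambda \<phi> (fst (snd p))) (snd (snd p))"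
      and x: "x \<in> \<Omega>" and \<omega>: "norm \<omega> = 1" and t: "t > 0"
    define f where "f = (\<lambda>p. ell_form (B h x) (fst p) (Lambda \<phi> (fst (snd p))) (snd (snd p)) - \<kappa> * (norm (snd (snd p)))\<^sup>2)"
    have cont: "continuous_on X f"
      unfolding f_def X_def using continuous_on_ell_form[of "B h x"]
      by (intro continuous_intros) (simp add: split_beta)
    have pX: "(\<omega>, t, \<eta>) \<in> X" using \<omega> t by (simp add: X_def)
    then obtain s where s: "\<And>n. s n \<in> T" "s \<longlonglongrightarrow> (\<omega>, t, \<eta>)"
      using T(3) closure_sequential by blast
    have "s n \<in> X" for n using s(1) T(2) by blast
    then have "(\<lambda>n. f (s n)) \<longlonglongrightarrow> f (\<omega>, t, \<eta>)"
      by (intro continuous_on_tendsto_compose[OF cont s(2) pX] always_eventually allI)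
    moreover have "0 \<le> f (s n)" for n using dense s(1)[of n] x by (simp add: f_def)
    ultimately have "0 \<le> f (\<omega>, t, \<eta>)" by (intro LIMSEQ_le_const) auto
    then show "\<kappa> * (norm \<eta>)\<^sup>2 \<le> ell_form (B h x) \<omega> (Lambda \<phi> t) \<eta>" by (simp add: f_def)
  qed
qed

end

section \<open>Equivalence of the four conditions\<close>

lemma L1_loc_matrix_diff_id:
  fixes A :: "real^'n \<Rightarrow> complex^'m^'m"
  assumes "L1_loc_matrix \<Omega> A"
  shows "L1_loc_matrix \<Omega> (\<lambda>x. A x - \<kappa> *\<^sub>R mat 1)"
  unfolding L1_loc_matrix_def
proof (intro allI impI)
  fix i j :: 'm and K assume K: "compact K \<and> K \<subseteq> \<Omega>"
  have "(\<lambda>x. A x $ i $ j) absolutely_integrable_on K"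
    using assms K by (simp add: L1_loc_matrix_def)
  moreover have "(\<lambda>x::real^'n. (\<kappa> *\<^sub>R mat 1 :: complex^'m^'m) $ i $ j) absolutely_integrable_on K"
    using lmeasurable_compact K by (intro absolutely_integrable_on_const) auto
  ultimately show "(\<lambda>x. (A x - \<kappa> *\<^sub>R mat 1) $ i $ j) absolutely_integrable_on K"
    using set_integral_diff(1) by fastforce
qed

theorem theorem8:
  fixes \<phi> :: "real \<Rightarrow> real"
    and \<Omega> :: "(real^'n) set"
    and A :: "'n \<Rightarrow> real^'n \<Rightarrow> complex^'m^'m"
  assumes "CARD('n) \<ge> 2"
    and "phi_admissible \<phi>"
    and "open \<Omega>" and "connected \<Omega>" and "\<Omega> \<noteq> {}"
    and "\<And>h. L1_loc_matrix \<Omega> (A h)"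
    and "(Lambda_infinity \<phi>)\<^sup>2 < 1"
  shows
    "(strict_LPhi_dissipative \<phi> \<Omega> (diag_system A) \<longleftrightarrow>
        (\<exists>\<kappa>>0. LPhi_dissipative \<phi> \<Omega> (diag_system (\<lambda>h x. A h x - \<kappa> *\<^sub>R mat 1)))) \<and>
     (strict_LPhi_dissipative \<phi> \<Omega> (diag_system A) \<longleftrightarrow>
        integral_Phi_elliptic \<phi> \<Omega> (diag_system A)) \<and>
     (strict_LPhi_dissipative \<phi> \<Omega> (diag_system A) \<longleftrightarrow>
        weak_Phi_elliptic \<phi> \<Omega> (diag_system A)) \<and>
     (strong_Phi_elliptic \<phi> \<Omega> (diag_system A) \<longrightarrow>
        strict_LPhi_dissipative \<phi> \<Omega> (diag_system A) \<and>
        (\<exists>\<kappa>>0. LPhi_dissipative \<phi> \<Omega> (diag_system (\<lambda>h x. A h x - \<kappa> *\<^sub>R mat 1))) \<and>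
        integral_Phi_elliptic \<phi> \<Omega> (diag_system A) \<and>
        weak_Phi_elliptic \<phi> \<Omega> (diag_system A))"
proof -
  interpret admissible \<phi> by standard (rule assms(2))
  note \<Omega> = \<open>open \<Omega>\<close>
  note L1 = \<open>\<And>h. L1_loc_matrix \<Omega> (A h)\<close>
  have L1': "L1_loc_matrix \<Omega> (\<lambda>x. A h x - \<kappa> *\<^sub>R mat 1)" for h and \<kappa> :: real
    by (rule L1_loc_matrix_diff_id[OF L1])
  \<comment> \<open>The hub: each condition is compared with pointwise ellipticity alone.\<close>
  define PE where "PE \<longleftrightarrow> (\<exists>\<kappa>>0. pointwise_elliptic \<phi> \<Omega> A \<kappa>)"
  have a: "strict_LPhi_dissipative \<phi> \<Omega> (diag_system A) \<longleftrightarrow> PE"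
  proof
    assume "strict_LPhi_dissipative \<phi> \<Omega> (diag_system A)"
    then obtain \<kappa> where "\<kappa> > 0" and k: "\<And>u :: real^'n \<Rightarrow> complex^'m. u \<in> phi_test_functions \<phi> \<Omega> \<Longrightarrow>
        \<kappa> * (LINT x:\<Omega>|lebesgue. grad_sq (sqrt_phi_mult \<phi> u) x) \<le> Re (phi_form \<phi> \<Omega> (diag_system A) u)"
      unfolding strict_LPhi_dissipative_def by blast
    have "pointwise_elliptic \<phi> \<Omega> A \<kappa>"
    proof (rule pointwise_elliptic_if_test[OF L1 \<Omega>])
      fix v u :: "real^'n \<Rightarrow> complex^'m"
      assume v: "v \<in> C1_0 \<Omega>" and u: "u \<in> phi_test_functions \<phi> \<Omega>" and vu: "v = sqrt_phi_mult \<phi> u"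
      show "\<kappa> * (LINT x:\<Omega>|lebesgue. grad_sq v x) \<le> Re (LINT x:\<Omega>|lebesgue. integral_Phi_integrand \<phi> (diag_system A) v x)"
        using k[OF u] Re_phi_form[OF L1 \<Omega> u] v unfolding vu by simp
    qed
    with \<open>\<kappa> > 0\<close> show PE unfolding PE_def by blast
  next
    assume PE
    then obtain \<kappa> where "\<kappa> > 0" "pointwise_elliptic \<phi> \<Omega> A \<kappa>" unfolding PE_def by blast
    then show "strict_LPhi_dissipative \<phi> \<Omega> (diag_system A)"
      unfolding strict_LPhi_dissipative_def
      by (intro exI[of _ \<kappa>] conjI ballI pointwise_imp_phi_form_bound[OF L1 \<Omega>]) auto
  qed
  have b: "(\<exists>\<kappa>>0. LPhi_dissipative \<phi> \<Omega> (diag_system (\<lambda>h x. A h x - \<kappa> *\<^sub>R mat 1))) \<longleftrightarrow> PE"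
  proof
    assume "\<exists>\<kappa>>0. LPhi_dissipative \<phi> \<Omega> (diag_system (\<lambda>h x. A h x - \<kappa> *\<^sub>R mat 1))"
    then obtain \<kappa> where \<kappa>: "\<kappa> > 0" and k: "\<And>u :: real^'n \<Rightarrow> complex^'m. u \<in> phi_test_functions \<phi> \<Omega> \<Longrightarrow>
        0 \<le> Re (phi_form \<phi> \<Omega> (diag_system (\<lambda>h x. A h x - \<kappa> *\<^sub>R mat 1)) u)"
      unfolding LPhi_dissipative_def by blast
    have "pointwise_elliptic \<phi> \<Omega> (\<lambda>h x. A h x - \<kappa> *\<^sub>R mat 1) 0"
    \<comment> \<open>The constant is 0 here because the dissipativity of
      \<open>A - \<kappa>\<Delta>\<close> is not strict.\<close>
    proof (rule pointwise_elliptic_if_test[OF L1' \<Omega>])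
      fix v u :: "real^'n \<Rightarrow> complex^'m"
      assume v: "v \<in> C1_0 \<Omega>" and u: "u \<in> phi_test_functions \<phi> \<Omega>" and vu: "v = sqrt_phi_mult \<phi> u"
      show "0 * (LINT x:\<Omega>|lebesgue. grad_sq v x) \<le> Re (LINT x:\<Omega>|lebesgue.
          integral_Phi_integrand \<phi> (diag_system (\<lambda>h x. A h x - \<kappa> *\<^sub>R mat 1)) v x)"
        using k[OF u] Re_phi_form[OF L1' \<Omega> u] v unfolding vu by simp
    qed
    \<comment> \<open>Moving the identity to the other side shrinks the constant by the factor of
      \<open>ell_form_id_bounds\<close>, taken with the uniform bound
      \<open>Lambda_sq_le\<close>.\<close>
    then have "pointwise_elliptic \<phi> \<Omega> A (\<kappa> * (1 - (Lambda_infinity \<phi>)\<^sup>2))"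
      unfolding pointwise_elliptic_def
    proof (eventually_elim, intro impI allI)
      fix x h and \<eta> \<omega> :: "complex^'m" and t :: real
      assume *: "x \<in> \<Omega> \<longrightarrow> (\<forall>h \<eta> \<omega> t. norm \<omega> = 1 \<longrightarrow> 0 < t \<longrightarrow>
          0 * (norm \<eta>)\<^sup>2 \<le> ell_form (A h x - \<kappa> *\<^sub>R mat 1) \<omega> (Lambda \<phi> t) \<eta>)"
        and x: "x \<in> \<Omega>" "norm \<omega> = 1" "t > 0"
      have "\<kappa> * ((1 - (Lambda_infinity \<phi>)\<^sup>2) * (norm \<eta>)\<^sup>2) \<le> \<kappa> * ell_form (mat 1) \<omega> (Lambda \<phi> t) \<eta>"
        using ell_form_id_bounds(2)[OF x(2) Lambda_sq_le[OF x(3)]] \<kappa> by (intro mult_left_mono) auto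
      also have "\<dots> \<le> ell_form (A h x) \<omega> (Lambda \<phi> t) \<eta>"
        using *[rule_format, OF x, of \<eta> h] by (simp add: ell_form_diff_id)
      finally show "\<kappa> * (1 - (Lambda_infinity \<phi>)\<^sup>2) * (norm \<eta>)\<^sup>2 \<le> ell_form (A h x) \<omega> (Lambda \<phi> t) \<eta>"
        by (simp add: mult.assoc)
    qed
    moreover have "\<kappa> * (1 - (Lambda_infinity \<phi>)\<^sup>2) > 0" using \<kappa> assms(7) by simp
    ultimately show PE unfolding PE_def by blast
  next
    assume PE
    then obtain \<kappa> where \<kappa>: "\<kappa> > 0" "pointwise_elliptic \<phi> \<Omega> A \<kappa>" unfolding PE_def by blast
    \<comment> \<open>In this direction \<kappa> itself may be subtracted, as the form of the
      identity never exceeds \<open>|\<eta>|^2\<close>.\<close>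
    from \<kappa>(2) have ell: "pointwise_elliptic \<phi> \<Omega> (\<lambda>h x. A h x - \<kappa> *\<^sub>R mat 1) 0"
      unfolding pointwise_elliptic_def
    proof (eventually_elim, intro impI allI)
      fix x h and \<eta> \<omega> :: "complex^'m" and t :: real
      assume *: "x \<in> \<Omega> \<longrightarrow> (\<forall>h \<eta> \<omega> t. norm \<omega> = 1 \<longrightarrow> 0 < t \<longrightarrow>
          \<kappa> * (norm \<eta>)\<^sup>2 \<le> ell_form (A h x) \<omega> (Lambda \<phi> t) \<eta>)"
        and x: "x \<in> \<Omega>" "norm \<omega> = 1" "t > 0"
      have "\<kappa> * ell_form (mat 1) \<omega> (Lambda \<phi> t) \<eta> \<le> \<kappa> * (norm \<eta>)\<^sup>2"
        using ell_form_id_bounds(1)[OF x(2) order_refl] \<kappa>(1) by (intro mult_left_mono) auto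
      then show "0 * (norm \<eta>)\<^sup>2 \<le> ell_form (A h x - \<kappa> *\<^sub>R mat 1) \<omega> (Lambda \<phi> t) \<eta>"
        using *[rule_format, OF x, of \<eta> h] by (simp add: ell_form_diff_id)
    qed
    have "LPhi_dissipative \<phi> \<Omega> (diag_system (\<lambda>h x. A h x - \<kappa> *\<^sub>R mat 1))"
      unfolding LPhi_dissipative_def
      using pointwise_imp_phi_form_bound[OF L1' \<Omega> order_refl ell] by simp
    with \<kappa>(1) show "\<exists>\<kappa>>0. LPhi_dissipative \<phi> \<Omega> (diag_system (\<lambda>h x. A h x - \<kappa> *\<^sub>R mat 1))" by blast
  qed
  have c: "integral_Phi_elliptic \<phi> \<Omega> (diag_system A) \<longleftrightarrow> PE"
  proof
    assume "integral_Phi_elliptic \<phi> \<Omega> (diag_system A)"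
    then obtain \<kappa> where "\<kappa> > 0" and k: "\<And>v :: real^'n \<Rightarrow> complex^'m. v \<in> C1_0 \<Omega> \<Longrightarrow> \<kappa> * (LINT x:\<Omega>|lebesgue. grad_sq v x) \<le>
        Re (LINT x:\<Omega>|lebesgue. integral_Phi_integrand \<phi> (diag_system A) v x)"
      unfolding integral_Phi_elliptic_def by blast
    have "pointwise_elliptic \<phi> \<Omega> A \<kappa>"
      by (rule pointwise_elliptic_if_test[OF L1 \<Omega>]) (rule k)
    with \<open>\<kappa> > 0\<close> show PE unfolding PE_def by blast
  next
    assume PE
    then obtain \<kappa> where "\<kappa> > 0" "pointwise_elliptic \<phi> \<Omega> A \<kappa>" unfolding PE_def by blast
    then show "integral_Phi_elliptic \<phi> \<Omega> (diag_system A)"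
      unfolding integral_Phi_elliptic_def
      by (intro exI[of _ \<kappa>] conjI ballI pointwise_imp_integral_bound[OF L1 \<Omega>]) auto
  qed
  have d: "weak_Phi_elliptic \<phi> \<Omega> (diag_system A) \<longleftrightarrow> PE"
    unfolding PE_def by (rule weak_Phi_elliptic_diag_iff)
  have s: "strong_Phi_elliptic \<phi> \<Omega> (diag_system A) \<longrightarrow> PE"
    unfolding PE_def using strong_Phi_elliptic_imp_pointwise by blast
  show ?thesis using s unfolding a b c d by simp
qed

end
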